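(* Let $1\le r<n$ and let $f:\mathbb{R}^{n\times n}\to\mathbb{R}$ be twice differentiable, satisfying Assumptions A1 (constants $L\ge\mu>0$), A2 (unconstrained minimizer $\mathbf{X}_*$) and A3 (constant $\rho$) of the context, and assume $L/\mu<3$. Then: (a) [No spurious local minimizers] $\mathbf{X}_*$ is the unique local minimizer of the optimization problem $\min\{f(\mathbf{X}):\mathbf{X}\in\mathbb{R}^{n\times n},\ \mathrm{rank}(\mathbf{X})\le r\}$. (b) Every $(\epsilon,\frac{3\mu-L}{4})$-second order local minimizer $\mathbf{X}$ satisfies $\|\mathbf{X}-\mathbf{X}_*\|_F\le\frac{4\epsilon}{3\mu-L}$. Consequently, by the general guarantee for the algorithm PprojGD (perturbed projected gradient descent) recalled in the context, PprojGD run with $\gamma=\frac{3\mu-L}{4}$ converges to an approximate solution close to $\mathbf{X}_*$.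
   Context: $\|\cdot\|_F$ and $\langle\cdot,\cdot\rangle$ are the Frobenius norm and inner product, $\|\cdot\|$ is the operator norm, $\sigma_r(\cdot)$ is the $r$-th largest singular value, and $\mathcal{P}_r$ maps a matrix to its best rank-$r$ approximation (truncated SVD). Assumption A1: for all $\mathbf{X},\mathbf{X}',\mathbf{E}\in\mathbb{R}^{n\times n}$ of rank at most $2r$, $\|\nabla f(\mathbf{X})-\nabla f(\mathbf{X}')\|_F\le L\|\mathbf{X}-\mathbf{X}'\|_F$ and $\langle\nabla^2 f(\mathbf{X})[\mathbf{E}],\mathbf{E}\rangle\ge\mu\|\mathbf{E}\|_F^2$. Assumption A2: $\mathbf{X}_*=\arg\min_{\mathbf{X}\in\mathbb{R}^{n\times n}}f(\mathbf{X})$ satisfies $\mathrm{rank}(\mathbf{X}_* )=r_*\le r$. Assumption A3 ($\rho$-Hessian Lipschitz): $\|\nabla^2f(\mathbf{X})-\nabla^2f(\mathbf{X}')\|\le\rho\|\mathbf{X}-\mathbf{X}'\|_F$ for all $\mathbf{X},\mathbf{X}'\in\mathbb{R}^{n\times n}$ of rank at most $r$. Tangent space, retraction, pullback. For $\mathbf{X}$ of rank $r$ with compact SVD $\mathbf{X}=\mathbf{U}\boldsymbol{\Sigma}\mathbf{V}^T$ ($\mathbf{U},\mathbf{V}\in\mathbb{R}^{n\times r}$) and orthonormal complements $\mathbf{U}^\perp,\mathbf{V}^\perp\in\mathbb{R}^{n\times(n-r)}$, let $T(\mathbf{X})=\{\mathbf{Z}_1\mathbf{X}+\mathbf{X}\mathbf{Z}_2:\mathbf{Z}_1,\mathbf{Z}_2\in\mathbb{R}^{n\times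 n}\}$. For $\mathbf{S}\in T(\mathbf{X})$ with $\mathbf{A}=\mathbf{U}^T(\mathbf{X}+\mathbf{S})\mathbf{V}$ invertible, put $\mathbf{B}=\mathbf{U}^T\mathbf{S}\mathbf{V}^\perp$, $\mathbf{C}=(\mathbf{U}^\perp)^T\mathbf{S}\mathbf{V}$ and $$\mathbf{Retr}_{\mathbf{X}}(\mathbf{S})=[\mathbf{U},\mathbf{U}^\perp]\begin{pmatrix}\mathbf{A}&\mathbf{B}\\ \mathbf{C}&\mathbf{C}\mathbf{A}^{-1}\mathbf{B}\end{pmatrix}[\mathbf{V},\mathbf{V}^\perp]^T .$$ The pullback is $\hat f_{\mathbf{X}}=f\circ\mathbf{Retr}_{\mathbf{X}}$ on (a neighborhood of $0$ in) $T(\mathbf{X})$; its gradient and Hessian are taken on $T(\mathbf{X})$ with the Frobenius inner product. A rank-$r$ matrix $\mathbf{X}$ is an $(\epsilon,\gamma)$-second order local minimizer if $\|\nabla\hat f_{\mathbf{X}}(0)\|_F\le\epsilon$ and $\lambda_{\min}(\nabla^2\hat f_{\mathbf{X}}(0))\ge-\gamma$. Algorithm PprojGD. Inputs: initialization $\mathbf{X}^{(0)}$, step size $\eta$, criterion for improvement $\epsilon$, threshold $\epsilon_T$, perturbation size $\delta$, tangent step size $\eta_T$, number of tangent steps $\mathcal{J}$, maximum number of iterations. At iterate $\mathbf{X}=\mathbf{X}^{(k)}$ compute $\mathbf{X}_+=\mathcal{P}_r(\mathbf{X}-\eta\nabla f(\mathbf{X}))$. If $\|\mathbf{X}_+-\mathbf{X}\|_F\ge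 2\eta\epsilon/3$, set $\mathbf{X}^{(k+1)}=\mathbf{X}_+$. If $\|\mathbf{X}_+-\mathbf{X}\|_F<2\eta\epsilon/3$ and $\sigma_r(\mathbf{X})>2\epsilon_T$, let $\mathbf{X}^{(k+1)}$ be the output of the tangent space steps at $\mathbf{X}$. If $\|\mathbf{X}_+-\mathbf{X}\|_F<2\eta\epsilon/3$ and $\sigma_r(\mathbf{X})<2\epsilon_T$, terminate and return $\mathbf{X}$. Tangent space steps at $\mathbf{X}$: start from $\mathbf{S}^{(0)}=\eta_T\mathbf{S}'$, where $\mathbf{S}'\in T(\mathbf{X})$ is random with $\|\mathbf{S}'\|_F=\delta$; for $j=0,\dots,\mathcal{J}-1$ compute $\mathbf{S}_+=\mathbf{S}^{(j)}-\eta_T\nabla\hat f_{\mathbf{X}}(\mathbf{S}^{(j)})$; if $\|\mathbf{S}_+\|_F\le\epsilon_T$ set $\mathbf{S}^{(j+1)}=\mathbf{S}_+$; otherwise choose $\eta_T'$ such that $\mathbf{S}^{(j+1)}=\mathbf{S}^{(j)}-\eta_T'\nabla\hat f_{\mathbf{X}}(\mathbf{S}^{(j)})$ has $\|\mathbf{S}^{(j+1)}\|_F=\epsilon_T$, and stop, returning $\mathbf{Retr}_{\mathbf{X}}(\mathbf{S}^{(j+1)})$. If not stopped early, return $\mathbf{Retr}_{\mathbf{X}}(\mathbf{S}^{(\mathcal{J})})$. General guarantee for PprojGD referred to in (b) (under A1–A3). Let $M=\max\{\|\nabla\hat f_{\mathbf{X}}(0)\|_F:\mathrm{rank}(\mathbf{X})=r,\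 f(\mathbf{X})\le f(\mathbf{X}^{(0)})\}$ and $\rho_T=12\rho(1+2/\epsilon_T)^2+2M/\epsilon_T^2$. Suppose that, for some $C>0$, $\eta\le\frac1{2L}$, $C\sqrt{\epsilon(\rho+M)}/\gamma\le\epsilon_T\le1$, $\eta_T\le\min(C\epsilon_T/(L+\rho+M),\frac{1}{2L})$, $\delta=\frac{\epsilon}{400\chi^3}$, $\mathcal{J}=\frac{\chi}{\eta_T\sqrt{\rho_T\epsilon}}$, with $$\chi\ge C\Big(4\log\Big(2^{10}(f(\mathbf{X}^{(0)})-f(\mathbf{X}_* ))\Big(\tfrac{2}{(\frac1\eta-L)\eta^2\epsilon^2}+\sqrt{\tfrac{\rho_T}{\epsilon^3}}\Big)\tfrac{\sqrt{2rn}}{\eta_T\sqrt{\rho_T\epsilon}}\Big)-\log\alpha+1\Big).$$ Then within $\frac{f(\mathbf{X}^{(0)})-f(\mathbf{X}_* )}{\min(\frac{1}{100\chi^3}\sqrt{\epsilon^3/\rho_T},\ \eta^2\epsilon^2)}$ iterations, with probability at least $1-\alpha$, PprojGD converges either to an $(\epsilon,\gamma)$-second order local minimizer $\mathbf{X}$ with $\sigma_r(\mathbf{X})\ge2\epsilon_T$, or to an approximate stationary point of $f$ in $\mathbb{R}^{n\times n}$, in the sense that $\|\nabla f(\mathbf{X})\|<\frac83(\epsilon+\epsilon_T/\eta)$. *)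

theory Defs
  imports "HOL-Probability.Probability"
begin

text \<open>On \<^typ>\<open>real^'n^'n\<close> the library's \<^const>\<open>norm\<close> and \<^const>\<open>inner\<close> are the Frobenius norm and inner
  product.  The operator norm of a matrix or of a linear map is \<^const>\<open>onorm\<close>.\<close>


section \<open>Singular values\<close>

definition outer_prod :: "real^'n \<Rightarrow> real^'n \<Rightarrow> real^'n^'n" where
  "outer_prod u v = (\<chi> i j. u $ i * v $ j)"

definition orthonormal_family :: "(nat \<Rightarrow> real^'n) \<Rightarrow> bool" where
  "orthonormal_family u \<longleftrightarrow>
     (\<forall>i<CARD('n). \<forall>j<CARD('n). u i \<bullet> u j = (if i = j then 1 else 0))"

text \<open>A full SVD.  The \<open>u i\<close> and \<open>v i\<close> with \<open>i < CARD('n)\<close> are the columns of the two orthogonal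
  factors.  If \<open>X\<close> has rank \<open>r\<close>, those with \<open>i < r\<close> form the factors of the compact SVD, and
  the remaining ones are the columns of the orthonormal complements.\<close>

definition is_svd :: "real^'n^'n \<Rightarrow> (nat \<Rightarrow> real^'n) \<Rightarrow> (nat \<Rightarrow> real) \<Rightarrow> (nat \<Rightarrow> real^'n) \<Rightarrow> bool" where
  "is_svd X u s v \<longleftrightarrow>
     orthonormal_family u \<and> orthonormal_family v \<and>
     (\<forall>i<CARD('n). 0 \<le> s i) \<and>
     (\<forall>i j. i \<le> j \<and> j < CARD('n) \<longrightarrow> s j \<le> s i) \<and>
     X = (\<Sum>i<CARD('n). s i *\<^sub>R outer_prod (u i) (v i))"

text \<open>The \<open>k\<close>-th largest singular value, with \<open>k\<close> counted from 1.\<close>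

definition singular_value :: "nat \<Rightarrow> real^'n^'n \<Rightarrow> real" where
  "singular_value k X = (THE t. \<exists>u s v. is_svd X u s v \<and> t = s (k - 1))"

text \<open>A relation, since the truncated SVD is unique only if the \<open>r\<close>-th and the next singular value
  differ.\<close>

definition truncated_svd :: "nat \<Rightarrow> real^'n^'n \<Rightarrow> real^'n^'n \<Rightarrow> bool" where
  "truncated_svd r X Y \<longleftrightarrow>
     (\<exists>u s v. is_svd X u s v \<and> Y = (\<Sum>i<r. s i *\<^sub>R outer_prod (u i) (v i)))"


section \<open>Gradients and Hessians on a subspace\<close>

text \<open>The derivative within a proper subspace \<open>T\<close> determines a functional on \<open>T\<close> only, so the gradient
  is required to lie in \<open>T\<close>.  For the same reason \<^term>\<open>hessian_on T F S\<close> is meaningful only on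
  arguments from \<open>T\<close>.\<close>

definition gradient_on :: "(real^'n^'n) set \<Rightarrow> (real^'n^'n \<Rightarrow> real) \<Rightarrow> real^'n^'n \<Rightarrow> real^'n^'n" where
  "gradient_on T F S = (THE g. g \<in> T \<and> (F has_derivative (\<lambda>E. E \<bullet> g)) (at S within T))"

definition hessian_on ::
    "(real^'n^'n) set \<Rightarrow> (real^'n^'n \<Rightarrow> real) \<Rightarrow> real^'n^'n \<Rightarrow> real^'n^'n \<Rightarrow> real^'n^'n" where
  "hessian_on T F S = frechet_derivative (gradient_on T F) (at S within T)"

abbreviation grad :: "(real^'n^'n \<Rightarrow> real) \<Rightarrow> real^'n^'n \<Rightarrow> real^'n^'n" where
  "grad \<equiv> gradient_on UNIV"

abbreviation hess :: "(real^'n^'n \<Rightarrow> real) \<Rightarrow> real^'n^'n \<Rightarrow> real^'n^'n \<Rightarrow> real^'n^'n" where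
  "hess \<equiv> hessian_on UNIV"

definition twice_differentiable :: "(real^'n^'n \<Rightarrow> real) \<Rightarrow> bool" where
  "twice_differentiable f \<longleftrightarrow> (\<forall>X. f differentiable (at X) \<and> grad f differentiable (at X))"

definition lambda_min :: "(real^'n^'n) set \<Rightarrow> (real^'n^'n \<Rightarrow> real^'n^'n) \<Rightarrow> real" where
  "lambda_min T H = Min {c. \<exists>E\<in>T. E \<noteq> 0 \<and> H E = c *\<^sub>R E}"


section \<open>Assumptions on the objective function\<close>

definition assumption_A1 :: "nat \<Rightarrow> real \<Rightarrow> real \<Rightarrow> (real^'n^'n \<Rightarrow> real) \<Rightarrow> bool" where
  "assumption_A1 r L \<mu> f \<longleftrightarrow>
     (\<forall>X X' E. rank X \<le> 2 * r \<and> rank X' \<le> 2 * r \<and> rank E \<le> 2 * r \<longrightarrow>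
        norm (grad f X - grad f X') \<le> L * norm (X - X') \<and>
        hess f X E \<bullet> E \<ge> \<mu> * (norm E)\<^sup>2)"

definition assumption_A2 :: "nat \<Rightarrow> (real^'n^'n \<Rightarrow> real) \<Rightarrow> real^'n^'n \<Rightarrow> bool" where
  "assumption_A2 r f Xs \<longleftrightarrow> is_arg_min f (\<lambda>_. True) Xs \<and> rank Xs \<le> r"

definition assumption_A3 :: "nat \<Rightarrow> real \<Rightarrow> (real^'n^'n \<Rightarrow> real) \<Rightarrow> bool" where
  "assumption_A3 r \<rho> f \<longleftrightarrow>
     (\<forall>X X'. rank X \<le> r \<and> rank X' \<le> r \<longrightarrow>
        onorm (\<lambda>E. hess f X E - hess f X' E) \<le> \<rho> * norm (X - X'))"

definition local_minimizer_on :: "(real^'n^'n \<Rightarrow> real) \<Rightarrow> (real^'n^'n) set \<Rightarrow> real^'n^'n \<Rightarrow> bool" where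
  "local_minimizer_on f D X \<longleftrightarrow> X \<in> D \<and> (\<exists>e>0. \<forall>Y\<in>D. dist Y X < e \<longrightarrow> f X \<le> f Y)"


section \<open>Tangent space, retraction, pullback\<close>

definition tangent_space :: "real^'n^'n \<Rightarrow> (real^'n^'n) set" where
  "tangent_space X = {Z1 ** X + X ** Z2 | Z1 Z2. True}"

definition inverse_block :: "nat \<Rightarrow> (nat \<Rightarrow> nat \<Rightarrow> real) \<Rightarrow> (nat \<Rightarrow> nat \<Rightarrow> real) \<Rightarrow> bool" where
  "inverse_block r A W \<longleftrightarrow>
     (\<forall>i<r. \<forall>j<r. (\<Sum>k<r. A i k * W k j) = (if i = j then 1 else 0) \<and>
                  (\<Sum>k<r. W i k * A k j) = (if i = j then 1 else 0))"

text \<open>Blocks are indexed by their position in the full \<open>n \<times> n\<close> matrix, so \<open>B\<close> is the part of \<open>BC\<close> with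
  \<open>i < r \<le> j\<close> and \<open>C\<close> the part with \<open>j < r \<le> i\<close>; \<open>W\<close> is the inverse of \<open>A\<close>.  The value does not
  depend on the choice of the SVD.  If \<open>A\<close> is singular, the retraction is undefined; the value \<open>X\<close>
  given to it there is arbitrary and is never used near \<open>S = 0\<close> when \<open>X\<close> has rank \<open>r\<close>.\<close>

definition retr :: "nat \<Rightarrow> real^'n^'n \<Rightarrow> real^'n^'n \<Rightarrow> real^'n^'n" where
  "retr r X S =
    (let (u, s, v) = (SOME (u, s, v). is_svd X u s v);
         A = (\<lambda>i j. u i \<bullet> ((X + S) *v v j));
         BC = (\<lambda>i j. u i \<bullet> (S *v v j))
     in if \<exists>W. inverse_block r A W then
          (let W = (SOME W. inverse_block r A W);
               K = (\<lambda>i j. if i < r \<and> j < r then A i j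
                          else if i < r \<or> j < r then BC i j
                          else (\<Sum>k<r. \<Sum>l<r. BC i k * W k l * BC l j))
           in \<Sum>i<CARD('n). \<Sum>j<CARD('n). K i j *\<^sub>R outer_prod (u i) (v j))
        else X)"

definition pullback :: "nat \<Rightarrow> (real^'n^'n \<Rightarrow> real) \<Rightarrow> real^'n^'n \<Rightarrow> real^'n^'n \<Rightarrow> real" where
  "pullback r f X = f \<circ> retr r X"

definition second_order_local_minimizer ::
    "nat \<Rightarrow> (real^'n^'n \<Rightarrow> real) \<Rightarrow> real \<Rightarrow> real \<Rightarrow> real^'n^'n \<Rightarrow> bool" where
  "second_order_local_minimizer r f \<epsilon> \<gamma> X \<longleftrightarrow>
     rank X = r \<and>
     norm (gradient_on (tangent_space X) (pullback r f X) 0) \<le> \<epsilon> \<and>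
     lambda_min (tangent_space X) (hessian_on (tangent_space X) (pullback r f X) 0) \<ge> - \<gamma>"


section \<open>Perturbed projected gradient descent\<close>

record 'm pprojgd_input =
  init :: 'm
  step_size :: real
  improvement :: real
  threshold :: real
  perturb_size :: real
  tangent_step_size :: real
  tangent_step_count :: nat
  max_iterations :: nat

text \<open>\<open>g\<close> is the gradient of the pullback.  A step that would leave the ball of radius \<open>\<epsilon>\<^sub>T\<close> is shortened
  to end on its boundary.\<close>

fun tangent_steps ::
    "(real^'n^'n \<Rightarrow> real^'n^'n) \<Rightarrow> real \<Rightarrow> real \<Rightarrow> nat \<Rightarrow> real^'n^'n \<Rightarrow> real^'n^'n" where
  "tangent_steps g \<eta>\<^sub>T \<epsilon>\<^sub>T 0 S = S"
| "tangent_steps g \<eta>\<^sub>T \<epsilon>\<^sub>T (Suc j) S =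
    (if norm (S - \<eta>\<^sub>T *\<^sub>R g S) \<le> \<epsilon>\<^sub>T then tangent_steps g \<eta>\<^sub>T \<epsilon>\<^sub>T j (S - \<eta>\<^sub>T *\<^sub>R g S)
     else S - (SOME t. 0 \<le> t \<and> t \<le> \<eta>\<^sub>T \<and> norm (S - t *\<^sub>R g S) = \<epsilon>\<^sub>T) *\<^sub>R g S)"

text \<open>For \<open>G\<close> uniform on the unit ball, the result is uniform on the sphere of radius \<open>\<delta>\<close> in the tangent
  space: \<^const>\<open>closest_point\<close> is the orthogonal projection, so the law of the projected point is invariant
  under rotations of the tangent space.\<close>

definition random_tangent :: "real^'n^'n \<Rightarrow> real \<Rightarrow> real^'n^'n \<Rightarrow> real^'n^'n" where
  "random_tangent X \<delta> G = \<delta> *\<^sub>R sgn (closest_point (tangent_space X) G)"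

text \<open>\<open>Pr\<close> is the rank-\<open>r\<close> truncation used by the algorithm.  A terminated run stays where it is.\<close>

definition pprojgd_step ::
    "(real^'n^'n \<Rightarrow> real^'n^'n) \<Rightarrow> nat \<Rightarrow> (real^'n^'n \<Rightarrow> real) \<Rightarrow> (real^'n^'n) pprojgd_input \<Rightarrow>
     real^'n^'n \<Rightarrow> real^'n^'n \<Rightarrow> real^'n^'n" where
  "pprojgd_step Pr r f p G X =
    (let Xp = Pr (X - step_size p *\<^sub>R grad f X)
     in if norm (Xp - X) \<ge> 2 * step_size p * improvement p / 3 then Xp
        else if singular_value r X > 2 * threshold p then
          retr r X (tangent_steps (gradient_on (tangent_space X) (pullback r f X))
            (tangent_step_size p) (threshold p) (tangent_step_count p)
            (tangent_step_size p *\<^sub>R random_tangent X (perturb_size p) G))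
        else X)"

fun pprojgd_iterate ::
    "(real^'n^'n \<Rightarrow> real^'n^'n) \<Rightarrow> nat \<Rightarrow> (real^'n^'n \<Rightarrow> real) \<Rightarrow> (real^'n^'n) pprojgd_input \<Rightarrow>
     (nat \<Rightarrow> real^'n^'n) \<Rightarrow> nat \<Rightarrow> real^'n^'n" where
  "pprojgd_iterate Pr r f p \<omega> 0 = init p"
| "pprojgd_iterate Pr r f p \<omega> (Suc k) =
     pprojgd_step Pr r f p (\<omega> k) (pprojgd_iterate Pr r f p \<omega> k)"

definition noise :: "(nat \<Rightarrow> real^'n^'n) measure" where
  "noise = (\<Pi>\<^sub>M k\<in>UNIV. uniform_measure lborel (cball 0 1))"

text \<open>The event contains a measurable set of probability at least \<open>q\<close>; for a measurable event this just says
  that its probability is at least \<open>q\<close>.\<close>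

definition with_prob_at_least :: "'w measure \<Rightarrow> real \<Rightarrow> ('w \<Rightarrow> bool) \<Rightarrow> bool" where
  "with_prob_at_least M q P \<longleftrightarrow> (\<exists>A\<in>sets M. (\<forall>\<omega>\<in>A. P \<omega>) \<and> measure M A \<ge> q)"

definition pprojgd_reaches ::
    "(real^'n^'n \<Rightarrow> real^'n^'n) \<Rightarrow> nat \<Rightarrow> (real^'n^'n \<Rightarrow> real) \<Rightarrow> (real^'n^'n) pprojgd_input \<Rightarrow>
     real \<Rightarrow> real \<Rightarrow> (real^'n^'n \<Rightarrow> bool) \<Rightarrow> bool" where
  "pprojgd_reaches Pr r f p N q Q \<longleftrightarrow>
     with_prob_at_least noise q
       (\<lambda>\<omega>. \<exists>k \<le> max_iterations p. real k \<le> N \<and> Q (pprojgd_iterate Pr r f p \<omega> k))"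


section \<open>The general guarantee for the algorithm\<close>

text \<open>A supremum, since the maximum need not be attained.\<close>

definition M_bound :: "nat \<Rightarrow> (real^'n^'n \<Rightarrow> real) \<Rightarrow> real^'n^'n \<Rightarrow> real" where
  "M_bound r f X0 =
     Sup {norm (gradient_on (tangent_space X) (pullback r f X) 0) | X. rank X = r \<and> f X \<le> f X0}"

definition rho_T :: "nat \<Rightarrow> (real^'n^'n \<Rightarrow> real) \<Rightarrow> real \<Rightarrow> (real^'n^'n) pprojgd_input \<Rightarrow> real" where
  "rho_T r f \<rho> p =
     12 * \<rho> * (1 + 2 / threshold p)\<^sup>2 + 2 * M_bound r f (init p) / (threshold p)\<^sup>2"

definition iteration_bound ::
    "nat \<Rightarrow> (real^'n^'n \<Rightarrow> real) \<Rightarrow> real \<Rightarrow> real^'n^'n \<Rightarrow> (real^'n^'n) pprojgd_input \<Rightarrow> real \<Rightarrow> real" where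
  "iteration_bound r f \<rho> Xs p chi =
     (f (init p) - f Xs) /
     min (1 / (100 * chi ^ 3) * sqrt (improvement p ^ 3 / rho_T r f \<rho> p))
         ((step_size p)\<^sup>2 * (improvement p)\<^sup>2)"

definition admissible_input ::
    "real \<Rightarrow> nat \<Rightarrow> (real^'n^'n \<Rightarrow> real) \<Rightarrow> real \<Rightarrow> real \<Rightarrow> real^'n^'n \<Rightarrow>
     (real^'n^'n) pprojgd_input \<Rightarrow> real \<Rightarrow> real \<Rightarrow> real \<Rightarrow> bool" where
  "admissible_input C r f L \<rho> Xs p \<gamma> chi \<alpha> \<longleftrightarrow>
    (let \<eta> = step_size p; \<epsilon> = improvement p; \<epsilon>\<^sub>T = threshold p; \<eta>\<^sub>T = tangent_step_size p;
         M = M_bound r f (init p); \<rho>\<^sub>T = rho_T r f \<rho> p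
     in rank (init p) \<le> r \<and>
        0 < \<eta> \<and> 0 < \<epsilon> \<and> 0 < \<epsilon>\<^sub>T \<and> 0 < \<eta>\<^sub>T \<and> 0 < \<gamma> \<and> 0 < chi \<and> 0 < \<alpha> \<and>
        \<eta> \<le> 1 / (2 * L) \<and>
        C * sqrt (\<epsilon> * (\<rho> + M)) / \<gamma> \<le> \<epsilon>\<^sub>T \<and> \<epsilon>\<^sub>T \<le> 1 \<and>
        \<eta>\<^sub>T \<le> min (C * \<epsilon>\<^sub>T / (L + \<rho> + M)) (1 / (2 * L)) \<and>
        perturb_size p = \<epsilon> / (400 * chi ^ 3) \<and>
        tangent_step_count p = nat \<lceil>chi / (\<eta>\<^sub>T * sqrt (\<rho>\<^sub>T * \<epsilon>))\<rceil> \<and>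
        real (max_iterations p) \<ge> iteration_bound r f \<rho> Xs p chi \<and>
        chi \<ge> C * (4 * ln (2 ^ 10 * (f (init p) - f Xs) *
                            (2 / ((1 / \<eta> - L) * \<eta>\<^sup>2 * \<epsilon>\<^sup>2) + sqrt (\<rho>\<^sub>T / \<epsilon> ^ 3)) *
                            (sqrt (2 * real r * real CARD('n)) / (\<eta>\<^sub>T * sqrt (\<rho>\<^sub>T * \<epsilon>))))
                  - ln \<alpha> + 1))"

text \<open>The guarantee for \<open>f\<close> with constant \<open>C\<close>; \<open>f\<close> is meant to satisfy the three assumptions above.\<close>

definition pprojgd_guarantee ::
    "(real^'n^'n \<Rightarrow> real^'n^'n) \<Rightarrow> real \<Rightarrow> nat \<Rightarrow> (real^'n^'n \<Rightarrow> real) \<Rightarrow> real \<Rightarrow> real \<Rightarrow> real^'n^'n \<Rightarrow> bool" where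
  "pprojgd_guarantee Pr C r f L \<rho> Xs \<longleftrightarrow>
    (\<forall>p \<gamma> chi \<alpha>. admissible_input C r f L \<rho> Xs p \<gamma> chi \<alpha> \<longrightarrow>
       pprojgd_reaches Pr r f p (iteration_bound r f \<rho> Xs p chi) (1 - \<alpha>)
         (\<lambda>X. (second_order_local_minimizer r f (improvement p) \<gamma> X \<and>
                singular_value r X \<ge> 2 * threshold p) \<or>
              onorm ((*v) (grad f X)) < 8 / 3 * (improvement p + threshold p / step_size p)))"

end

theory Submission
  imports Defs
begin

text \<open>Let \<open>G\<close> be the gradient of \<open>f\<close> at a rank-\<open>r\<close> matrix \<open>X\<close> with smallest nonzero singular value \<open>\<sigma>\<close>, and
  let \<open>e = X - Xs\<close>, \<open>c = (L + \<mu>) / 2\<close>.  The Hessian of the pullback at \<open>0\<close> is the Hessian of \<open>f\<close> plus a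
  curvature term; tested on \<open>a v\<^sub>r\<^sup>T + u\<^sub>r b\<^sup>T\<close> with \<open>a\<close>, \<open>b\<close> normal to the column and row space of \<open>X\<close>, the
  second-order condition bounds the operator norm of the normal part \<open>N\<close> of \<open>G\<close> by
  \<open>(L + \<gamma>) \<sigma> = 3/2 c \<sigma>\<close>.

  The matrices whose columns lie in the span of the columns of \<open>X\<close> and \<open>Xs\<close> form a linear space of matrices
  of rank at most \<open>2r\<close>, on which \<open>f\<close> is strongly convex and smooth.  Cocoercivity there says that the
  projection \<open>P G\<close> of \<open>G\<close> is within \<open>(L - \<mu>) / 2 norm e\<close> of \<open>c e\<close>, and up to the tangential part, of norm at
  most \<open>\<epsilon>\<close>, \<open>P G\<close> equals \<open>P N\<close>.  On the other hand \<open>norm (P N - c e) \<ge> c / 2 norm e\<close>: by Apollonius this says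
  that \<open>Xs\<close> has distance at least half the norm of \<open>M = - 4/(3c) P N\<close> from \<open>X + M\<close>, and this holds for every
  matrix of rank at most \<open>r\<close> since the operator norm of \<open>M\<close> is at most \<open>2\<sigma>\<close>.  Together,
  \<open>(c / 2 - (L - \<mu>) / 2) norm e = (3\<mu> - L) / 4 norm e \<le> \<epsilon>\<close>.\<close>

section \<open>Matrices\<close>

text \<open>A1 says nothing beyond rank 2r, so convexity and smoothness may be used only along lines
  and in linear spaces that stay within this rank: the line through X and Xs, tangent lines at X,
  and the matrices fixed by P from the left. That is why P acts on columns only and why the upper
  Hessian bound is stated for special directions. The curvature term has weight 1/\<sigma>, so N is
  controlled only relative to \<sigma>. This is enough because a matrix of rank at most r that
  captures part of M has to give up directions in which X has singular values at least \<sigma>; the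
  bound 2\<sigma> on M is where this trade costs at most the factor 1/2. The 3/4 in the Apollonius
  step undoes the scaling of M, since c * 3/4 * 4/(3c) = 1. A local minimizer of rank below r has no
  pullback. There every rank-one perturbation is feasible, so its whole gradient vanishes. The
  smallest eigenvalue bounds the quadratic form only for a symmetric Hessian; symmetry on the
  tangent space is derived from differentiability of the gradient of the pullback at 0.\<close>

lemma inner_matrix_matrix_mult_left:
  fixes A :: "real^'m^'k" and B :: "real^'n^'m" and C :: "real^'n^'k"
  shows "(A ** B) \<bullet> C = B \<bullet> (transpose A ** C)"
proof -
  have "(A ** B) \<bullet> C = (\<Sum>i\<in>UNIV. \<Sum>j\<in>UNIV. \<Sum>k\<in>UNIV. A$i$k * B$k$j * C$i$j)"
    by (simp add: inner_vec_def matrix_matrix_mult_def sum_distrib_right)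
  also have "\<dots> = (\<Sum>k\<in>UNIV. \<Sum>j\<in>UNIV. \<Sum>i\<in>UNIV. A$i$k * B$k$j * C$i$j)"
    by (subst sum.swap, subst (2) sum.swap, subst sum.swap) rule
  also have "\<dots> = B \<bullet> (transpose A ** C)"
    by (simp add: inner_vec_def matrix_matrix_mult_def transpose_def sum_distrib_left mult_ac)
  finally show ?thesis .
qed

lemma inner_transpose_transpose:
  fixes A B :: "real^'n^'m"
  shows "transpose A \<bullet> transpose B = A \<bullet> B"
  by (simp add: inner_vec_def transpose_def) (rule sum.swap)

lemma inner_matrix_matrix_mult_right:
  fixes A :: "real^'m^'k" and B :: "real^'n^'m" and C :: "real^'n^'k"
  shows "(A ** B) \<bullet> C = A \<bullet> (C ** transpose B)"
proof -
  have "(A ** B) \<bullet> C = (transpose B ** transpose A) \<bullet> transpose C"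
    by (metis inner_transpose_transpose matrix_transpose_mul)
  also have "\<dots> = transpose A \<bullet> (B ** transpose C)"
    by (simp add: inner_matrix_matrix_mult_left)
  also have "\<dots> = A \<bullet> (C ** transpose B)"
    by (metis inner_transpose_transpose matrix_transpose_mul transpose_transpose)
  finally show ?thesis .
qed

lemma norm_matrix_power2_rows:
  fixes A :: "real^'n^'m"
  shows "(norm A)\<^sup>2 = (\<Sum>i\<in>UNIV. (norm (A$i))\<^sup>2)"
  by (simp add: power2_norm_eq_inner inner_vec_def)

lemma matrix_mult_row:
  fixes A :: "real^'m^'k" and B :: "real^'n^'m"
  shows "(A ** B)$i = transpose B *v (A$i)"
  by (simp add: vec_eq_iff matrix_matrix_mult_def matrix_vector_mult_def transpose_def mult.commute
      del: transpose_matrix_vector)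

text \<open>Each row of \<open>A ** B\<close> is \<open>transpose B\<close> applied to a row of
  \<open>A\<close>, and squared row norms add up. This is the mixed estimate, operator norm times
  Frobenius norm, that carries the bound 2\<sigma> later.\<close>

lemma norm_matrix_mult_le_bound:
  fixes A :: "real^'m^'k" and B :: "real^'n^'m"
  assumes "\<And>x. norm (transpose B *v x) \<le> K * norm x" "0 \<le> K"
  shows "norm (A ** B) \<le> K * norm A"
proof (rule power2_le_imp_le)
  have "(norm (A ** B))\<^sup>2 = (\<Sum>i\<in>UNIV. (norm (transpose B *v (A$i)))\<^sup>2)"
    unfolding norm_matrix_power2_rows matrix_mult_row ..
  also have "\<dots> \<le> (\<Sum>i\<in>UNIV. (K * norm (A$i))\<^sup>2)"
    by (intro sum_mono power_mono assms norm_ge_zero)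
  also have "\<dots> = (K * norm A)\<^sup>2"
    by (simp add: power_mult_distrib norm_matrix_power2_rows sum_distrib_left)
  finally show "(norm (A ** B))\<^sup>2 \<le> (K * norm A)\<^sup>2" .
  show "0 \<le> K * norm A" using assms(2) by simp
qed

lemma norm_matrix_vector_mult_le:
  fixes A :: "real^'n^'m"
  shows "norm (A *v x) \<le> norm A * norm x"
proof (rule power2_le_imp_le)
  have "(norm (A *v x))\<^sup>2 = (\<Sum>i\<in>UNIV. (A$i \<bullet> x)\<^sup>2)"
    unfolding power2_norm_eq_inner inner_vec_def[of "A *v x"]
    by (simp add: matrix_vector_mul_component power2_eq_square)
  also have "\<dots> \<le> (\<Sum>i\<in>UNIV. (norm (A$i) * norm x)\<^sup>2)"
  proof (rule sum_mono)
    fix i show "(A$i \<bullet> x)\<^sup>2 \<le> (norm (A$i) * norm x)\<^sup>2"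
      by (rule abs_le_square_iff[THEN iffD1]) (simp add: Cauchy_Schwarz_ineq2)
  qed
  also have "\<dots> = (norm A * norm x)\<^sup>2"
    by (simp add: power_mult_distrib norm_matrix_power2_rows sum_distrib_right)
  finally show "(norm (A *v x))\<^sup>2 \<le> (norm A * norm x)\<^sup>2" .
qed simp

lemma norm_transpose [simp]:
  fixes A :: "real^'n^'m"
  shows "norm (transpose A) = norm A"
  by (simp add: norm_eq_sqrt_inner inner_transpose_transpose)

lemma norm_matrix_matrix_mult_le:
  fixes A :: "real^'m^'k" and B :: "real^'n^'m"
  shows "norm (A ** B) \<le> norm A * norm B"
  using norm_matrix_mult_le_bound[of B "norm B" A] norm_matrix_vector_mult_le[of "transpose B"]
  by (simp add: mult.commute)

lemma bounded_bilinear_matrix_matrix_mult: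
  "bounded_bilinear ((**) :: real^'m^'k \<Rightarrow> real^'n^'m \<Rightarrow> real^'n^'k)"
proof (unfold_locales, goal_cases)
  case 1 show ?case by (simp add: matrix_matrix_mult_def vec_eq_iff algebra_simps sum.distrib)
next
  case 2 show ?case by (rule matrix_add_ldistrib)
next
  case (3 r a b) show ?case by (simp add: matrix_matrix_mult_def vec_eq_iff sum_distrib_left mult_ac)
next
  case (4 a r b) show ?case by (simp add: matrix_matrix_mult_def vec_eq_iff sum_distrib_left mult_ac)
next
  case 5 show ?case
    by (intro exI[of _ 1] allI) (use norm_matrix_matrix_mult_le in simp)
qed

interpretation mat_mult: bounded_bilinear "(**) :: real^'m^'k \<Rightarrow> real^'n^'m \<Rightarrow> real^'n^'k"
  by (rule bounded_bilinear_matrix_matrix_mult)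

lemma bounded_bilinear_matrix_vector_mult:
  "bounded_bilinear ((*v) :: real^'n^'m \<Rightarrow> real^'n \<Rightarrow> real^'m)"
proof (unfold_locales, goal_cases)
  case 1 show ?case by (rule matrix_vector_mult_add_rdistrib)
next
  case 2 show ?case by (rule matrix_vector_right_distrib)
next
  case (3 r a b) show ?case by (simp add: scaleR_matrix_vector_assoc)
next
  case (4 a r b) show ?case by (simp add: matrix_vector_mult_scaleR)
next
  case 5 show ?case
    by (intro exI[of _ 1] allI) (use norm_matrix_vector_mult_le in simp)
qed

interpretation mat_vec: bounded_bilinear "(*v) :: real^'n^'m \<Rightarrow> real^'n \<Rightarrow> real^'m"
  by (rule bounded_bilinear_matrix_vector_mult)

lemma bounded_linear_transpose: "bounded_linear (transpose :: real^'n^'m \<Rightarrow> real^'m^'n)"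
proof (unfold_locales, goal_cases)
  case 3 show ?case by (intro exI[of _ 1]) simp
qed (simp_all add: transpose_def vec_eq_iff)

lemma transpose_zero [simp]: "transpose (0 :: real^'n^'m) = 0"
  by (simp add: transpose_def vec_eq_iff)

lemmas transpose_diff = linear_diff[OF bounded_linear.linear[OF bounded_linear_transpose]]
lemmas transpose_sum = linear_sum[OF bounded_linear.linear[OF bounded_linear_transpose]]

lemmas mat_distribs = mat_mult.add_left mat_mult.add_right mat_mult.diff_left mat_mult.diff_right
  mat_mult.scaleR_left mat_mult.scaleR_right mat_mult.minus_left mat_mult.minus_right
  matrix_mul_assoc

lemmas mat_vec_distribs = mat_vec.add_left mat_vec.add_right mat_vec.diff_left mat_vec.diff_right
  mat_vec.scaleR_left mat_vec.scaleR_right mat_vec.minus_left mat_vec.minus_right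

section \<open>Outer products\<close>

lemma outer_prod_mult_vec: "outer_prod u v *v x = (v \<bullet> x) *\<^sub>R u"
  by (simp add: outer_prod_def vec_eq_iff matrix_vector_mult_def inner_vec_def sum_distrib_left mult_ac)

lemma matrix_mult_outer_prod: "A ** outer_prod u v = outer_prod (A *v u) v"
  by (simp add: matrix_eq matrix_vector_mul_assoc[symmetric] outer_prod_mult_vec mat_vec.scaleR_right)

lemma transpose_outer_prod: "transpose (outer_prod u v) = outer_prod v u"
  by (simp add: outer_prod_def transpose_def vec_eq_iff mult.commute)

lemma outer_prod_matrix_mult: "outer_prod u v ** A = outer_prod u (transpose A *v v)"
  by (simp add: outer_prod_def matrix_matrix_mult_def vec_eq_iff matrix_vector_mult_def
      transpose_def sum_distrib_left mult_ac del: transpose_matrix_vector)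

lemma inner_outer_prod: "M \<bullet> outer_prod u v = u \<bullet> (M *v v)"
  by (simp add: outer_prod_def inner_vec_def matrix_vector_mult_def sum_distrib_left mult_ac)

lemma inner_outer_prod_outer_prod: "outer_prod a b \<bullet> outer_prod c d = (a \<bullet> c) * (b \<bullet> d)"
  by (simp add: inner_outer_prod outer_prod_mult_vec inner_commute)

lemma norm_outer_prod: "norm (outer_prod a b) = norm a * norm b"
  by (simp add: norm_eq_sqrt_inner inner_outer_prod_outer_prod real_sqrt_mult)

lemma bounded_bilinear_outer_prod:
  "bounded_bilinear (outer_prod :: real^'n \<Rightarrow> real^'n \<Rightarrow> real^'n^'n)"
proof (unfold_locales, goal_cases)
  case 5 show ?case
    by (intro exI[of _ 1]) (simp add: norm_eq_sqrt_inner inner_outer_prod_outer_prod real_sqrt_mult)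
qed (simp_all add: outer_prod_def vec_eq_iff algebra_simps)

interpretation outer: bounded_bilinear "outer_prod :: real^'n \<Rightarrow> real^'n \<Rightarrow> real^'n^'n"
  by (rule bounded_bilinear_outer_prod)

lemma inner_matrix_vector_mult:
  fixes A :: "real^'n^'m"
  shows "(A *v x) \<bullet> y = x \<bullet> (transpose A *v y)"
  by (metis dot_lmul_matrix inner_commute transpose_matrix_vector)

section \<open>Orthonormal families\<close>

lemma orthonormal_familyD:
  fixes u :: "nat \<Rightarrow> real^'n"
  assumes "orthonormal_family u" "i < CARD('n)" "j < CARD('n)"
  shows "u i \<bullet> u j = (if i = j then 1 else 0)"
  using assms by (simp add: orthonormal_family_def)

text \<open>CARD('n) orthonormal vectors are independent, hence span; the remainder of the expansion
  is orthogonal to all of them and so to itself.\<close>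

lemma orthonormal_expansion:
  fixes u :: "nat \<Rightarrow> real^'n"
  assumes u: "orthonormal_family u"
  shows "(\<Sum>i<CARD('n). (u i \<bullet> x) *\<^sub>R u i) = x"
proof -
  let ?B = "u ` {..<CARD('n)}"
  have inj: "inj_on u {..<CARD('n)}"
    by (rule inj_onI) (metis lessThan_iff orthonormal_familyD[OF u] zero_neq_one)
  have "pairwise orthogonal ?B"
    unfolding pairwise_def orthogonal_def using orthonormal_familyD[OF u] by auto
  moreover have "0 \<notin> ?B" using orthonormal_familyD[OF u] by force
  ultimately have "independent ?B" by (rule pairwise_orthogonal_independent)
  moreover have "card ?B = CARD('n)" using inj by (simp add: card_image)
  ultimately have span: "span ?B = UNIV"
    using card_ge_dim_independent[of ?B UNIV] by (auto simp: dim_UNIV)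
  define y where "y = x - (\<Sum>i<CARD('n). (u i \<bullet> x) *\<^sub>R u i)"
  have "orthogonal y b" if "b \<in> ?B" for b
  proof -
    obtain j where j: "j < CARD('n)" "b = u j" using \<open>b \<in> ?B\<close> by auto
    have "(\<Sum>i<CARD('n). (u i \<bullet> x) * (u i \<bullet> u j)) = (\<Sum>i<CARD('n). if i = j then u i \<bullet> x else 0)"
      using j by (intro sum.cong) (auto simp: orthonormal_familyD[OF u])
    also have "\<dots> = u j \<bullet> x" using j by simp
    finally show ?thesis
      using j by (simp add: y_def orthogonal_def inner_diff_left inner_sum_left inner_commute[of x])
  qed
  then have "orthogonal y y"
    using orthogonal_to_span[of y ?B y] span by simp
  then show ?thesis by (simp add: y_def orthogonal_def)
qed

lemma orthonormal_parseval:
  fixes u :: "nat \<Rightarrow> real^'n"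
  assumes u: "orthonormal_family u"
  shows "x \<bullet> y = (\<Sum>i<CARD('n). (u i \<bullet> x) * (u i \<bullet> y))"
proof -
  have "x \<bullet> y = (\<Sum>i<CARD('n). (u i \<bullet> x) *\<^sub>R u i) \<bullet> y"
    by (simp add: orthonormal_expansion[OF u])
  then show ?thesis by (simp add: inner_sum_left)
qed

lemma orthonormal_eqI:
  fixes u :: "nat \<Rightarrow> real^'n"
  assumes u: "orthonormal_family u" and "\<And>i. i < CARD('n) \<Longrightarrow> u i \<bullet> x = u i \<bullet> y"
  shows "x = y"
  using orthonormal_expansion[OF u, of x] orthonormal_expansion[OF u, of y] assms(2)
  by (metis (mono_tags, lifting) lessThan_iff sum.cong)

lemma orthonormal_matrix_eqI:
  fixes u v :: "nat \<Rightarrow> real^'n"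
  assumes u: "orthonormal_family u" and v: "orthonormal_family v"
    and eq: "\<And>i j. i < CARD('n) \<Longrightarrow> j < CARD('n) \<Longrightarrow> u i \<bullet> (A *v v j) = u i \<bullet> (B *v v j)"
  shows "A = B"
proof (rule matrix_eq[THEN iffD2, rule_format])
  fix x
  have "A *v v j = B *v v j" if "j < CARD('n)" for j
    using eq that by (intro orthonormal_eqI[OF u]) auto
  then have "A *v (\<Sum>i<CARD('n). (v i \<bullet> x) *\<^sub>R v i) = B *v (\<Sum>i<CARD('n). (v i \<bullet> x) *\<^sub>R v i)"
    by (simp add: mat_vec.sum_right mat_vec.scaleR_right)
  then show "A *v x = B *v x" by (simp add: orthonormal_expansion[OF v])
qed

text \<open>Parseval for each row, then an exchange of sums: the Frobenius norm can be computed in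
  the basis of singular vectors.\<close>

lemma norm_matrix_power2_orthonormal:
  fixes v :: "nat \<Rightarrow> real^'n" and A :: "real^'n^'m"
  assumes v: "orthonormal_family v"
  shows "(norm A)\<^sup>2 = (\<Sum>i<CARD('n). (norm (A *v v i))\<^sup>2)"
proof -
  have "(norm A)\<^sup>2 = (\<Sum>k\<in>UNIV. \<Sum>i<CARD('n). (v i \<bullet> A$k)\<^sup>2)"
    unfolding norm_matrix_power2_rows power2_norm_eq_inner
    by (subst orthonormal_parseval[OF v]) (simp add: power2_eq_square)
  also have "\<dots> = (\<Sum>i<CARD('n). \<Sum>k\<in>UNIV. (v i \<bullet> A$k)\<^sup>2)" by (rule sum.swap)
  also have "\<dots> = (\<Sum>i<CARD('n). (norm (A *v v i))\<^sup>2)"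
    unfolding power2_norm_eq_inner inner_vec_def[of "A *v _"]
    by (simp add: matrix_vector_mul_component power2_eq_square inner_commute)
  finally show ?thesis .
qed

section \<open>Orthogonal projections and rank\<close>

definition orth_proj :: "real^'n^'n \<Rightarrow> bool" where
  "orth_proj P \<longleftrightarrow> transpose P = P \<and> P ** P = P"

lemma orth_proj_compl: "orth_proj P \<Longrightarrow> orth_proj (mat 1 - P)"
  by (simp add: orth_proj_def transpose_diff mat_distribs)

lemma orth_proj_mult_inner:
  fixes P :: "real^'n^'n"
  assumes "orth_proj P"
  shows "(P *v x) \<bullet> y = x \<bullet> (P *v y)" "P *v (P *v x) = P *v x"
  using assms inner_matrix_vector_mult[of P x y]
  by (auto simp: orth_proj_def matrix_vector_mul_assoc simp del: transpose_matrix_vector)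

lemma orth_proj_pythagoras_vec:
  assumes "orth_proj P"
  shows "(norm x)\<^sup>2 = (norm (P *v x))\<^sup>2 + (norm ((mat 1 - P) *v x))\<^sup>2"
proof -
  have "orthogonal (P *v x) ((mat 1 - P) *v x)"
    by (simp add: orthogonal_def orth_proj_mult_inner[OF assms] mat_vec_distribs inner_diff_right)
  from norm_add_Pythagorean[OF this] show ?thesis
    by (simp add: mat_vec_distribs)
qed

lemma norm_orth_proj_vec_le:
  assumes "orth_proj P"
  shows "norm (P *v x) \<le> norm x"
  by (rule power2_le_imp_le) (simp_all add: orth_proj_pythagoras_vec[OF assms, of x])

lemma inner_orth_proj_left:
  assumes "orth_proj P"
  shows "(P ** A) \<bullet> B = A \<bullet> (P ** B)" "P ** (P ** A) = P ** A"
  using assms inner_matrix_matrix_mult_left[of P A B] matrix_mul_assoc[of P P A]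
  unfolding orth_proj_def by metis+

lemma inner_orth_proj_right:
  assumes "orth_proj P"
  shows "(A ** P) \<bullet> B = A \<bullet> (B ** P)" "A ** P ** P = A ** P"
  using assms inner_matrix_matrix_mult_right[of A P B] matrix_mul_assoc[of A P P]
  unfolding orth_proj_def by metis+

lemma orth_proj_pythagoras:
  assumes "orth_proj P"
  shows "(norm A)\<^sup>2 = (norm (P ** A))\<^sup>2 + (norm ((mat 1 - P) ** A))\<^sup>2"
proof -
  have "orthogonal (P ** A) ((mat 1 - P) ** A)"
    by (simp add: orthogonal_def inner_orth_proj_left[OF assms] mat_mult.diff_left inner_diff_right)
  from norm_add_Pythagorean[OF this] show ?thesis
    by (simp add: mat_mult.diff_left)
qed

lemma norm_orth_proj_le:
  assumes "orth_proj P"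
  shows "norm (P ** A) \<le> norm A"
  by (rule power2_le_imp_le) (simp_all add: orth_proj_pythagoras[OF assms, of A])

text \<open>The second claim is the trace: the squared Frobenius norm of an orthogonal projection
  counts dimensions, which is how rank enters the norm estimates.\<close>

lemma orth_proj_sum_outer:
  fixes b :: "'i \<Rightarrow> real^'n"
  assumes fin: "finite I"
    and on: "\<And>i j. i \<in> I \<Longrightarrow> j \<in> I \<Longrightarrow> b i \<bullet> b j = (if i = j then 1 else 0)"
  shows "orth_proj (\<Sum>i\<in>I. outer_prod (b i) (b i))"
    and "(norm (\<Sum>i\<in>I. outer_prod (b i) (b i)))\<^sup>2 = card I"
proof -
  let ?P = "\<Sum>i\<in>I. outer_prod (b i) (b i)"
  have Pb: "?P *v b i = b i" if "i \<in> I" for i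
  proof -
    have "?P *v b i = (\<Sum>j\<in>I. if j = i then b i else 0)"
      unfolding mat_vec.sum_left outer_prod_mult_vec using that by (intro sum.cong) (auto simp: on)
    then show ?thesis using that fin by simp
  qed
  then have "?P ** ?P = ?P"
    by (subst mat_mult.sum_right) (simp add: matrix_mult_outer_prod Pb)
  then show "orth_proj ?P"
    by (simp add: orth_proj_def transpose_sum transpose_outer_prod)
  have "(norm ?P)\<^sup>2 = (\<Sum>i\<in>I. b i \<bullet> (?P *v b i))"
    by (simp add: power2_norm_eq_inner inner_sum_right inner_outer_prod)
  also have "\<dots> = card I" using on by (simp add: Pb)
  finally show "(norm ?P)\<^sup>2 = card I" .
qed

lemma exists_orth_proj:
  fixes S :: "(real^'n) set"
  assumes "subspace S"
  obtains P where "orth_proj P" "\<And>x. P *v x \<in> S" "\<And>x. x \<in> S \<Longrightarrow> P *v x = x" "(norm P)\<^sup>2 = dim S"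
proof -
  obtain B where B: "B \<subseteq> S" "pairwise orthogonal B" "\<And>x. x \<in> B \<Longrightarrow> norm x = 1"
    "independent B" "card B = dim S" "span B = S"
    by (rule orthonormal_basis_subspace[OF assms]) blast
  have fin: "finite B" using B(4) by (rule independent_imp_finite)
  have on: "a \<bullet> b = (if a = b then 1 else 0)" if "a \<in> B" "b \<in> B" for a b
    using that B(2,3) by (auto simp: pairwise_def orthogonal_def norm_eq_1)
  define P where "P = (\<Sum>b\<in>B. outer_prod b b)"
  have P: "orth_proj P" "(norm P)\<^sup>2 = card B"
    using orth_proj_sum_outer[OF fin, of "\<lambda>x. x", OF on] by (simp_all add: P_def)
  have Px: "P *v x = (\<Sum>b\<in>B. (b \<bullet> x) *\<^sub>R b)" for x
    by (simp add: P_def mat_vec.sum_left outer_prod_mult_vec)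
  have "P *v x \<in> S" for x
    unfolding Px using B(1) assms by (intro subspace_sum subspace_scale) auto
  moreover have "P *v x = x" if "x \<in> S" for x
  proof -
    have "x \<in> span B" using that B(6) by simp
    then show ?thesis
    proof (induction rule: span_induct_alt)
      case (step c b y)
      have "(\<Sum>a\<in>B. (a \<bullet> b) *\<^sub>R a) = (\<Sum>a\<in>B. if a = b then b else 0)"
        using step by (intro sum.cong) (auto simp: on)
      then have "P *v b = b" using step fin by (simp add: Px)
      then show ?case using step by (simp add: mat_vec_distribs)
    qed simp
  qed
  ultimately show thesis by (intro that[of P]) (simp_all add: P B(5))
qed

lemma rank_le_dimI:
  fixes A :: "real^'n^'m"
  assumes "\<And>x. A *v x \<in> S"
  shows "rank A \<le> dim S"
  unfolding rank_dim_range using assms by (intro dim_subset) auto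

lemma subspace_range_matrix: "subspace (range ((*v) (A :: real^'n^'m)))"
  by (intro linear_subspace_image matrix_vector_mul_linear) auto

lemma rank_add_le:
  fixes A B :: "real^'n^'m"
  shows "rank (A + B) \<le> rank A + rank B"
proof -
  let ?S = "{x + y |x y. x \<in> range ((*v) A) \<and> y \<in> range ((*v) B)}"
  have "rank (A + B) \<le> dim ?S"
    by (rule rank_le_dimI) (auto simp: mat_vec_distribs)
  also have "\<dots> \<le> rank A + rank B"
    using dim_sums_Int[OF subspace_range_matrix[of A] subspace_range_matrix[of B]]
    by (simp add: rank_dim_range)
  finally show ?thesis .
qed

lemma rank_scaleR_le:
  fixes A :: "real^'n^'m"
  shows "rank (c *\<^sub>R A) \<le> rank A"
  unfolding rank_dim_range[of A]
  by (rule rank_le_dimI) (auto simp: mat_vec_distribs simp flip: mat_vec.scaleR_right)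

lemma rank_diff_le:
  fixes A B :: "real^'n^'m"
  shows "rank (A - B) \<le> rank A + rank B"
  using rank_add_le[of A "- 1 *\<^sub>R B"] rank_scaleR_le[of "- 1" B] by simp

lemma rank_sum_outer_prod_le:
  assumes "finite I"
  shows "rank (\<Sum>i\<in>I. outer_prod (a i) (b i)) \<le> card I"
proof -
  have "rank (\<Sum>i\<in>I. outer_prod (a i) (b i)) \<le> dim (span (a ` I))"
    by (rule rank_le_dimI)
      (unfold mat_vec.sum_left outer_prod_mult_vec, intro span_sum span_scale span_base imageI)
  also have "\<dots> \<le> card (a ` I)" using assms by (simp add: dim_le_card')
  also have "\<dots> \<le> card I" using assms by (rule card_image_le)
  finally show ?thesis .
qed

lemma rank_outer_prod_le: "rank (outer_prod a b) \<le> 1"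
  using rank_sum_outer_prod_le[of "{()}" "\<lambda>_. a" "\<lambda>_. b"] by simp

lemma exists_orth_proj_range:
  fixes A :: "real^'m^'n"
  obtains P where "orth_proj P" "P ** A = A" "(norm P)\<^sup>2 = rank A"
proof -
  obtain P where P: "orth_proj P" "\<And>x. P *v x \<in> range ((*v) A)"
      "\<And>x. x \<in> range ((*v) A) \<Longrightarrow> P *v x = x" "(norm P)\<^sup>2 = dim (range ((*v) A))"
    by (rule exists_orth_proj[OF subspace_range_matrix[of A]]) blast
  have "P ** A = A"
    using P(3) by (auto simp: matrix_eq matrix_vector_mul_assoc[symmetric])
  then show thesis using P(1,4) by (intro that[of P]) (simp_all add: rank_dim_range)
qed

lemma exists_orth_proj_range2:
  fixes A B :: "real^'m^'n"
  obtains P where "orth_proj P" "P ** A = A" "P ** B = B" "rank P \<le> rank A + rank B"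
proof -
  let ?S = "{x + y |x y. x \<in> range ((*v) A) \<and> y \<in> range ((*v) B)}"
  have "subspace ?S" by (intro subspace_sums subspace_range_matrix)
  then obtain P where P: "orth_proj P" "\<And>x. P *v x \<in> ?S" "\<And>x. x \<in> ?S \<Longrightarrow> P *v x = x"
      "(norm P)\<^sup>2 = dim ?S"
    by (rule exists_orth_proj) (rule that)
  have zero: "0 \<in> range ((*v) A)" "0 \<in> range ((*v) B)"
    by (auto intro: subspace_0 subspace_range_matrix)
  have "A *v x \<in> ?S" for x
    by (rule CollectI, rule exI[of _ "A *v x"], rule exI[of _ 0]) (use zero in simp)
  then have "P ** A = A"
    using P(3) by (auto simp: matrix_eq matrix_vector_mul_assoc[symmetric])
  moreover have "B *v x \<in> ?S" for x
    by (rule CollectI, rule exI[of _ 0], rule exI[of _ "B *v x"]) (use zero in simp)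
  then have "P ** B = B"
    using P(3) by (auto simp: matrix_eq matrix_vector_mul_assoc[symmetric])
  moreover have "rank P \<le> dim ?S"
    by (rule rank_le_dimI) (rule P(2))
  then have "rank P \<le> rank A + rank B"
    using dim_sums_Int[OF subspace_range_matrix[of A] subspace_range_matrix[of B]]
    by (simp add: rank_dim_range)
  ultimately show thesis using P(1) by (intro that[of P])
qed

text \<open>\<open>A\<close> may be restricted to the row space of \<open>E\<close> without changing
  the inner product, and the projection onto that space has Frobenius norm
  \<open>sqrt (rank E)\<close>. This converts an operator norm bound on a gradient into a Frobenius
  estimate.\<close>

lemma inner_le_onorm_rank:
  fixes A E :: "real^'n^'n"
  shows "\<bar>A \<bullet> E\<bar> \<le> onorm ((*v) A) * sqrt (rank E) * norm E"
proof -
  obtain P where P: "orth_proj P" "P ** transpose E = transpose E" "(norm P)\<^sup>2 = rank (transpose E)"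
    by (rule exists_orth_proj_range)
  have "transpose (P ** transpose E) = transpose (transpose E)"
    by (simp only: P(2))
  then have E: "E ** P = E"
    using P(1) by (simp add: matrix_transpose_mul orth_proj_def)
  have "(A ** P) \<bullet> E = A \<bullet> E"
    by (simp only: inner_orth_proj_right(1)[OF P(1)] E)
  then have "\<bar>A \<bullet> E\<bar> = \<bar>(A ** P) \<bullet> E\<bar>" by simp
  also have "\<dots> \<le> norm (A ** P) * norm E" by (rule Cauchy_Schwarz_ineq2)
  also have "norm (A ** P) = norm (transpose (A ** P))" by simp
  also have "transpose (A ** P) = P ** transpose A"
    using P(1) by (simp add: matrix_transpose_mul orth_proj_def)
  also have "norm (P ** transpose A) * norm E \<le> (onorm ((*v) A) * norm P) * norm E"
    using onorm[OF matrix_vector_mul_bounded_linear[of A]]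
    by (intro mult_right_mono norm_matrix_mult_le_bound)
      (auto simp: onorm_pos_le simp del: transpose_matrix_vector)
  also have "norm P = sqrt (rank E)"
    using P(3) by (simp add: rank_transpose real_sqrt_unique)
  finally show ?thesis .
qed

section \<open>Existence of the singular value decomposition\<close>

lemma inner_sgn_self: "x \<bullet> sgn x = norm x" for x :: "'a::real_inner"
  by (cases "x = 0") (simp_all add: sgn_div_norm dot_square_norm power2_eq_square)

lemma exists_unit_orthogonal:
  fixes u :: "nat \<Rightarrow> real^'n"
  assumes "k < CARD('n)"
  obtains x where "norm x = 1" "\<And>i. i < k \<Longrightarrow> u i \<bullet> x = 0"
proof -
  have "dim (u ` {..<k}) \<le> card (u ` {..<k})" by (rule dim_le_card') simp
  also have "\<dots> \<le> k" using card_image_le[of "{..<k}" u] by simp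
  finally have "dim (u ` {..<k}) < DIM(real^'n)" using assms by simp
  then obtain x where x: "x \<noteq> 0" "\<And>y. y \<in> span (u ` {..<k}) \<Longrightarrow> orthogonal x y"
    by (rule orthogonal_to_subspace_exists) blast
  have "u i \<bullet> sgn x = 0" if "i < k" for i
    using x(2)[of "u i"] that by (auto simp: orthogonal_def span_base sgn_div_norm inner_commute)
  then show thesis using that[of "sgn x"] x(1) by (simp add: norm_sgn)
qed

text \<open>The construction is greedy: the next pair of singular vectors maximizes \<open>a \<bullet> X b\<close> over the unit
  vectors orthogonal to the previous ones.\<close>

definition partial_svd ::
    "real^'n^'n \<Rightarrow> nat \<Rightarrow> (nat \<Rightarrow> real^'n) \<Rightarrow> (nat \<Rightarrow> real) \<Rightarrow> (nat \<Rightarrow> real^'n) \<Rightarrow> bool" where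
  "partial_svd X k u s v \<longleftrightarrow>
      (\<forall>i<k. \<forall>j<k. u i \<bullet> u j = (if i = j then 1 else 0)) \<and>
      (\<forall>i<k. \<forall>j<k. v i \<bullet> v j = (if i = j then 1 else 0)) \<and>
      (\<forall>i<k. 0 \<le> s i) \<and>
      (\<forall>i<k. X *v v i = s i *\<^sub>R u i \<and> transpose X *v u i = s i *\<^sub>R v i) \<and>
      (\<forall>i j. i \<le> j \<and> j < k \<longrightarrow> s j \<le> s i) \<and>
      (\<forall>i<k. \<forall>a b. norm a = 1 \<and> norm b = 1 \<and> (\<forall>j<k. u j \<bullet> a = 0 \<and> v j \<bullet> b = 0) \<longrightarrow>
         a \<bullet> (X *v b) \<le> s i)"

lemma exists_partial_svd:
  fixes X :: "real^'n^'n"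
  assumes "k \<le> CARD('n)"
  shows "\<exists>u s v. partial_svd X k u s v"
  using assms
proof (induction k)
  case 0
  show ?case by (simp add: partial_svd_def)
next
  case (Suc k)
  then obtain u s v where usv: "partial_svd X k u s v" by auto
  note parts = usv[unfolded partial_svd_def]
  note u = parts[THEN conjunct1, rule_format]
    and v = parts[THEN conjunct2, THEN conjunct1, rule_format]
    and s = parts[THEN conjunct2, THEN conjunct2, THEN conjunct1, rule_format]
    and X_uv = parts[THEN conjunct2, THEN conjunct2, THEN conjunct2, THEN conjunct1, rule_format]
    and dec = parts[THEN conjunct2, THEN conjunct2, THEN conjunct2, THEN conjunct2, THEN conjunct1, rule_format]
    and mx = parts[THEN conjunct2, THEN conjunct2, THEN conjunct2, THEN conjunct2, THEN conjunct2, rule_format]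
  note Xv = X_uv[THEN conjunct1] and Xu = X_uv[THEN conjunct2]
  let ?K = "{p. norm (fst p) = 1 \<and> norm (snd p) = 1 \<and> (\<forall>j<k. u j \<bullet> fst p = 0 \<and> v j \<bullet> snd p = 0)}"
  have kn: "k < CARD('n)" using Suc.prems by simp
  have "closed ?K"
  proof -
    have "?K = {p. norm (fst p) = 1} \<inter> {p. norm (snd p) = 1} \<inter>
        (\<Inter>j\<in>{..<k}. {p. u j \<bullet> fst p = 0} \<inter> {p. v j \<bullet> snd p = 0})" by auto
    also have "closed \<dots>"
      by (intro closed_Int closed_INT ballI closed_Collect_eq continuous_intros)
    finally show ?thesis .
  qed
  moreover have "bounded ?K"
  proof (rule boundedI)
    fix p assume "p \<in> ?K"
    then show "norm p \<le> 2" using norm_Pair_le[of "fst p" "snd p"] by simp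
  qed
  ultimately have "compact ?K" by (simp add: compact_eq_bounded_closed)
  moreover have "?K \<noteq> {}"
  proof -
    obtain a where "norm a = 1" "\<And>i. i < k \<Longrightarrow> u i \<bullet> a = 0"
      by (rule exists_unit_orthogonal[OF kn, of u]) (rule that)
    moreover obtain b where "norm b = 1" "\<And>i. i < k \<Longrightarrow> v i \<bullet> b = 0"
      by (rule exists_unit_orthogonal[OF kn, of v]) (rule that)
    ultimately have "(a, b) \<in> ?K" by simp
    then show ?thesis by (metis (no_types, lifting) empty_iff)
  qed
  moreover have "continuous_on ?K (\<lambda>p. fst p \<bullet> (X *v snd p))"
    by (intro continuous_intros mat_vec.continuous_on)
  ultimately have "\<exists>p\<in>?K. \<forall>q\<in>?K. fst q \<bullet> (X *v snd q) \<le> fst p \<bullet> (X *v snd p)"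
    by (rule continuous_attains_sup)
  then obtain p where p: "p \<in> ?K" "\<forall>q\<in>?K. fst q \<bullet> (X *v snd q) \<le> fst p \<bullet> (X *v snd p)"
    by (elim bexE)
  define a b t where "a = fst p" and "b = snd p" and "t = a \<bullet> (X *v b)"
  have a: "norm a = 1" "\<And>j. j < k \<Longrightarrow> u j \<bullet> a = 0"
    and b: "norm b = 1" "\<And>j. j < k \<Longrightarrow> v j \<bullet> b = 0"
    using p(1) by (auto simp: a_def b_def)
  have best: "a' \<bullet> (X *v b') \<le> t"
    if "norm a' = 1" "norm b' = 1" "\<And>j. j < k \<Longrightarrow> u j \<bullet> a' = 0" "\<And>j. j < k \<Longrightarrow> v j \<bullet> b' = 0" for a' b'
    using p(2)[rule_format, of "(a', b')"] that by (simp add: a_def b_def t_def)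
  \<comment> \<open>Replacing a by -a changes the sign of the value, so the maximum cannot be
    negative.\<close>
  have t0: "0 \<le> t"
    using best[of "- a" b] a b by (simp add: t_def)
  \<comment> \<open>The equality case of Cauchy-Schwarz.\<close>
  have collinear: "w = t *\<^sub>R c" if "c \<bullet> w = t" "norm w \<le> t" "norm c = 1" for w c :: "real^'n"
  proof -
    have "(w - t *\<^sub>R c) \<bullet> (w - t *\<^sub>R c) = w \<bullet> w - 2 * t * (c \<bullet> w) + t * t * (c \<bullet> c)"
      by (simp add: inner_diff_left inner_diff_right inner_commute algebra_simps)
    then have "(norm (w - t *\<^sub>R c))\<^sup>2 = (norm w)\<^sup>2 - t\<^sup>2"
      using that(1,3) by (simp add: power2_norm_eq_inner[symmetric] norm_eq_1[symmetric])
        (simp add: power2_eq_square)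
    also have "\<dots> \<le> 0" using that(2) t0 by (simp add: power_mono)
    finally show ?thesis by simp
  qed
  \<comment> \<open>\<open>transpose X\<close> maps each earlier \<open>u j\<close> to a multiple of
    \<open>v j\<close>, so \<open>X *v b\<close> is orthogonal to the earlier \<open>u j\<close>.
    Its normalization therefore competes with a, and maximality bounds its norm by t.\<close>
  have Xb: "X *v b = t *\<^sub>R a"
  proof (rule collinear)
    have "u j \<bullet> (X *v b) = 0" if "j < k" for j
      using Xu[OF that] b(2)[OF that] inner_matrix_vector_mult[of X b "u j"]
      by (simp add: inner_commute del: transpose_matrix_vector)
    then have "sgn (X *v b) \<bullet> (X *v b) \<le> t" if "X *v b \<noteq> 0"
      using that b by (intro best) (simp_all add: norm_sgn sgn_div_norm)
    then show "norm (X *v b) \<le> t"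
      using t0 by (cases "X *v b = 0") (simp_all add: inner_sgn_self inner_commute)
  qed (simp_all add: a t_def)
  have Xa: "transpose X *v a = t *\<^sub>R b"
  proof (rule collinear)
    have "v j \<bullet> (transpose X *v a) = 0" if "j < k" for j
      using Xv[OF that] a(2)[OF that] inner_matrix_vector_mult[of X "v j" a]
      by (simp add: inner_commute del: transpose_matrix_vector)
    then have "a \<bullet> (X *v sgn (transpose X *v a)) \<le> t" if "transpose X *v a \<noteq> 0"
      using that a by (intro best) (simp_all add: norm_sgn sgn_div_norm del: transpose_matrix_vector)
    moreover have "a \<bullet> (X *v sgn (transpose X *v a)) = norm (transpose X *v a)"
      by (metis inner_commute inner_matrix_vector_mult inner_sgn_self)
    ultimately show "norm (transpose X *v a) \<le> t"
      using t0 by (cases "transpose X *v a = 0") (simp_all del: transpose_matrix_vector)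
    show "b \<bullet> (transpose X *v a) = t"
      by (metis inner_commute inner_matrix_vector_mult t_def)
  qed (simp_all add: b)
  \<comment> \<open>The maximality clause kept in \<open>partial_svd\<close> pays off here: a and b
    were admissible in every earlier step.\<close>
  have ts: "t \<le> s i" if "i < k" for i
    using mx[OF that, of a b] a b by (simp add: t_def)
  let ?u = "u(k := a)" and ?v = "v(k := b)" and ?s = "s(k := t)"
  have c1: "\<forall>i<Suc k. \<forall>j<Suc k. ?u i \<bullet> ?u j = (if i = j then 1 else 0)"
    using u a by (auto simp: less_Suc_eq inner_commute norm_eq_1)
  have c2: "\<forall>i<Suc k. \<forall>j<Suc k. ?v i \<bullet> ?v j = (if i = j then 1 else 0)"
    using v b by (auto simp: less_Suc_eq inner_commute norm_eq_1)
  have c3: "\<forall>i<Suc k. 0 \<le> ?s i"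
    using s t0 by (auto simp: less_Suc_eq)
  have c4: "\<forall>i<Suc k. X *v ?v i = ?s i *\<^sub>R ?u i \<and> transpose X *v ?u i = ?s i *\<^sub>R ?v i"
    using Xv Xu Xa Xb by (auto simp: less_Suc_eq simp del: transpose_matrix_vector)
  have c5: "\<forall>i j. i \<le> j \<and> j < Suc k \<longrightarrow> ?s j \<le> ?s i"
    using dec ts by (auto simp: less_Suc_eq)
  have c6: "a' \<bullet> (X *v b') \<le> ?s i" if "i < Suc k" "norm a' = 1" "norm b' = 1"
      and j: "\<forall>j<Suc k. ?u j \<bullet> a' = 0 \<and> ?v j \<bullet> b' = 0" for i a' b'
  proof -
    have orth: "u j \<bullet> a' = 0 \<and> v j \<bullet> b' = 0" if "j < k" for j
      using j[rule_format, of j] that by simp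
    show ?thesis
      using that(1-3) orth best[of a' b'] mx[of i a' b'] by (cases "i = k") auto
  qed
  have "partial_svd X (Suc k) ?u ?s ?v"
    unfolding partial_svd_def
    by (intro conjI c1 c2 c3 c4 c5) (use c6 in \<open>intro allI impI, elim conjE, simp\<close>)
  then show ?case by blast
qed

text \<open>After CARD('n) greedy steps the right singular vectors form a basis, on which X agrees
  with the sum.\<close>

lemma exists_svd: "\<exists>u s v. is_svd (X :: real^'n^'n) u s v"
proof -
  obtain u s v where usv: "partial_svd X CARD('n) u s v"
    using exists_partial_svd[of "CARD('n)" X] by auto
  then have uv: "orthonormal_family u" "orthonormal_family v"
    and s: "\<forall>i<CARD('n). 0 \<le> s i" "\<forall>i j. i \<le> j \<and> j < CARD('n) \<longrightarrow> s j \<le> s i"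
    and Xv: "\<And>i. i < CARD('n) \<Longrightarrow> X *v v i = s i *\<^sub>R u i"
    by (simp_all add: partial_svd_def orthonormal_family_def)
  have "X = (\<Sum>i<CARD('n). s i *\<^sub>R outer_prod (u i) (v i))"
  proof (rule matrix_eq[THEN iffD2, rule_format])
    fix x
    have "X *v x = X *v (\<Sum>i<CARD('n). (v i \<bullet> x) *\<^sub>R v i)"
      by (simp add: orthonormal_expansion[OF uv(2)])
    also have "\<dots> = (\<Sum>i<CARD('n). s i *\<^sub>R outer_prod (u i) (v i)) *v x"
      by (simp add: mat_vec.sum_left mat_vec.sum_right mat_vec_distribs outer_prod_mult_vec Xv mult.commute)
    finally show "X *v x = (\<Sum>i<CARD('n). s i *\<^sub>R outer_prod (u i) (v i)) *v x" .
  qed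
  then have "is_svd X u s v" using uv s unfolding is_svd_def by blast
  then show ?thesis by blast
qed

section \<open>Gradients on subspaces\<close>

text \<open>The whole line lies in T, so a derivative within T already gives an ordinary two-sided
  derivative in t. One-variable calculus enters the development through this lemma.\<close>

lemma has_vector_derivative_along_line:
  fixes F :: "'a::real_normed_vector \<Rightarrow> 'b::real_normed_vector"
  assumes T: "subspace T" "S \<in> T" "E \<in> T"
    and F: "(F has_derivative D) (at (S + t *\<^sub>R E) within T)"
  shows "((\<lambda>t. F (S + t *\<^sub>R E)) has_vector_derivative D E) (at t)"
proof -
  interpret D: bounded_linear D using F by (rule has_derivative_bounded_linear)
  have "((\<lambda>t. S + t *\<^sub>R E) has_derivative (\<lambda>t. t *\<^sub>R E)) (at t)"
    by (auto intro!: derivative_eq_intros)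
  moreover have "(F has_derivative D) (at (S + t *\<^sub>R E) within range (\<lambda>t. S + t *\<^sub>R E))"
    by (rule has_derivative_subset[OF F]) (use T in \<open>auto intro: subspace_add subspace_scale\<close>)
  ultimately have "((\<lambda>t. F (S + t *\<^sub>R E)) has_derivative (\<lambda>t. D (t *\<^sub>R E))) (at t)"
    by (rule has_derivative_in_compose)
  then show ?thesis by (simp add: has_vector_derivative_def D.scaleR)
qed

lemma has_derivative_on_subspace_unique:
  fixes F :: "'a::real_normed_vector \<Rightarrow> 'b::real_normed_vector"
  assumes T: "subspace T" "S \<in> T" "E \<in> T"
    and D1: "(F has_derivative D1) (at S within T)" and D2: "(F has_derivative D2) (at S within T)"
  shows "D1 E = D2 E"
  using has_vector_derivative_along_line[OF T, where t = 0] D1 D2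
  by (auto intro: vector_derivative_unique_at)

text \<open>Two candidates lie in T, hence so does their difference; testing both derivatives on
  that difference shows that it is orthogonal to itself.\<close>

lemma gradient_on_eqI:
  assumes T: "subspace T" "S \<in> T" and g: "g \<in> T"
    and F: "(F has_derivative (\<lambda>E. E \<bullet> g)) (at S within T)"
  shows "gradient_on T F S = g"
  unfolding gradient_on_def
proof (rule the_equality)
  fix g' assume g': "g' \<in> T \<and> (F has_derivative (\<lambda>E. E \<bullet> g')) (at S within T)"
  then have "(g' - g) \<bullet> g' = (g' - g) \<bullet> g"
    using F T g by (intro has_derivative_on_subspace_unique[of T S "g' - g" F]) (auto intro: subspace_diff)
  then have "(g' - g) \<bullet> (g' - g) = 0" by (simp add: inner_diff_right)
  then show "g' = g" by simp
qed (use g F in simp)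

text \<open>\<open>frechet_derivative\<close> selects one of possibly many derivatives within T, but
  all of them agree on T.\<close>

lemma frechet_derivative_on_subspace:
  assumes "subspace T" "S \<in> T" "E \<in> T" "(F has_derivative D) (at S within T)"
  shows "frechet_derivative F (at S within T) E = D E"
proof (rule has_derivative_on_subspace_unique[OF assms(1-3)])
  show "(F has_derivative frechet_derivative F (at S within T)) (at S within T)"
    using assms(4) by (auto simp: differentiable_def simp flip: frechet_derivative_works)
qed (rule assms(4))

lemma linear_functional_eq_inner:
  fixes D :: "'a::euclidean_space \<Rightarrow> real"
  assumes "linear D"
  shows "D = (\<lambda>x. x \<bullet> (\<Sum>b\<in>Basis. D b *\<^sub>R b))"
proof
  fix x
  have "D x = D (\<Sum>b\<in>Basis. (x \<bullet> b) *\<^sub>R b)" by (simp add: euclidean_representation)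
  also have "\<dots> = x \<bullet> (\<Sum>b\<in>Basis. D b *\<^sub>R b)"
    by (simp add: linear_sum[OF assms] linear_cmul[OF assms] inner_sum_right mult.commute)
  finally show "D x = x \<bullet> (\<Sum>b\<in>Basis. D b *\<^sub>R b)" .
qed

lemma grad_has_derivative:
  assumes "f differentiable (at X)"
  shows "(f has_derivative (\<lambda>E. E \<bullet> grad f X)) (at X)"
proof -
  obtain D where D: "(f has_derivative D) (at X)"
    using assms by (auto simp: differentiable_def)
  define g where "g = (\<Sum>b\<in>Basis. D b *\<^sub>R b)"
  have "D = (\<lambda>E. E \<bullet> g)"
    unfolding g_def by (rule linear_functional_eq_inner) (rule has_derivative_linear[OF D])
  then have g: "(f has_derivative (\<lambda>E. E \<bullet> g)) (at X)" using D by simp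
  moreover have "grad f X = g"
    by (rule gradient_on_eqI) (use g in auto)
  ultimately show ?thesis by simp
qed

section \<open>Cocoercivity on a subspace\<close>

text \<open>The tangent inequality of convexity and the descent lemma, read off from the
  monotonicity of one-variable functions along the segment. The gradient need not lie in W: only its
  inner products with elements of W matter.\<close>

lemma quadratic_bounds_on_subspace:
  fixes h :: "'a::real_inner \<Rightarrow> real" and g :: "'a \<Rightarrow> 'a"
  assumes W: "subspace W" and h: "\<And>x. x \<in> W \<Longrightarrow> (h has_derivative (\<lambda>E. E \<bullet> g x)) (at x)"
    and lower: "\<And>x y. x \<in> W \<Longrightarrow> y \<in> W \<Longrightarrow> 0 \<le> (g x - g y) \<bullet> (x - y)"
    and upper: "\<And>x y. x \<in> W \<Longrightarrow> y \<in> W \<Longrightarrow> (g x - g y) \<bullet> (x - y) \<le> l * (norm (x - y))\<^sup>2"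
    and p: "p \<in> W" and d: "d \<in> W"
  shows "h p + g p \<bullet> d \<le> h (p + d)" "h (p + d) \<le> h p + g p \<bullet> d + l / 2 * (norm d)\<^sup>2"
proof -
  have in_W: "p + t *\<^sub>R d \<in> W" for t using W p d by (simp add: subspace_add subspace_scale)
  have deriv: "((\<lambda>t. h (p + t *\<^sub>R d)) has_real_derivative d \<bullet> g (p + t *\<^sub>R d)) (at t)" for t
    unfolding has_real_derivative_iff_has_vector_derivative
    by (rule has_vector_derivative_along_line[where T = UNIV]) (use h in_W in auto)
  have lo: "g p \<bullet> d \<le> d \<bullet> g (p + t *\<^sub>R d)" if "0 \<le> t" for t
    using lower[OF in_W[of t] p] that
    by (cases "t = 0") (auto simp: inner_diff_left inner_diff_right inner_commute zero_le_mult_iff)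
  have up: "d \<bullet> g (p + t *\<^sub>R d) \<le> g p \<bullet> d + l * t * (norm d)\<^sup>2" if "0 \<le> t" for t
  proof (cases "t = 0")
    case False
    then have "t * ((g (p + t *\<^sub>R d) - g p) \<bullet> d) \<le> t * (l * t * (norm d)\<^sup>2)"
      using upper[OF in_W[of t] p] that by (simp add: power_mult_distrib power2_eq_square[of t] mult_ac)
    then show ?thesis using that False
      by (simp add: inner_diff_left inner_diff_right inner_commute)
  qed (simp add: inner_commute)
  have "h (p + 0 *\<^sub>R d) - 0 * (g p \<bullet> d) \<le> h (p + 1 *\<^sub>R d) - 1 * (g p \<bullet> d)"
  proof (rule DERIV_nonneg_imp_nondecreasing[where f = "\<lambda>t. h (p + t *\<^sub>R d) - t * (g p \<bullet> d)"])
    fix t :: real assume "0 \<le> t"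
    then show "\<exists>y. ((\<lambda>t. h (p + t *\<^sub>R d) - t * (g p \<bullet> d)) has_real_derivative y) (at t) \<and> 0 \<le> y"
      using lo[of t]
      by (intro exI[of _ "d \<bullet> g (p + t *\<^sub>R d) - g p \<bullet> d"]) (auto intro!: derivative_eq_intros deriv)
  qed simp
  then show "h p + g p \<bullet> d \<le> h (p + d)" by simp
  have "h (p + 1 *\<^sub>R d) - 1 * (g p \<bullet> d) - l / 2 * 1\<^sup>2 * (norm d)\<^sup>2
      \<le> h (p + 0 *\<^sub>R d) - 0 * (g p \<bullet> d) - l / 2 * 0\<^sup>2 * (norm d)\<^sup>2"
  proof (rule DERIV_nonpos_imp_nonincreasing
      [where f = "\<lambda>t. h (p + t *\<^sub>R d) - t * (g p \<bullet> d) - l / 2 * t\<^sup>2 * (norm d)\<^sup>2"])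
    fix t :: real assume "0 \<le> t"
    then show "\<exists>y. ((\<lambda>t. h (p + t *\<^sub>R d) - t * (g p \<bullet> d) - l / 2 * t\<^sup>2 * (norm d)\<^sup>2)
        has_real_derivative y) (at t) \<and> y \<le> 0"
      using up[of t]
      by (intro exI[of _ "d \<bullet> g (p + t *\<^sub>R d) - g p \<bullet> d - l * t * (norm d)\<^sup>2"])
        (auto intro!: derivative_eq_intros deriv)
  qed simp
  then show "h (p + d) \<le> h p + g p \<bullet> d + l / 2 * (norm d)\<^sup>2" by simp
qed

text \<open>\<open>a\<close> plays the role of the projection of the gradient difference onto \<open>W\<close>.\<close>

lemma cocoercive_on_subspace:
  fixes h :: "'a::real_inner \<Rightarrow> real" and g :: "'a \<Rightarrow> 'a"
  assumes W: "subspace W" and h: "\<And>x. x \<in> W \<Longrightarrow> (h has_derivative (\<lambda>E. E \<bullet> g x)) (at x)"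
    and lower: "\<And>x y. x \<in> W \<Longrightarrow> y \<in> W \<Longrightarrow> 0 \<le> (g x - g y) \<bullet> (x - y)"
    and upper: "\<And>x y. x \<in> W \<Longrightarrow> y \<in> W \<Longrightarrow> (g x - g y) \<bullet> (x - y) \<le> l * (norm (x - y))\<^sup>2"
    and x: "x \<in> W" and y: "y \<in> W" and a: "a \<in> W" "\<And>w. w \<in> W \<Longrightarrow> w \<bullet> (g x - g y) = w \<bullet> a"
    and l: "0 \<le> l"
  shows "(norm a)\<^sup>2 \<le> l * (a \<bullet> (x - y))"
proof -
  note bounds = quadratic_bounds_on_subspace[OF W h lower upper]
  have inW: "x - y \<in> W" "y - x \<in> W" using W x y by (auto intro: subspace_diff)
  \<comment> \<open>The value at q - w is bounded below by the tangent at p and above by the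
    quadratic model at q.\<close>
  have gap: "h p + g p \<bullet> (q - p) + (g q - g p) \<bullet> w - l / 2 * (norm w)\<^sup>2 \<le> h q"
    if "p \<in> W" "q \<in> W" "w \<in> W" for p q w
  proof -
    have "h p + g p \<bullet> (q - w - p) \<le> h (p + (q - w - p))"
      using that W by (intro bounds(1)) (auto intro: subspace_diff)
    moreover have "h (q + - w) \<le> h q + g q \<bullet> (- w) + l / 2 * (norm (- w))\<^sup>2"
      using that W by (intro bounds(2)) (auto intro: subspace_neg)
    ultimately show ?thesis
      by (simp add: inner_diff_left inner_diff_right algebra_simps)
  qed
  \<comment> \<open>The two orders of x and y, with w = c a and w = - c a, are added and the values
    of h cancel. The step c stays free: c = 1/l is the best choice, and for l = 0 a large c forces a
    = 0.\<close>
  have main: "2 * c * (norm a)\<^sup>2 - l * c\<^sup>2 * (norm a)\<^sup>2 \<le> a \<bullet> (x - y)" for c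
  proof -
    have ca: "c *\<^sub>R a \<in> W" "- (c *\<^sub>R a) \<in> W" using W a(1) by (auto intro: subspace_scale subspace_neg)
    have e: "a \<bullet> (x - y) = (g x - g y) \<bullet> (x - y)"
      using a(2)[OF inW(1)] by (simp add: inner_commute)
    have "(g x - g y) \<bullet> (c *\<^sub>R a) = c * (norm a)\<^sup>2"
      using a(2)[OF ca(1)] by (simp add: inner_commute power2_norm_eq_inner)
    then show ?thesis
      using gap[OF y x ca(1)] gap[OF x y ca(2)] unfolding e
      by (simp add: inner_diff_left inner_diff_right power_mult_distrib algebra_simps)
  qed
  show ?thesis
  proof (cases "l = 0")
    case True
    have "(norm a)\<^sup>2 = 0"
    proof (rule ccontr)
      assume "(norm a)\<^sup>2 \<noteq> 0"
      \<comment> \<open>With l = 0 this c makes the left side of \<open>main\<close> exceed the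
        right side by exactly 1.\<close>
      then show False
        using main[of "(a \<bullet> (x - y) + 1) / (2 * (norm a)\<^sup>2)"] True by simp
    qed
    then show ?thesis using True by simp
  next
    case False
    then have "(norm a)\<^sup>2 / l \<le> a \<bullet> (x - y)"
      using main[of "1 / l"] by (simp add: power2_eq_square field_simps)
    then show ?thesis using False l by (simp add: field_simps)
  qed
qed

section \<open>Objectives with restricted strong convexity and smoothness\<close>

locale restricted_objective =
  fixes f :: "real^'n^'n \<Rightarrow> real" and r :: nat and L \<mu> :: real and Xs :: "real^'n^'n"
  assumes r_pos: "1 \<le> r" and mu_pos: "0 < \<mu>" and mu_le: "\<mu> \<le> L"
    and twice_diff: "twice_differentiable f"
    and A1: "assumption_A1 r L \<mu> f" and A2: "assumption_A2 r f Xs"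
begin

lemma f_deriv: "(f has_derivative (\<lambda>E. E \<bullet> grad f X)) (at X)"
  using twice_diff by (intro grad_has_derivative) (simp add: twice_differentiable_def)

lemma grad_deriv: "(grad f has_derivative hess f X) (at X)"
  using twice_diff by (simp add: twice_differentiable_def hessian_on_def frechet_derivative_works)

lemma grad_lipschitz: "rank X \<le> 2 * r \<Longrightarrow> rank Y \<le> 2 * r \<Longrightarrow> norm (grad f X - grad f Y) \<le> L * norm (X - Y)"
  using A1 unfolding assumption_A1_def by (metis rank_0 zero_le)

lemma hess_lower: "rank X \<le> 2 * r \<Longrightarrow> rank E \<le> 2 * r \<Longrightarrow> \<mu> * (norm E)\<^sup>2 \<le> hess f X E \<bullet> E"
  using A1 unfolding assumption_A1_def by blast

lemma rank_minimizer: "rank Xs \<le> r" and minimizer: "f Xs \<le> f X"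
  using A2 by (auto simp: assumption_A2_def is_arg_min_def not_less)

lemma grad_minimizer: "grad f Xs = 0"
proof -
  have "(\<lambda>E. E \<bullet> grad f Xs) = (\<lambda>E. 0)"
    by (rule has_derivative_local_min[OF f_deriv]) (simp add: minimizer)
  then have "grad f Xs \<bullet> grad f Xs = 0" by (rule fun_cong)
  then show ?thesis by simp
qed

lemma grad_line_deriv:
  "((\<lambda>t. grad f (X + t *\<^sub>R E)) has_vector_derivative hess f (X + t *\<^sub>R E) E) (at t)"
  by (rule has_vector_derivative_along_line[where T = UNIV]) (auto intro: grad_deriv)

text \<open>The mean value theorem for the gradient along the line from Y to X. The intermediate
  point is unknown, so the rank bound is required on the line and not just at its ends.\<close>

lemma strongly_monotone:
  assumes "\<And>t. rank (Y + t *\<^sub>R (X - Y)) \<le> 2 * r" "rank (X - Y) \<le> 2 * r"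
  shows "\<mu> * (norm (X - Y))\<^sup>2 \<le> (grad f X - grad f Y) \<bullet> (X - Y)"
proof -
  define E where "E = X - Y"
  have deriv: "((\<lambda>t. grad f (Y + t *\<^sub>R E) \<bullet> E) has_real_derivative hess f (Y + t *\<^sub>R E) E \<bullet> E) (at t)" for t
    unfolding has_real_derivative_iff_has_vector_derivative
    by (rule bounded_linear.has_vector_derivative[OF bounded_linear_inner_left grad_line_deriv])
  have "\<exists>t::real. 0 < t \<and> t < 1 \<and> grad f (Y + 1 *\<^sub>R E) \<bullet> E - grad f (Y + 0 *\<^sub>R E) \<bullet> E
      = (1 - 0) * (hess f (Y + t *\<^sub>R E) E \<bullet> E)"
    by (rule MVT2) (simp, rule deriv)
  then obtain t where "grad f (Y + 1 *\<^sub>R E) \<bullet> E - grad f (Y + 0 *\<^sub>R E) \<bullet> E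
      = (1 - 0) * (hess f (Y + t *\<^sub>R E) E \<bullet> E)"
    by (elim exE conjE)
  moreover have "\<mu> * (norm E)\<^sup>2 \<le> hess f (Y + t *\<^sub>R E) E \<bullet> E"
    using assms by (intro hess_lower) (auto simp: E_def)
  ultimately show ?thesis by (simp add: E_def inner_diff_left)
qed

text \<open>A1 bounds the Hessian only from below. The upper bound is the limit of the Lipschitz
  estimate for difference quotients of the gradient, taken along a line of rank at most 2r.\<close>

lemma hess_upper:
  assumes "\<And>t. rank (X + t *\<^sub>R E) \<le> 2 * r"
  shows "hess f X E \<bullet> E \<le> L * (norm E)\<^sup>2"
proof -
  have "((\<lambda>t. grad f (X + t *\<^sub>R E) \<bullet> E) has_real_derivative hess f (X + 0 *\<^sub>R E) E \<bullet> E) (at 0)"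
    unfolding has_real_derivative_iff_has_vector_derivative
    by (rule bounded_linear.has_vector_derivative[OF bounded_linear_inner_left grad_line_deriv])
  then have lim: "((\<lambda>t. (grad f (X + t *\<^sub>R E) \<bullet> E - grad f X \<bullet> E) / t) \<longlongrightarrow> hess f X E \<bullet> E) (at 0)"
    by (simp add: has_field_derivative_iff)
  show ?thesis
  proof (rule tendsto_upperbound[OF lim])
    show "\<forall>\<^sub>F t in at 0. (grad f (X + t *\<^sub>R E) \<bullet> E - grad f X \<bullet> E) / t \<le> L * (norm E)\<^sup>2"
    proof (rule eventually_at_filter[THEN iffD2], intro always_eventually allI impI)
      fix t :: real assume "t \<noteq> 0"
      have "\<bar>(grad f (X + t *\<^sub>R E) - grad f (X + 0 *\<^sub>R E)) \<bullet> E\<bar>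
          \<le> norm (grad f (X + t *\<^sub>R E) - grad f (X + 0 *\<^sub>R E)) * norm E"
        by (rule Cauchy_Schwarz_ineq2)
      also have "\<dots> \<le> L * norm ((X + t *\<^sub>R E) - (X + 0 *\<^sub>R E)) * norm E"
        by (intro mult_right_mono grad_lipschitz assms) simp
      finally have "\<bar>(grad f (X + t *\<^sub>R E) \<bullet> E - grad f X \<bullet> E) / t\<bar> \<le> L * (norm E)\<^sup>2"
        using \<open>t \<noteq> 0\<close> by (simp add: inner_diff_left abs_divide divide_le_eq power2_eq_square mult_ac)
      then show "(grad f (X + t *\<^sub>R E) \<bullet> E - grad f X \<bullet> E) / t \<le> L * (norm E)\<^sup>2"
        by linarith
    qed
  qed simp
qed

text \<open>All points of the line through X and Xs are combinations of two matrices of rank at most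
  r, and the gradient vanishes at Xs. Since no exact rank is required, this also covers
  rank-deficient points.\<close>

lemma distance_to_minimizer:
  assumes "rank X \<le> r"
  shows "\<mu> * (norm (X - Xs))\<^sup>2 \<le> grad f X \<bullet> (X - Xs)"
proof -
  have "rank (Xs + t *\<^sub>R (X - Xs)) \<le> 2 * r" for t
  proof -
    have "Xs + t *\<^sub>R (X - Xs) = (1 - t) *\<^sub>R Xs + t *\<^sub>R X" by (simp add: algebra_simps)
    also have "rank \<dots> \<le> rank Xs + rank X"
      using rank_add_le[of "(1 - t) *\<^sub>R Xs" "t *\<^sub>R X"] rank_scaleR_le[of "1 - t" Xs] rank_scaleR_le[of t X]
      by linarith
    finally show ?thesis using assms rank_minimizer by linarith
  qed
  moreover have "rank (X - Xs) \<le> 2 * r"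
    using rank_diff_le[of X Xs] assms rank_minimizer by linarith
  ultimately show ?thesis using strongly_monotone[of Xs X] by (simp add: grad_minimizer)
qed

text \<open>The matrices with columns in the range of \<open>P\<close> form a linear space of matrices of rank at most
  \<open>2r\<close>, so that \<open>f\<close> is strongly convex and smooth on it in the usual sense.\<close>

lemma projected_gradient_close:
  assumes P: "orth_proj P" "rank P \<le> 2 * r" and X: "P ** X = X" and Xs: "P ** Xs = Xs"
  shows "norm (P ** grad f X - ((L + \<mu>) / 2) *\<^sub>R (X - Xs)) \<le> (L - \<mu>) / 2 * norm (X - Xs)"
proof -
  define W where "W = {Z :: real^'n^'n. P ** Z = Z}"
  have W: "subspace W" unfolding W_def subspace_def by (simp add: mat_distribs)
  have rk: "rank Z \<le> 2 * r" if "Z \<in> W" for Z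
    using rank_mul_le_left[of P Z] that P(2) by (simp add: W_def)
  \<comment> \<open>Removing the quadratic of modulus \<mu> leaves a function that on W is convex
    with smoothness constant L - \<mu>, the form in which cocoercivity is sharp enough.\<close>
  define h g where "h = (\<lambda>Z. f Z - \<mu> / 2 * (Z \<bullet> Z))" and "g = (\<lambda>Z. grad f Z - \<mu> *\<^sub>R Z)"
  have h: "(h has_derivative (\<lambda>E. E \<bullet> g Z)) (at Z)" for Z
    unfolding h_def g_def
    by (rule derivative_eq_intros f_deriv refl)+
       (simp add: fun_eq_iff inner_diff_right inner_commute)
  have mono: "\<mu> * (norm (Z - Y))\<^sup>2 \<le> (grad f Z - grad f Y) \<bullet> (Z - Y)" if "Z \<in> W" "Y \<in> W" for Z Y
    using that W by (intro strongly_monotone rk) (auto intro: subspace_add subspace_scale subspace_diff)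
  have g_diff: "(g Z - g Y) \<bullet> (Z - Y) = (grad f Z - grad f Y) \<bullet> (Z - Y) - \<mu> * (norm (Z - Y))\<^sup>2" for Z Y
    by (simp add: g_def power2_norm_eq_inner algebra_simps)
  have lower: "0 \<le> (g Z - g Y) \<bullet> (Z - Y)" if "Z \<in> W" "Y \<in> W" for Z Y
    using mono[OF that] by (simp add: g_diff)
  have upper: "(g Z - g Y) \<bullet> (Z - Y) \<le> (L - \<mu>) * (norm (Z - Y))\<^sup>2" if "Z \<in> W" "Y \<in> W" for Z Y
  proof -
    have "(grad f Z - grad f Y) \<bullet> (Z - Y) \<le> norm (grad f Z - grad f Y) * norm (Z - Y)"
      by (rule norm_cauchy_schwarz)
    also have "\<dots> \<le> L * norm (Z - Y) * norm (Z - Y)"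
      using that by (intro mult_right_mono grad_lipschitz rk) auto
    finally have "(grad f Z - grad f Y) \<bullet> (Z - Y) \<le> L * (norm (Z - Y))\<^sup>2"
      by (simp add: power2_eq_square mult.assoc)
    then show ?thesis by (simp only: g_diff left_diff_distrib)
  qed
  define e where "e = X - Xs"
  define a where "a = P ** grad f X - \<mu> *\<^sub>R e"
  have XW: "X \<in> W" "Xs \<in> W" "e \<in> W" using X Xs W by (auto simp: W_def e_def mat_distribs)
  have "(norm a)\<^sup>2 \<le> (L - \<mu>) * (a \<bullet> (X - Xs))"
  proof (rule cocoercive_on_subspace[OF W h lower upper XW(1,2)])
    show "a \<in> W"
      unfolding a_def using W XW(3) inner_orth_proj_left(2)[OF P(1)]
      by (intro subspace_diff subspace_scale) (auto simp: W_def)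
    fix w assume "w \<in> W"
    then have "w \<bullet> (P ** grad f X) = w \<bullet> grad f X"
      using inner_orth_proj_left(1)[OF P(1), of w "grad f X"] by (simp add: W_def)
    then show "w \<bullet> (g X - g Xs) = w \<bullet> a"
      by (simp add: g_def a_def e_def grad_minimizer algebra_simps)
  qed (use mu_le in auto)
  then have le: "a \<bullet> a \<le> (L - \<mu>) * (a \<bullet> e)"
    by (simp add: power2_norm_eq_inner e_def)
  have sq: "(norm (a - k *\<^sub>R e))\<^sup>2 = a \<bullet> a - 2 * k * (a \<bullet> e) + (k * norm e)\<^sup>2" for k
    by (simp add: power_mult_distrib power2_norm_eq_inner inner_diff_left inner_diff_right
        inner_commute power2_eq_square[of k])
  \<comment> \<open>The cocoercive bound places a in the ball with diameter from 0 to (L - \<mu>) e.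
    Its center is (L - \<mu>)/2 e, and adding back \<mu> e moves it to (L + \<mu>)/2 e.\<close>
  have "(norm (a - ((L - \<mu>) / 2) *\<^sub>R e))\<^sup>2 \<le> ((L - \<mu>) / 2 * norm e)\<^sup>2"
  proof -
    have two: "2 * ((L - \<mu>) / 2) = L - \<mu>" by simp
    show ?thesis unfolding sq two using le by linarith
  qed
  moreover have "a - ((L - \<mu>) / 2) *\<^sub>R e = P ** grad f X - ((L + \<mu>) / 2) *\<^sub>R e"
  proof -
    have k: "(L + \<mu>) / 2 = \<mu> + (L - \<mu>) / 2" by (simp add: field_simps)
    show ?thesis unfolding a_def k by (simp only: scaleR_left_distrib diff_diff_eq)
  qed
  ultimately have "(norm (P ** grad f X - ((L + \<mu>) / 2) *\<^sub>R e))\<^sup>2 \<le> ((L - \<mu>) / 2 * norm e)\<^sup>2"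
    by (simp only:)
  moreover have "0 \<le> (L - \<mu>) / 2 * norm e"
    using mu_le by (intro mult_nonneg_nonneg) auto
  ultimately show ?thesis
    unfolding e_def by (rule power2_le_imp_le)
qed

end

section \<open>The compact singular value decomposition\<close>

locale compact_svd =
  fixes X :: "real^'n^'n" and r :: nat and u :: "nat \<Rightarrow> real^'n" and s :: "nat \<Rightarrow> real" and v :: "nat \<Rightarrow> real^'n"
  assumes svd: "is_svd X u s v" and rank_X: "rank X = r" and r_ge_1: "1 \<le> r"
begin

lemma orthonormal: "orthonormal_family u" "orthonormal_family v"
  using svd by (auto simp: is_svd_def)

lemma s_nonneg: "i < CARD('n) \<Longrightarrow> 0 \<le> s i"
  and s_decreasing: "i \<le> j \<Longrightarrow> j < CARD('n) \<Longrightarrow> s j \<le> s i"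
  and X_eq: "X = (\<Sum>i<CARD('n). s i *\<^sub>R outer_prod (u i) (v i))"
  using svd by (auto simp: is_svd_def)

lemma r_le: "r \<le> CARD('n)"
  using rank_bound[of X] rank_X by simp

lemma X_mult_v: "j < CARD('n) \<Longrightarrow> X *v v j = s j *\<^sub>R u j"
proof -
  assume j: "j < CARD('n)"
  have "X *v v j = (\<Sum>i<CARD('n). if i = j then s j *\<^sub>R u j else 0)"
    unfolding X_eq mat_vec.sum_left mat_vec.scaleR_left outer_prod_mult_vec
    using j by (intro sum.cong) (auto simp: orthonormal_familyD[OF orthonormal(2)])
  then show ?thesis using j by simp
qed

text \<open>If one of the first r values were zero, so would be all later ones, and X would be a sum
  of fewer than r rank-one matrices.\<close>

lemma s_pos: "i < r \<Longrightarrow> 0 < s i"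
proof (rule ccontr)
  assume i: "i < r" and "\<not> 0 < s i"
  then have zero: "s j = 0" if "i \<le> j" "j < CARD('n)" for j
    using that s_nonneg[of j] s_decreasing[of i j] by linarith
  have "X = (\<Sum>j<i. s j *\<^sub>R outer_prod (u j) (v j))"
    unfolding X_eq using i r_le zero by (intro sum.mono_neutral_right) auto
  also have "\<dots> = (\<Sum>j<i. outer_prod (s j *\<^sub>R u j) (v j))" by (simp add: outer.scaleR_left)
  finally have "rank X \<le> i" using rank_sum_outer_prod_le[of "{..<i}" "\<lambda>j. s j *\<^sub>R u j" v] by simp
  then show False using i rank_X by simp
qed

text \<open>A nonzero value from index r on would put the r + 1 independent vectors
  \<open>u 0\<close>, ..., \<open>u r\<close> into the range of X.\<close>

lemma s_zero: "r \<le> i \<Longrightarrow> i < CARD('n) \<Longrightarrow> s i = 0"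
proof (rule ccontr)
  assume i: "r \<le> i" "i < CARD('n)" and "s i \<noteq> 0"
  then have pos: "0 < s j" if "j \<le> r" for j
    using that s_nonneg[of i] s_decreasing[of j i] by simp
  have inj: "inj_on u {..r}"
    by (rule inj_onI)
      (metis atMost_iff i le_less_trans orthonormal_familyD[OF orthonormal(1)] zero_neq_one)
  have "pairwise orthogonal (u ` {..r})"
    unfolding pairwise_def orthogonal_def using i orthonormal_familyD[OF orthonormal(1)] by auto
  moreover have "u j \<noteq> 0" if "j \<le> r" for j
    using that i orthonormal_familyD[OF orthonormal(1), of j j] by auto
  then have "0 \<notin> u ` {..r}" by auto
  ultimately have "independent (u ` {..r})" by (rule pairwise_orthogonal_independent)
  moreover have "u ` {..r} \<subseteq> range ((*v) X)"
  proof
    fix x assume "x \<in> u ` {..r}"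
    then obtain j where j: "j \<le> r" "x = u j" by auto
    then have "X *v ((1 / s j) *\<^sub>R v j) = x"
      using X_mult_v[of j] pos[of j] i by (simp add: mat_vec.scaleR_right)
    then show "x \<in> range ((*v) X)" by (metis rangeI)
  qed
  ultimately have "card (u ` {..r}) \<le> rank X"
    unfolding rank_dim_range by (intro independent_card_le_dim)
  then show False using inj rank_X by (simp add: card_image)
qed

definition "\<sigma> = s (r - 1)"

lemma sigma_pos: "0 < \<sigma>" using s_pos[of "r - 1"] r_ge_1 by (simp add: \<sigma>_def)

lemma sigma_le: "i < r \<Longrightarrow> \<sigma> \<le> s i"
  unfolding \<sigma>_def using r_le by (intro s_decreasing) auto

definition "projU = (\<Sum>i<r. outer_prod (u i) (u i))"
definition "projV = (\<Sum>i<r. outer_prod (v i) (v i))"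
definition "perpU = mat 1 - projU"
definition "perpV = mat 1 - projV"
text \<open>The Moore-Penrose inverse of X.\<close>

definition "pinv = (\<Sum>i<r. (1 / s i) *\<^sub>R outer_prod (v i) (u i))"

lemma orth_proj_UV: "orth_proj projU" "orth_proj projV" "orth_proj perpU" "orth_proj perpV"
proof -
  show *: "orth_proj projU" "orth_proj projV"
    unfolding projU_def projV_def
    by (rule orth_proj_sum_outer(1); use r_le orthonormal_familyD[OF orthonormal(1)]
      orthonormal_familyD[OF orthonormal(2)] in simp)+
  show "orth_proj perpU" "orth_proj perpV"
    unfolding perpU_def perpV_def by (intro orth_proj_compl *)+
qed

lemma sum_delta_vec:
  fixes w x :: "nat \<Rightarrow> real^'n"
  assumes w: "orthonormal_family w" and "j < CARD('n)"
  shows "(\<Sum>i<r. (w i \<bullet> w j) *\<^sub>R x i) = (if j < r then x j else 0)"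
proof -
  have "(\<Sum>i<r. (w i \<bullet> w j) *\<^sub>R x i) = (\<Sum>i<r. if i = j then x j else 0)"
    using assms r_le by (intro sum.cong) (auto simp: orthonormal_familyD[OF w])
  then show ?thesis by simp
qed

lemma projU_u: "j < CARD('n) \<Longrightarrow> projU *v u j = (if j < r then u j else 0)"
  unfolding projU_def mat_vec.sum_left outer_prod_mult_vec by (rule sum_delta_vec[OF orthonormal(1)])

lemma projV_v: "j < CARD('n) \<Longrightarrow> projV *v v j = (if j < r then v j else 0)"
  unfolding projV_def mat_vec.sum_left outer_prod_mult_vec by (rule sum_delta_vec[OF orthonormal(2)])

lemma perpU_u: "j < CARD('n) \<Longrightarrow> perpU *v u j = (if j < r then 0 else u j)"
  by (simp add: perpU_def mat_vec_distribs projU_u)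

lemma perpV_v: "j < CARD('n) \<Longrightarrow> perpV *v v j = (if j < r then 0 else v j)"
  by (simp add: perpV_def mat_vec_distribs projV_v)

lemma pinv_u: "j < CARD('n) \<Longrightarrow> pinv *v u j = (if j < r then (1 / s j) *\<^sub>R v j else 0)"
  unfolding pinv_def mat_vec.sum_left mat_vec.scaleR_left outer_prod_mult_vec scaleR_left_commute[of "1 / _"]
  by (rule sum_delta_vec[OF orthonormal(1), where x = "\<lambda>i. (1 / s i) *\<^sub>R v i"])

lemma matrix_eqI_u: "(\<And>j. j < CARD('n) \<Longrightarrow> A *v u j = B *v u j) \<Longrightarrow> A = B" for A B :: "real^'n^'n"
  by (rule orthonormal_matrix_eqI[OF orthonormal(1) orthonormal(1)]) simp

lemma matrix_eqI_v: "(\<And>j. j < CARD('n) \<Longrightarrow> A *v v j = B *v v j) \<Longrightarrow> A = B" for A B :: "real^'n^'n"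
  by (rule orthonormal_matrix_eqI[OF orthonormal(1) orthonormal(2)]) simp

lemma projU_X: "projU ** X = X"
  by (rule matrix_eqI_v) (auto simp: matrix_vector_mul_assoc[symmetric] X_mult_v mat_vec_distribs projU_u s_zero)

lemma X_projV: "X ** projV = X"
  by (rule matrix_eqI_v) (auto simp: matrix_vector_mul_assoc[symmetric] X_mult_v projV_v s_zero)

lemma perpU_X: "perpU ** X = 0" and X_perpV: "X ** perpV = 0"
  by (simp_all add: perpU_def perpV_def mat_mult.diff_left mat_mult.diff_right projU_X X_projV)

lemma X_pinv: "X ** pinv = projU"
  by (rule matrix_eqI_u)
    (use s_pos r_le in \<open>auto simp: matrix_vector_mul_assoc[symmetric] X_mult_v projU_u pinv_u mat_vec_distribs order_less_imp_not_eq2\<close>)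

lemma pinv_X: "pinv ** X = projV"
  by (rule matrix_eqI_v)
    (use s_pos r_le in \<open>auto simp: matrix_vector_mul_assoc[symmetric] X_mult_v projV_v pinv_u mat_vec_distribs order_less_imp_not_eq2 s_zero\<close>)

lemma projV_pinv: "projV ** pinv = pinv"
  by (rule matrix_eqI_u)
    (use r_le in \<open>auto simp: matrix_vector_mul_assoc[symmetric] pinv_u projV_v mat_vec_distribs\<close>)

lemma pinv_projU: "pinv ** projU = pinv"
  by (rule matrix_eqI_u)
    (use r_le in \<open>auto simp: matrix_vector_mul_assoc[symmetric] pinv_u projU_u mat_vec_distribs\<close>)

section \<open>The tangent space\<close>

text \<open>\<open>perpU\<close> annihilates X from the left and \<open>perpV\<close> from the
  right. Conversely, \<open>Z2 = pinv ** E\<close> recovers the part of E in the column space of X,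
  and \<open>Z1 = perpU ** E ** pinv\<close> recovers the rest once the normal block is
  zero.\<close>

lemma tangent_space_iff: "E \<in> tangent_space X \<longleftrightarrow> perpU ** E ** perpV = 0"
proof
  assume "E \<in> tangent_space X"
  then obtain Z1 Z2 where "E = Z1 ** X + X ** Z2" by (auto simp: tangent_space_def)
  then have "perpU ** E ** perpV = perpU ** Z1 ** (X ** perpV) + perpU ** X ** Z2 ** perpV"
    by (simp add: mat_distribs)
  then show "perpU ** E ** perpV = 0" by (simp add: X_perpV perpU_X)
next
  assume "perpU ** E ** perpV = 0"
  then have "perpU ** E = perpU ** E ** projV"
    by (simp add: perpV_def mat_mult.diff_right)
  moreover have "E = projU ** E + perpU ** E"
    by (simp add: perpU_def mat_mult.diff_left)
  moreover have "projU ** E = X ** (pinv ** E)"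
    by (simp add: matrix_mul_assoc X_pinv)
  moreover have "perpU ** E ** projV = (perpU ** E ** pinv) ** X"
    by (simp add: pinv_X flip: matrix_mul_assoc)
  ultimately have "E = (perpU ** E ** pinv) ** X + X ** (pinv ** E)"
    by (metis add.commute)
  then show "E \<in> tangent_space X"
    unfolding tangent_space_def by blast
qed

lemma subspace_tangent_space: "subspace (tangent_space X)"
  by (simp add: subspace_def Ball_def tangent_space_iff mat_mult.add_left mat_mult.add_right
      mat_mult.scaleR_left mat_mult.scaleR_right)

text \<open>The orthogonal projection onto the tangent space, which only has to remove the normal
  block.\<close>

definition "projT G = G - perpU ** G ** perpV"

lemma projT_in_tangent_space: "projT G \<in> tangent_space X"
  using inner_orth_proj_left(2)[OF orth_proj_UV(3), of "G ** perpV"]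
    inner_orth_proj_right(2)[OF orth_proj_UV(4), of "perpU ** (perpU ** G)"]
  by (simp add: tangent_space_iff projT_def mat_mult.diff_left mat_mult.diff_right matrix_mul_assoc)

lemma inner_perp_perp: "(perpU ** A ** perpV) \<bullet> B = A \<bullet> (perpU ** B ** perpV)"
  by (simp add: inner_orth_proj_right(1)[OF orth_proj_UV(4)] inner_orth_proj_left(1)[OF orth_proj_UV(3)]
      matrix_mul_assoc)

lemma inner_projT: "E \<in> tangent_space X \<Longrightarrow> E \<bullet> projT G = E \<bullet> G"
  using inner_perp_perp[of E G] by (simp add: projT_def inner_diff_right tangent_space_iff)

section \<open>Distance to low-rank matrices\<close>

text \<open>Let \<open>P\<close> project onto the range of \<open>Z\<close>.  Its trace is at most \<open>r\<close>, so every bit of \<open>M\<close> that it captures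
  is paid for by a part of the \<open>r\<close> left singular vectors of \<open>X\<close> that it misses.\<close>

lemma norm_diff_low_rank_ge:
  assumes M: "perpU ** M = M" "M ** perpV = M"
    and bound: "\<And>x. norm (transpose M *v x) \<le> 2 * \<sigma> * norm x"
    and Z: "rank Z \<le> r"
  shows "norm M / 2 \<le> norm (Z - (X + M))"
proof (rule power2_le_imp_le)
  obtain P where P: "orth_proj P" "P ** Z = Z" "(norm P)\<^sup>2 = rank Z"
    by (rule exists_orth_proj_range)
  let ?R = "mat 1 - P"
  \<comment> \<open>The part of the trace of P that is spent outside the column space of X.\<close>
  define b where "b = (\<Sum>j\<in>{r..<CARD('n)}. (norm (P *v u j))\<^sup>2)"
  have split: "(\<Sum>j<CARD('n). g j) = (\<Sum>j<r. g j) + (\<Sum>j\<in>{r..<CARD('n)}. g j)" for g :: "nat \<Rightarrow> real"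
    using sum.atLeastLessThan_concat[of 0 r "CARD('n)" g] r_le by (simp add: atLeast0LessThan)
  have P_cols: "(\<Sum>j<r. (norm (P *v u j))\<^sup>2) + b \<le> r"
    using P(3) Z norm_matrix_power2_orthonormal[OF orthonormal(1), of P] by (simp add: b_def split)
  have "(norm (P ** perpU))\<^sup>2 = b"
    unfolding norm_matrix_power2_orthonormal[OF orthonormal(1)] split b_def
    using r_le by (simp add: matrix_vector_mul_assoc[symmetric] perpU_u)
  moreover have "norm (P ** M) \<le> 2 * \<sigma> * norm (P ** perpU)"
    using norm_matrix_mult_le_bound[OF bound, of "P ** perpU"] M(1) sigma_pos
    by (simp flip: matrix_mul_assoc)
  ultimately have PM: "(norm (P ** M))\<^sup>2 \<le> 4 * \<sigma>\<^sup>2 * b"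
    using power_mono[of "norm (P ** M)" "2 * \<sigma> * norm (P ** perpU)" 2]
    by (simp add: power_mult_distrib)
  have "\<sigma>\<^sup>2 * b \<le> \<sigma>\<^sup>2 * (\<Sum>j<r. (norm (?R *v u j))\<^sup>2)"
  proof (rule mult_left_mono)
    have "(norm (?R *v u j))\<^sup>2 = 1 - (norm (P *v u j))\<^sup>2" if "j < r" for j
    proof -
      have "norm (u j) = 1"
        using that r_le orthonormal_familyD[OF orthonormal(1), of j j] by (simp add: norm_eq_1)
      then show ?thesis using orth_proj_pythagoras_vec[OF P(1), of "u j"] by simp
    qed
    then have "(\<Sum>j<r. (norm (?R *v u j))\<^sup>2) = r - (\<Sum>j<r. (norm (P *v u j))\<^sup>2)"
      by (simp add: sum_subtractf)
    then show "b \<le> (\<Sum>j<r. (norm (?R *v u j))\<^sup>2)" using P_cols by linarith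
  qed simp
  also have "\<dots> \<le> (\<Sum>j<r. (norm (?R *v (X *v v j)))\<^sup>2)"
    unfolding sum_distrib_left
  proof (rule sum_mono)
    fix j assume "j \<in> {..<r}"
    then have "?R *v (X *v v j) = s j *\<^sub>R (?R *v u j)" and "\<sigma>\<^sup>2 \<le> (s j)\<^sup>2"
      using r_le sigma_le[of j] sigma_pos by (auto simp: X_mult_v mat_vec.scaleR_right power_mono)
    then show "\<sigma>\<^sup>2 * (norm (?R *v u j))\<^sup>2 \<le> (norm (?R *v (X *v v j)))\<^sup>2"
      by (simp add: power_mult_distrib mult_right_mono)
  qed
  also have "\<dots> \<le> (norm (?R ** X))\<^sup>2"
    unfolding norm_matrix_power2_orthonormal[OF orthonormal(2)] split
    by (simp add: matrix_vector_mul_assoc sum_nonneg)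
  finally have RX: "\<sigma>\<^sup>2 * b \<le> (norm (?R ** X))\<^sup>2" .
  have RM: "(norm (?R ** M))\<^sup>2 = (norm M)\<^sup>2 - (norm (P ** M))\<^sup>2"
    using orth_proj_pythagoras[OF P(1), of M] by simp
  \<comment> \<open>X and M have orthogonal row spaces, and multiplication from the left does not
    affect this.\<close>
  have "(?R ** M) \<bullet> (?R ** X) = 0"
  proof -
    have "(?R ** M) \<bullet> (?R ** X) = (?R ** M ** perpV) \<bullet> (?R ** X)"
      using M(2) by (simp flip: matrix_mul_assoc)
    also have "\<dots> = (?R ** M) \<bullet> (?R ** (X ** perpV))"
      by (simp add: inner_orth_proj_right(1)[OF orth_proj_UV(4)] matrix_mul_assoc)
    finally show ?thesis by (simp add: X_perpV)
  qed
  then have "(norm (?R ** X + ?R ** M))\<^sup>2 = (norm (?R ** X))\<^sup>2 + (norm (?R ** M))\<^sup>2"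
    by (intro norm_add_Pythagorean) (simp add: orthogonal_def inner_commute)
  moreover have "norm (?R ** X + ?R ** M) \<le> norm (Z - (X + M))"
  proof -
    have "?R ** (Z - (X + M)) = - (?R ** X + ?R ** M)"
      using P(2) by (simp add: mat_mult.diff_left mat_mult.diff_right mat_mult.add_right)
    then have "norm (?R ** X + ?R ** M) = norm (?R ** (Z - (X + M)))"
      by (simp only: norm_minus_cancel)
    also have "\<dots> \<le> norm (Z - (X + M))"
      by (rule norm_orth_proj_le[OF orth_proj_compl[OF P(1)]])
    finally show ?thesis .
  qed
  ultimately have "(norm (?R ** X))\<^sup>2 + (norm (?R ** M))\<^sup>2 \<le> (norm (Z - (X + M)))\<^sup>2"
    by (metis norm_ge_zero power_mono)
  moreover have "(norm (P ** M))\<^sup>2 \<le> (norm M)\<^sup>2"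
    by (intro power_mono norm_orth_proj_le P(1)) simp
  moreover have "(norm M / 2)\<^sup>2 = (norm M)\<^sup>2 / 4" by (simp add: power_divide)
  \<comment> \<open>The squared distance is at least \<sigma>^2 b + |M|^2 - |P M|^2. Since
    \<sigma>^2 b is at least |P M|^2 / 4, the loss is at most 3/4 |P M|^2, hence at most 3/4
    |M|^2.\<close>
  ultimately show "(norm M / 2)\<^sup>2 \<le> (norm (Z - (X + M)))\<^sup>2"
    using RX RM PM by linarith
qed simp

end

section \<open>Second-order conditions and the distance to the minimizer\<close>

context compact_svd
begin

text \<open>Every point of the line has the form \<open>A ** X + X ** B\<close>. This makes the
  upper Hessian bound available in all tangent directions.\<close>

lemma rank_tangent_line_le:
  assumes "E \<in> tangent_space X"
  shows "rank (X + t *\<^sub>R E) \<le> 2 * r"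
proof -
  obtain Z1 Z2 where E: "E = Z1 ** X + X ** Z2" using assms by (auto simp: tangent_space_def)
  have "X + t *\<^sub>R E = (mat 1 + t *\<^sub>R Z1) ** X + X ** (t *\<^sub>R Z2)"
    by (simp add: E mat_distribs scaleR_add_right)
  also have "rank \<dots> \<le> rank X + rank X"
    using rank_add_le rank_mul_le_right[of "mat 1 + t *\<^sub>R Z1" X] rank_mul_le_left[of X "t *\<^sub>R Z2"]
    by (meson add_mono order_trans)
  finally show ?thesis by (simp add: rank_X)
qed

lemma outer_mult_perpV: "outer_prod a b ** perpV = outer_prod a (perpV *v b)"
  using orth_proj_UV(4) unfolding outer_prod_matrix_mult orth_proj_def by metis

text \<open>\<open>critical_form (grad f X)\<close> is the part of the Hessian of the pullback that comes from the curvature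
  of the retraction.\<close>

definition "critical_form G E = 2 * (G \<bullet> (perpU ** (E ** pinv ** E) ** perpV))"

text \<open>Pairing a and b with the last singular pair gives the curvature its largest weight
  1/\<sigma>. The sign c turns that curvature against the Hessian of f, whatever the sign of the
  gradient entry.\<close>

lemma exists_critical_direction:
  assumes a: "perpU *v a = a" "a \<noteq> 0" and b: "perpV *v b = b" "b \<noteq> 0" and c: "\<bar>c\<bar> = 1"
  obtains E where "E \<in> tangent_space X" "(norm E)\<^sup>2 = 2"
    "critical_form G E = 2 * c * (a \<bullet> (G *v b)) / (\<sigma> * norm a * norm b)"
proof
  define k where "k = r - 1"
  have k: "k < r" "k < CARD('n)" "s k = \<sigma>" using r_ge_1 r_le by (auto simp: k_def \<sigma>_def)
  define p q where "p = 1 / norm a" and "q = c / norm b"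
  define E where "E = p *\<^sub>R outer_prod a (v k) + q *\<^sub>R outer_prod (u k) b"
  have uk: "perpU *v u k = 0" "u k \<bullet> u k = 1" and vk: "perpV *v v k = 0" "v k \<bullet> v k = 1"
    using k orthonormal_familyD[OF orthonormal(1), of k k] orthonormal_familyD[OF orthonormal(2), of k k]
    by (simp_all add: perpU_u perpV_v)
  have orth: "u k \<bullet> a = 0" "v k \<bullet> b = 0"
    using orth_proj_mult_inner(1)[OF orth_proj_UV(3), of "u k" a]
      orth_proj_mult_inner(1)[OF orth_proj_UV(4), of "v k" b] a b uk vk by simp_all
  \<comment> \<open>Since a is normal to the column space, \<open>pinv\<close> kills it. So in
    \<open>E ** pinv ** E\<close> only the product of the a-term with the b-term survives.\<close>
  have "pinv *v a = pinv *v (projU *v (perpU *v a))"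
    by (simp only: matrix_vector_mul_assoc pinv_projU a(1))
  also have "projU *v (perpU *v a) = 0"
    using orth_proj_UV(1)
    by (simp add: perpU_def matrix_vector_mul_assoc mat_mult.diff_right orth_proj_def)
  finally have pa: "pinv *v a = 0" by simp
  show "E \<in> tangent_space X"
    unfolding tangent_space_iff E_def
    by (simp add: mat_mult.add_left mat_mult.add_right mat_mult.scaleR_left mat_mult.scaleR_right
        matrix_mult_outer_prod uk outer_mult_perpV vk outer.zero_left outer.zero_right)
  show "(norm E)\<^sup>2 = 2"
  proof -
    have "orthogonal (p *\<^sub>R outer_prod a (v k)) (q *\<^sub>R outer_prod (u k) b)"
      using orth by (simp add: orthogonal_def inner_outer_prod_outer_prod)
    from norm_add_Pythagorean[OF this] have "(norm E)\<^sup>2 = (p * norm a)\<^sup>2 + (q * norm b)\<^sup>2"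
      using uk vk by (simp add: E_def norm_outer_prod power_mult_distrib flip: norm_eq_1)
    moreover have "p * norm a = 1" "q * norm b = c" using a(2) b(2) by (simp_all add: p_def q_def)
    moreover have "c\<^sup>2 = 1" using c by (metis power2_abs one_power2)
    ultimately show ?thesis by simp
  qed
  have "E *v v k = p *\<^sub>R a"
    by (simp add: E_def mat_vec_distribs outer_prod_mult_vec vk orth inner_commute[of b])
  moreover have "pinv ** E = (q / \<sigma>) *\<^sub>R outer_prod (v k) b"
    using k by (simp add: E_def mat_mult.add_right mat_mult.scaleR_right matrix_mult_outer_prod pa pinv_u
        outer.zero_left outer.scaleR_left)
  ultimately have "E ** pinv ** E = (p * q / \<sigma>) *\<^sub>R outer_prod a b"
    by (simp add: mat_mult.scaleR_right matrix_mult_outer_prod outer.scaleR_left mult.commute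
        flip: matrix_mul_assoc)
  then have "perpU ** (E ** pinv ** E) ** perpV = (p * q / \<sigma>) *\<^sub>R outer_prod a b"
    by (simp add: mat_mult.scaleR_right mat_mult.scaleR_left matrix_mult_outer_prod outer_mult_perpV a b)
  then show "critical_form G E = 2 * c * (a \<bullet> (G *v b)) / (\<sigma> * norm a * norm b)"
    by (simp add: critical_form_def inner_outer_prod p_def q_def mult_ac)
qed

end

locale rank_r_point = restricted_objective f r L \<mu> Xs + compact_svd X r u s v
  for f :: "real^'n^'n \<Rightarrow> real" and r L \<mu> and Xs X :: "real^'n^'n" and u s v
begin

text \<open>In the critical direction of squared norm 2 the Hessian of f contributes at most 2 L, so
  a curvature below - 2 (L + \<gamma>) would violate the second-order condition.\<close>

lemma normal_gradient_bound:
  assumes second_order: "\<And>E. E \<in> tangent_space X \<Longrightarrow>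
      - \<gamma> * (norm E)\<^sup>2 \<le> hess f X E \<bullet> E + critical_form (grad f X) E"
  shows "\<bar>x \<bullet> ((perpU ** grad f X ** perpV) *v y)\<bar> \<le> (L + \<gamma>) * \<sigma> * norm x * norm y"
proof -
  let ?G = "grad f X"
  define a b where "a = perpU *v x" and "b = perpV *v y"
  have eq: "x \<bullet> ((perpU ** ?G ** perpV) *v y) = a \<bullet> (?G *v b)"
    by (simp add: a_def b_def orth_proj_mult_inner(1)[OF orth_proj_UV(3)] matrix_vector_mul_assoc matrix_mul_assoc)
  have ab: "perpU *v a = a" "perpV *v b = b"
    unfolding a_def b_def by (rule orth_proj_mult_inner(2) orth_proj_UV)+
  have key: "c * (a \<bullet> (?G *v b)) / (\<sigma> * norm a * norm b) \<le> L + \<gamma>"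
    if "\<bar>c\<bar> = 1" "a \<noteq> 0" "b \<noteq> 0" for c
  proof -
    have "\<bar>- c\<bar> = 1" using that by simp
    from exists_critical_direction[OF ab(1) that(2) ab(2) that(3) this, of ?G]
    obtain E where E: "E \<in> tangent_space X" "(norm E)\<^sup>2 = 2"
      "critical_form ?G E = 2 * (- c) * (a \<bullet> (?G *v b)) / (\<sigma> * norm a * norm b)" .
    have "- \<gamma> * 2 \<le> L * 2 + critical_form ?G E"
      using second_order[OF E(1)] hess_upper[OF rank_tangent_line_le[OF E(1)]] E(2) by simp
    then show ?thesis unfolding E(3) by simp
  qed
  \<comment> \<open>Needed to pass from the norms of a and b to the larger ones of x and y. The
    tangent direction formed by a single singular pair has no curvature, so there the two Hessian
    bounds compare L with - \<gamma> directly.\<close>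
  have gL: "0 \<le> L + \<gamma>"
  proof -
    define k where k: "k = r - 1"
    have "- \<gamma> * 1 \<le> L * 1"
    proof -
      let ?E = "outer_prod (u k) (v k)"
      have kr: "k < r" "k < CARD('n)" using r_ge_1 r_le k by auto
      have T: "?E \<in> tangent_space X"
        using kr by (simp add: tangent_space_iff matrix_mult_outer_prod perpU_u outer.zero_left)
      have E1: "(norm ?E)\<^sup>2 = 1"
        using kr orthonormal_familyD[OF orthonormal(1), of k k] orthonormal_familyD[OF orthonormal(2), of k k]
        by (simp add: power2_norm_eq_inner inner_outer_prod_outer_prod)
      have "perpU ** ?E = 0"
        using kr by (simp add: matrix_mult_outer_prod perpU_u outer.zero_left)
      then have "perpU ** (?E ** pinv ** ?E) = 0"
        by (simp only: matrix_mul_assoc mat_mult.zero_left)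
      then have "critical_form ?G ?E = 0" by (simp add: critical_form_def)
      then show ?thesis
        using second_order[OF T] hess_upper[OF rank_tangent_line_le[OF T]] E1 by simp
    qed
    then show ?thesis by simp
  qed
  have "\<bar>a \<bullet> (?G *v b)\<bar> \<le> (L + \<gamma>) * \<sigma> * norm a * norm b"
  proof (cases "a = 0 \<or> b = 0")
    case False
    then have pos: "0 < \<sigma> * norm a * norm b" using sigma_pos by simp
    have "\<bar>a \<bullet> (?G *v b)\<bar> / (\<sigma> * norm a * norm b) \<le> L + \<gamma>"
      using key[of 1] key[of "- 1"] False by (auto simp: abs_real_def)
    then show ?thesis using pos by (simp add: pos_divide_le_eq mult_ac)
  qed auto
  also have "\<dots> \<le> (L + \<gamma>) * \<sigma> * norm x * norm y"
    unfolding a_def b_def using gL sigma_pos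
    by (intro mult_mono mult_left_mono norm_orth_proj_vec_le orth_proj_UV mult_nonneg_nonneg) auto
  finally show ?thesis by (simp add: eq)
qed

theorem distance_le:
  assumes first_order: "norm (projT (grad f X)) \<le> \<epsilon>"
    and second_order: "\<And>E. E \<in> tangent_space X \<Longrightarrow>
      - ((3 * \<mu> - L) / 4) * (norm E)\<^sup>2 \<le> hess f X E \<bullet> E + critical_form (grad f X) E"
  shows "(3 * \<mu> - L) / 4 * norm (X - Xs) \<le> \<epsilon>"
proof -
  let ?G = "grad f X"
  define e c where "e = X - Xs" and "c = (L + \<mu>) / 2"
  have c: "0 < c" using mu_pos mu_le by (simp add: c_def)
  obtain P where P: "orth_proj P" "P ** X = X" "P ** Xs = Xs" "rank P \<le> rank X + rank Xs"
    by (rule exists_orth_proj_range2)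
  have "rank P \<le> 2 * r" using P(4) rank_X rank_minimizer by simp
  note close = projected_gradient_close[OF P(1) this P(2,3)]
  have P_U: "P ** projU = projU"
    using P(2) by (simp add: X_pinv[symmetric] matrix_mul_assoc)
  moreover have "projU ** P = transpose (P ** projU)"
    using P(1) orth_proj_UV(1) by (simp add: orth_proj_def matrix_transpose_mul)
  ultimately have U_P: "projU ** P = projU"
    using orth_proj_UV(1) by (simp add: orth_proj_def)
  \<comment> \<open>The range of P contains the column space of X, so the two projections commute.
    Hence P N remains normal to X from both sides, as M must be.\<close>
  have comm: "P ** perpU = perpU ** P"
    by (simp add: perpU_def mat_mult.diff_left mat_mult.diff_right P_U U_P)
  define N where "N = perpU ** ?G ** perpV"
  define M where "M = - ((4 / (3 * c)) *\<^sub>R (P ** N))"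
  have "perpU ** N = N"
    by (simp add: N_def inner_orth_proj_left(2)[OF orth_proj_UV(3)] flip: matrix_mul_assoc)
  then have "perpU ** (P ** N) = P ** N"
    by (simp add: matrix_mul_assoc comm[symmetric]) (simp flip: matrix_mul_assoc)
  then have M1: "perpU ** M = M"
    by (simp add: M_def mat_mult.minus_right mat_mult.scaleR_right)
  have "P ** N ** perpV = P ** N"
    by (simp add: N_def matrix_mul_assoc inner_orth_proj_right(2)[OF orth_proj_UV(4)])
  then have M2: "M ** perpV = M"
    by (simp add: M_def mat_mult.minus_left mat_mult.scaleR_left)
  have "norm (transpose M *v x) \<le> 2 * \<sigma> * norm x" for x
  proof -
    \<comment> \<open>The bound on N is bilinear; testing M against its own image y turns it into a
      bound on \<open>transpose M\<close>.\<close>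
    define y where "y = transpose M *v x"
    have "(norm y)\<^sup>2 = (M *v y) \<bullet> x"
      unfolding power2_norm_eq_inner by (metis inner_matrix_vector_mult y_def)
    also have "M *v y = - ((4 / (3 * c)) *\<^sub>R (P *v (N *v y)))"
      by (simp add: M_def mat_vec_distribs matrix_vector_mul_assoc)
    also have "\<dots> \<bullet> x = - (4 / (3 * c)) * ((P *v x) \<bullet> (N *v y))"
      using orth_proj_mult_inner(1)[OF P(1), of "N *v y" x] by (simp add: inner_commute)
    also have "\<dots> \<le> 4 / (3 * c) * \<bar>(P *v x) \<bullet> (N *v y)\<bar>"
      using mult_left_mono[OF abs_ge_minus_self[of "(P *v x) \<bullet> (N *v y)"], of "4 / (3 * c)"] c by simp
    also have "\<dots> \<le> 4 / (3 * c) * (3 * c / 2 * \<sigma> * norm x * norm y)"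
    proof (rule mult_left_mono)
      have K: "L + (3 * \<mu> - L) / 4 = 3 * c / 2" by (simp add: c_def field_simps)
      have "\<bar>(P *v x) \<bullet> (N *v y)\<bar> \<le> 3 * c / 2 * \<sigma> * norm (P *v x) * norm y"
        unfolding N_def using normal_gradient_bound[OF second_order, unfolded K] .
      also have "\<dots> \<le> 3 * c / 2 * \<sigma> * norm x * norm y"
        using c sigma_pos by (intro mult_right_mono mult_left_mono norm_orth_proj_vec_le P) auto
      finally show "\<bar>(P *v x) \<bullet> (N *v y)\<bar> \<le> 3 * c / 2 * \<sigma> * norm x * norm y" .
    qed (use c in simp)
    also have "\<dots> = (2 * \<sigma> * norm x) * norm y" using c by simp
    finally have "norm y * norm y \<le> (2 * \<sigma> * norm x) * norm y"
      by (simp only: power2_eq_square)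
    then show ?thesis using sigma_pos unfolding y_def[symmetric]
      by (cases "norm y = 0") (simp_all only: mult_le_cancel_right, auto)
  qed
  from norm_diff_low_rank_ge[OF M1 M2 this rank_minimizer]
  have far: "norm M / 2 \<le> norm (e + M)"
    by (simp add: e_def norm_minus_commute[of Xs] algebra_simps)
  txt \<open>Apollonius: \<open>Xs\<close> is at distance at least \<open>norm M / 2\<close> from \<open>X + M\<close> iff it is at least half as far from
    \<open>X + 3/4 M\<close> as from \<open>X\<close>.\<close>
  have "(norm M / 2)\<^sup>2 \<le> (norm (e + M))\<^sup>2" using far by (intro power_mono) auto
  then have "(norm M)\<^sup>2 / 4 \<le> e \<bullet> e + 2 * (e \<bullet> M) + M \<bullet> M"
    by (simp add: power_divide power2_norm_eq_inner inner_add_left inner_add_right inner_commute)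
  \<comment> \<open>With everything moved to the right, this is 3/4 times the preceding
    inequality.\<close>
  then have "e \<bullet> e / 4 \<le> e \<bullet> e + 2 * (3 / 4) * (e \<bullet> M) + (3 / 4)\<^sup>2 * (M \<bullet> M)"
    unfolding power2_norm_eq_inner[of M] by (simp add: power2_eq_square[of "3/4 :: real"])
  also have "\<dots> = (norm (e + (3 / 4) *\<^sub>R M))\<^sup>2"
    unfolding power2_norm_eq_inner
    by (simp add: inner_add_left inner_add_right inner_commute power2_eq_square[of "3/4 :: real"])
  finally have "(norm e / 2)\<^sup>2 \<le> (norm (e + (3 / 4) *\<^sub>R M))\<^sup>2"
    by (simp add: power_divide power2_norm_eq_inner)
  then have "norm e / 2 \<le> norm (e + (3 / 4) *\<^sub>R M)"
    by (rule power2_le_imp_le) simp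
  then have "c * (norm e / 2) \<le> norm (c *\<^sub>R (e + (3 / 4) *\<^sub>R M))"
    using c by simp
  also have "c *\<^sub>R (e + (3 / 4) *\<^sub>R M) = - (P ** N - c *\<^sub>R e)"
    using c by (simp add: M_def scaleR_diff_right)
  also have "norm (- (P ** N - c *\<^sub>R e)) = norm ((P ** ?G - c *\<^sub>R e) - P ** projT ?G)"
    by (simp add: projT_def N_def mat_mult.diff_right norm_minus_commute)
  also have "\<dots> \<le> norm (P ** ?G - c *\<^sub>R e) + norm (P ** projT ?G)"
    by (rule norm_triangle_ineq4)
  also have "\<dots> \<le> (L - \<mu>) / 2 * norm e + \<epsilon>"
    using close norm_orth_proj_le[OF P(1), of "projT ?G"] first_order
    unfolding c_def e_def by linarith
  finally show ?thesis unfolding e_def[symmetric] c_def by (simp add: field_simps)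
qed

end

section \<open>Second derivatives on subspaces\<close>

text \<open>Difference quotients within T see a derivative only on T. This lets the chain rule
  formula be replaced by an inner product with a tangent vector, from which it differs off
  T.\<close>

lemma has_derivative_cong_subspace:
  fixes F :: "'a::real_normed_vector \<Rightarrow> 'b::real_normed_vector"
  assumes T: "subspace T" "S \<in> T" and F: "(F has_derivative D) (at S within T)"
    and D': "bounded_linear D'" "\<And>E. E \<in> T \<Longrightarrow> D' E = D E"
  shows "(F has_derivative D') (at S within T)"
proof -
  have "((\<lambda>y. (1 / norm (y - S)) *\<^sub>R (F y - (F S + D (y - S)))) \<longlongrightarrow> 0) (at S within T)"
    using F by (simp add: has_derivative_within)
  moreover have "\<forall>\<^sub>F y in at S within T. (1 / norm (y - S)) *\<^sub>R (F y - (F S + D (y - S)))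
      = (1 / norm (y - S)) *\<^sub>R (F y - (F S + D' (y - S)))"
    using T D'(2) by (auto simp: eventually_at_filter subspace_diff intro!: always_eventually)
  ultimately have "((\<lambda>y. (1 / norm (y - S)) *\<^sub>R (F y - (F S + D' (y - S)))) \<longlongrightarrow> 0) (at S within T)"
    by (rule Lim_transform_eventually)
  then show ?thesis using D'(1) by (simp add: has_derivative_within)
qed

text \<open>The mean value theorem for F(t B + x A) - F(x A) in x reduces the mixed second
  difference to g at two points near 0, where g is close to its linearization. Only
  differentiability of g at 0 enters.\<close>

lemma second_difference_estimate:
  fixes F :: "'a::real_inner \<Rightarrow> real" and g H :: "'a \<Rightarrow> 'a"
  assumes T: "subspace T" and d: "0 < d"
    and F: "\<And>S. S \<in> T \<Longrightarrow> norm S < d \<Longrightarrow> (F has_derivative (\<lambda>E. E \<bullet> g S)) (at S within T)"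
    and H: "bounded_linear H" and e: "0 \<le> e"
    and g: "\<And>S. S \<in> T \<Longrightarrow> norm S < d \<Longrightarrow> norm (g S - g 0 - H S) \<le> e * norm S"
    and E: "A \<in> T" "B \<in> T" and t: "0 < t" "t * (norm A + norm B) < d"
  shows "\<bar>F (t *\<^sub>R A + t *\<^sub>R B) - F (t *\<^sub>R A) - F (t *\<^sub>R B) + F 0 - t\<^sup>2 * (A \<bullet> H B)\<bar>
      \<le> e * (t\<^sup>2 * (norm A * (2 * norm A + norm B)))"
proof -
  interpret H: bounded_linear H by (rule H)
  have inT: "x *\<^sub>R A \<in> T" "t *\<^sub>R B + x *\<^sub>R A \<in> T" for x
    using T E by (auto intro: subspace_add subspace_scale)
  have small: "norm (x *\<^sub>R A) < d" "norm (t *\<^sub>R B + x *\<^sub>R A) < d" if "0 \<le> x" "x \<le> t" for x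
  proof -
    have xA: "x * norm A \<le> t * norm A" using that by (intro mult_right_mono) auto
    have tB: "0 \<le> t * norm B" using t by simp
    have sum: "t * norm A + t * norm B < d" using t(2) by (simp add: distrib_left)
    have "norm (x *\<^sub>R A) = x * norm A" using that by simp
    then show "norm (x *\<^sub>R A) < d" using xA tB sum by linarith
    have "norm (t *\<^sub>R B + x *\<^sub>R A) \<le> t * norm B + x * norm A"
      using norm_triangle_ineq[of "t *\<^sub>R B" "x *\<^sub>R A"] t that by simp
    then show "norm (t *\<^sub>R B + x *\<^sub>R A) < d" using xA sum by linarith
  qed
  have deriv: "((\<lambda>x. F (t *\<^sub>R B + x *\<^sub>R A) - F (0 + x *\<^sub>R A)) has_real_derivative
      A \<bullet> g (t *\<^sub>R B + x *\<^sub>R A) - A \<bullet> g (0 + x *\<^sub>R A)) (at x)" if "0 \<le> x" "x \<le> t" for x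
    unfolding has_real_derivative_iff_has_vector_derivative
    using inT small[OF that] T E
    by (intro has_vector_derivative_diff has_vector_derivative_along_line[OF T] F)
      (auto intro: subspace_scale subspace_0)
  have "\<exists>x>0. x < t \<and> (F (t *\<^sub>R B + t *\<^sub>R A) - F (0 + t *\<^sub>R A)) - (F (t *\<^sub>R B + 0 *\<^sub>R A) - F (0 + 0 *\<^sub>R A))
      = (t - 0) * (A \<bullet> g (t *\<^sub>R B + x *\<^sub>R A) - A \<bullet> g (0 + x *\<^sub>R A))"
    using t(1) by (rule MVT2) (rule deriv)
  then obtain x where x: "0 < x" "x < t" and
    eq: "F (t *\<^sub>R B + t *\<^sub>R A) - F (t *\<^sub>R A) - F (t *\<^sub>R B) + F 0
      = t * (A \<bullet> (g (t *\<^sub>R B + x *\<^sub>R A) - g (x *\<^sub>R A)))"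
    by (auto simp: inner_diff_right)
  let ?p = "t *\<^sub>R B + x *\<^sub>R A" and ?q = "x *\<^sub>R A"
  have np: "norm (g ?p - g 0 - H ?p) \<le> e * norm ?p" and nq: "norm (g ?q - g 0 - H ?q) \<le> e * norm ?q"
    by (rule g[OF inT(2) small(2)] g[OF inT(1) small(1)]; use x in simp)+
  have "norm ?p + norm ?q \<le> t * (2 * norm A + norm B)"
  proof -
    have "x * norm A \<le> t * norm A" using x by (intro mult_right_mono) auto
    moreover have "norm ?p \<le> t * norm B + x * norm A"
      using norm_triangle_ineq[of "t *\<^sub>R B" ?q] t x by simp
    ultimately show ?thesis using x by (simp add: distrib_left)
  qed
  then have pq: "e * (norm ?p + norm ?q) \<le> e * (t * (2 * norm A + norm B))"
    using e by (rule mult_left_mono)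
  have "g ?p - g ?q - t *\<^sub>R H B = (g ?p - g 0 - H ?p) - (g ?q - g 0 - H ?q)"
    by (simp add: H.add H.scaleR)
  then have "norm (g ?p - g ?q - t *\<^sub>R H B) \<le> e * (t * (2 * norm A + norm B))"
    using norm_triangle_ineq4[of "g ?p - g 0 - H ?p" "g ?q - g 0 - H ?q"] np nq pq
    by (simp only: distrib_left)
  then have "norm A * norm (g ?p - g ?q - t *\<^sub>R H B) \<le> norm A * (e * (t * (2 * norm A + norm B)))"
    by (rule mult_left_mono) simp
  then have "\<bar>A \<bullet> (g ?p - g ?q - t *\<^sub>R H B)\<bar> \<le> norm A * (e * (t * (2 * norm A + norm B)))"
    using Cauchy_Schwarz_ineq2 order_trans by blast
  then have "t * \<bar>A \<bullet> (g ?p - g ?q - t *\<^sub>R H B)\<bar> \<le> t * (norm A * (e * (t * (2 * norm A + norm B))))"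
    using t(1) by (intro mult_left_mono) auto
  moreover have "F (t *\<^sub>R A + t *\<^sub>R B) - F (t *\<^sub>R A) - F (t *\<^sub>R B) + F 0 - t\<^sup>2 * (A \<bullet> H B)
      = t * (A \<bullet> (g ?p - g ?q - t *\<^sub>R H B))"
    using eq by (simp add: add.commute inner_diff_right right_diff_distrib power2_eq_square mult.assoc)
  ultimately show ?thesis
    using t(1) by (simp add: abs_mult power2_eq_square mult_ac)
qed

text \<open>The mixed second difference is symmetric in A and B, and divided by t^2 it approximates
  both sides with an error that can be made smaller than any gap between them.\<close>

lemma second_derivative_symmetric_on_subspace:
  fixes F :: "'a::real_inner \<Rightarrow> real" and g H :: "'a \<Rightarrow> 'a"
  assumes T: "subspace T" and d: "0 < d"
    and F: "\<And>S. S \<in> T \<Longrightarrow> norm S < d \<Longrightarrow> (F has_derivative (\<lambda>E. E \<bullet> g S)) (at S within T)"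
    and H: "(g has_derivative H) (at 0 within T)"
    and E: "A \<in> T" "B \<in> T"
  shows "A \<bullet> H B = B \<bullet> H A"
proof (rule ccontr)
  assume ne: "A \<bullet> H B \<noteq> B \<bullet> H A"
  define C where "C = norm A * (2 * norm A + norm B) + norm B * (2 * norm B + norm A) + 1"
  have C: "0 < C" by (simp add: C_def add_nonneg_pos)
  define e where "e = \<bar>A \<bullet> H B - B \<bullet> H A\<bar> / (2 * C)"
  have e: "0 < e" using ne C by (simp add: e_def)
  then obtain d' where d': "0 < d'" and
    gd: "\<And>S. S \<in> T \<Longrightarrow> norm S < d' \<Longrightarrow> norm (g S - g 0 - H S) \<le> e * norm S"
    using H unfolding has_derivative_within_alt by force
  define m where "m = min d d'"
  have m: "0 < m" "m \<le> d" "m \<le> d'" using d d' by (auto simp: m_def)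
  define t where "t = m / (norm A + norm B + 1)"
  have t: "0 < t" using m by (simp add: t_def add_nonneg_pos)
  have "t * (norm A + norm B) < t * (norm A + norm B + 1)" using t by simp
  also have "\<dots> = m"
    using add_nonneg_pos[of "norm A + norm B" 1] by (simp add: t_def)
  finally have tm: "t * (norm A + norm B) < m" .
  note est = second_difference_estimate[OF T m(1) F has_derivative_bounded_linear[OF H] less_imp_le[OF e] gd]
  have "\<bar>F (t *\<^sub>R A + t *\<^sub>R B) - F (t *\<^sub>R A) - F (t *\<^sub>R B) + F 0 - t\<^sup>2 * (A \<bullet> H B)\<bar>
      \<le> e * (t\<^sup>2 * (norm A * (2 * norm A + norm B)))"
    using m by (intro est E t tm) auto
  moreover have "\<bar>F (t *\<^sub>R B + t *\<^sub>R A) - F (t *\<^sub>R B) - F (t *\<^sub>R A) + F 0 - t\<^sup>2 * (B \<bullet> H A)\<bar>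
      \<le> e * (t\<^sup>2 * (norm B * (2 * norm B + norm A)))"
    using m tm by (intro est E t) (auto simp: add.commute)
  ultimately have "\<bar>t\<^sup>2 * (A \<bullet> H B) - t\<^sup>2 * (B \<bullet> H A)\<bar>
      \<le> e * (t\<^sup>2 * (norm A * (2 * norm A + norm B))) + e * (t\<^sup>2 * (norm B * (2 * norm B + norm A)))"
    by (simp add: add.commute[of "t *\<^sub>R B"])
  also have "\<dots> = t\<^sup>2 * (e * (C - 1))" by (simp add: C_def algebra_simps)
  finally have "t\<^sup>2 * \<bar>A \<bullet> H B - B \<bullet> H A\<bar> \<le> t\<^sup>2 * (e * (C - 1))"
    by (simp add: abs_mult flip: right_diff_distrib)
  then have "\<bar>A \<bullet> H B - B \<bullet> H A\<bar> \<le> e * (C - 1)" using t by simp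
  also have "\<dots> < 2 * e * C" using e C by (simp add: algebra_simps add_pos_pos)
  also have "\<dots> = \<bar>A \<bullet> H B - B \<bullet> H A\<bar>" using C by (simp add: e_def)
  finally show False by simp
qed

text \<open>A negative c would make the derivative negative just to the right of 0, and the mean
  value theorem would then push the function below its minimum.\<close>

lemma local_min_second_order:
  fixes \<phi> :: "real \<Rightarrow> real"
  assumes d: "0 < d" and \<phi>: "\<And>t. \<bar>t\<bar> < d \<Longrightarrow> (\<phi> has_real_derivative \<phi>' t) (at t)"
    and \<phi>': "(\<phi>' has_real_derivative c) (at 0)"
    and min: "\<And>t. \<bar>t\<bar> < d \<Longrightarrow> \<phi> 0 \<le> \<phi> t"
  shows "\<phi>' 0 = 0" "0 \<le> c"
proof -
  show zero: "\<phi>' 0 = 0"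
    by (rule DERIV_local_min[OF \<phi> d]) (use d min in auto)
  show "0 \<le> c"
  proof (rule ccontr)
    assume "\<not> 0 \<le> c"
    then obtain b where b: "0 < b" "\<And>h. 0 < h \<Longrightarrow> h < b \<Longrightarrow> \<phi>' h < \<phi>' 0"
      using DERIV_neg_dec_right[OF \<phi>'] by force
    define h where "h = min b d / 2"
    have h: "0 < h" "h < b" "h < d" using b d by (auto simp: h_def)
    have "\<exists>x>0. x < h \<and> \<phi> h - \<phi> 0 = (h - 0) * \<phi>' x"
      using h by (intro MVT2 \<phi>) auto
    then obtain x where x: "0 < x" "x < h" "\<phi> h - \<phi> 0 = h * \<phi>' x" by auto
    have "h * \<phi>' x < 0" using b(2)[of x] x h zero by (simp add: mult_pos_neg)
    then show False using x(3) min[of h] h by simp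
  qed
qed

section \<open>The smallest eigenvalue\<close>

text \<open>\<open>lambda_min\<close> is a \<open>Min\<close>, which carries information only for a
  finite set. Eigenvectors of different eigenvalues are orthogonal and hence independent.\<close>

lemma finite_eigenvalues_on:
  fixes H :: "'a::euclidean_space \<Rightarrow> 'a"
  assumes sym: "\<And>A B. A \<in> T \<Longrightarrow> B \<in> T \<Longrightarrow> A \<bullet> H B = B \<bullet> H A"
  shows "finite {c. \<exists>E\<in>T. E \<noteq> 0 \<and> H E = c *\<^sub>R E}"
proof -
  let ?C = "{c. \<exists>E\<in>T. E \<noteq> 0 \<and> H E = c *\<^sub>R E}"
  have "\<forall>c\<in>?C. \<exists>E. E \<in> T \<and> E \<noteq> 0 \<and> H E = c *\<^sub>R E" by auto
  then obtain e where "\<forall>c\<in>?C. e c \<in> T \<and> e c \<noteq> 0 \<and> H (e c) = c *\<^sub>R e c"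
    by (rule bchoice[THEN exE])
  then have e: "e c \<in> T" "e c \<noteq> 0" "H (e c) = c *\<^sub>R e c" if "c \<in> ?C" for c
    using that by auto
  have orth: "e c \<bullet> e c' = 0" if "c \<in> ?C" "c' \<in> ?C" "c \<noteq> c'" for c c'
  proof -
    have "c' * (e c \<bullet> e c') = c * (e c \<bullet> e c')"
      using sym[OF e(1)[OF that(1)] e(1)[OF that(2)]] e(3)[OF that(1)] e(3)[OF that(2)]
      by (simp add: inner_commute)
    then show ?thesis using that by simp
  qed
  have inj: "inj_on e ?C"
  proof (rule inj_onI, rule ccontr)
    fix c c' assume "c \<in> ?C" "c' \<in> ?C" "e c = e c'" "c \<noteq> c'"
    then show False using orth[of c c'] e(2)[of c] by simp
  qed
  have "pairwise orthogonal (e ` ?C)"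
    unfolding pairwise_def orthogonal_def using orth by blast
  moreover have "0 \<notin> e ` ?C" using e(2) by (metis (no_types, lifting) imageE)
  ultimately have "finite (e ` ?C)"
    using pairwise_orthogonal_independent independent_imp_finite by blast
  then show ?thesis using inj by (rule finite_imageD)
qed

text \<open>The Rayleigh quotient attains its minimum m on the unit sphere of T. Its first variation
  vanishes there, so m is an eigenvalue and \<open>lambda_min\<close> is at most m.\<close>

lemma lambda_min_le:
  fixes H :: "real^'n^'n \<Rightarrow> real^'n^'n"
  assumes T: "subspace T" and H: "bounded_linear H" "\<And>E. E \<in> T \<Longrightarrow> H E \<in> T"
    and sym: "\<And>A B. A \<in> T \<Longrightarrow> B \<in> T \<Longrightarrow> A \<bullet> H B = B \<bullet> H A" and E: "E \<in> T"
  shows "lambda_min T H * (norm E)\<^sup>2 \<le> H E \<bullet> E"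
proof (cases "E = 0")
  case False
  interpret H: bounded_linear H by (rule H(1))
  let ?K = "T \<inter> sphere 0 1"
  have "compact ?K" by (intro closed_Int_compact closed_subspace T compact_sphere)
  moreover have unit: "sgn A \<in> ?K" if "A \<in> T" "A \<noteq> 0" for A
    using that T by (simp add: sgn_div_norm subspace_scale)
  then have "?K \<noteq> {}" using E False by blast
  moreover have "continuous_on ?K (\<lambda>A. H A \<bullet> A)"
    by (intro continuous_intros H.continuous_on)
  ultimately have "\<exists>A\<in>?K. \<forall>B\<in>?K. H A \<bullet> A \<le> H B \<bullet> B" by (rule continuous_attains_inf)
  then obtain A where A: "A \<in> T" "norm A = 1" and least: "\<And>B. B \<in> ?K \<Longrightarrow> H A \<bullet> A \<le> H B \<bullet> B"
    by auto
  define m where "m = H A \<bullet> A"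
  have rayleigh: "m * (norm B)\<^sup>2 \<le> H B \<bullet> B" if "B \<in> T" for B
  proof (cases "B = 0")
    case False
    then have "m \<le> H (sgn B) \<bullet> sgn B" unfolding m_def by (intro least unit that)
    also have "\<dots> = (H B \<bullet> B) / (norm B)\<^sup>2"
      by (simp add: sgn_div_norm H.scaleR power2_eq_square divide_inverse)
    finally show ?thesis using False by (simp add: pos_le_divide_eq)
  qed (simp add: H.zero)
  have orth: "(H A - m *\<^sub>R A) \<bullet> B = 0" if B: "B \<in> T" for B
  proof (rule ccontr)
    define p q where "p = (H A - m *\<^sub>R A) \<bullet> B" and "q = H B \<bullet> B - m * (B \<bullet> B)"
    assume "(H A - m *\<^sub>R A) \<bullet> B \<noteq> 0"
    then have p: "p \<noteq> 0" by (simp add: p_def)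
    have "0 \<le> 2 * t * p + t\<^sup>2 * q" for t
    proof -
      have "m * (norm (A + t *\<^sub>R B))\<^sup>2 \<le> H (A + t *\<^sub>R B) \<bullet> (A + t *\<^sub>R B)"
        using T A B by (intro rayleigh) (auto intro: subspace_add subspace_scale)
      moreover have "A \<bullet> A = 1" using A(2) by (simp add: norm_eq_1)
      moreover have "H B \<bullet> A = H A \<bullet> B" using sym[OF A(1) B] by (simp add: inner_commute)
      ultimately show ?thesis
        by (simp add: power2_norm_eq_inner H.add H.scaleR inner_add_left inner_add_right p_def q_def
            m_def[symmetric] inner_diff_left inner_commute[of B A] algebra_simps power2_eq_square[of t])
    qed
    note quad = this
    have q: "0 \<le> q" using rayleigh[OF B] by (simp add: q_def power2_norm_eq_inner)
    \<comment> \<open>A nearly optimal t for the quadratic; the summand 1 keeps it defined when q is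
      zero.\<close>
    have "2 * (- p / (q + 1)) * p + (- p / (q + 1))\<^sup>2 * q < 0"
    proof -
      have "2 * (- p / (q + 1)) * p + (- p / (q + 1))\<^sup>2 * q = - (p\<^sup>2 * (q + 2)) / (q + 1)\<^sup>2"
        using q by (simp add: power2_eq_square divide_simps) (simp add: algebra_simps)
      also have "\<dots> < 0" using p q by (simp add: divide_neg_pos)
      finally show ?thesis .
    qed
    then show False using quad[of "- p / (q + 1)"] by linarith
  qed
  have "H A - m *\<^sub>R A \<in> T" using T A H(2) by (intro subspace_diff subspace_scale) auto
  then have "H A - m *\<^sub>R A = 0" using orth by (metis inner_eq_zero_iff)
  moreover have "A \<noteq> 0" using A(2) by auto
  ultimately have "lambda_min T H \<le> m"
    unfolding lambda_min_def using A(1) by (intro Min_le finite_eigenvalues_on sym) auto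
  then have "lambda_min T H * (norm E)\<^sup>2 \<le> m * (norm E)\<^sup>2" by (rule mult_right_mono) simp
  also have "\<dots> \<le> H E \<bullet> E" by (rule rayleigh[OF E])
  finally show ?thesis .
qed (simp add: linear_0[OF bounded_linear.linear[OF H(1)]])

section \<open>The retraction\<close>

lemma sum_mult_delta:
  fixes c :: "nat \<Rightarrow> real"
  assumes "j < r"
  shows "(\<Sum>k<r. c k * (if k = j then 1 else 0)) = c j"
    and "(\<Sum>k<r. (if j = k then 1 else 0) * c k) = c j"
  using assms by (simp_all add: if_distrib[of "\<lambda>x. _ * x"] if_distrib[of "\<lambda>x. x * _"] cong: if_cong)

text \<open>Allows the inverse that \<open>retr\<close> chooses by \<open>SOME\<close> to be
  replaced by an explicit one.\<close>

lemma inverse_block_unique: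
  assumes 1: "inverse_block r A W1" and 2: "inverse_block r A W2" and ij: "i < r" "j < r"
  shows "W1 i j = W2 i j"
proof -
  have "W1 i j = (\<Sum>k<r. W1 i k * (\<Sum>l<r. A k l * W2 l j))"
    using 2 ij unfolding inverse_block_def by (subst sum_mult_delta(1)[OF ij(2), symmetric]) (intro sum.cong, auto)
  also have "\<dots> = (\<Sum>l<r. (\<Sum>k<r. W1 i k * A k l) * W2 l j)"
    unfolding sum_distrib_left sum_distrib_right by (subst sum.swap) (simp add: mult.assoc)
  also have "\<dots> = W2 i j"
    using 1 ij unfolding inverse_block_def by (subst (2) sum_mult_delta(2)[OF ij(1), symmetric]) (intro sum.cong, auto)
  finally show ?thesis .
qed

text \<open>The lower right block is chosen so that the full coefficient matrix K factors through
  its first r columns, W, and its first r rows. The result is thus a sum of r outer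
  products.\<close>

lemma rank_retr_le:
  fixes X S :: "real^'n^'n"
  assumes "rank X \<le> r"
  shows "rank (retr r X S) \<le> r"
proof -
  obtain u s v where usv: "(SOME (u, s, v). is_svd X u s v) = (u, s, v)" by (metis prod_cases3)
  define A where "A = (\<lambda>i j. u i \<bullet> ((X + S) *v v j))"
  define BC where "BC = (\<lambda>i j. u i \<bullet> (S *v v j))"
  show ?thesis
  proof (cases "\<exists>W. inverse_block r A W")
    case False
    then have "retr r X S = X"
      unfolding retr_def usv Let_def prod.case A_def by (rule if_not_P)
    then show ?thesis using assms by simp
  next
    case True
    define W where "W = (SOME W. inverse_block r A W)"
    have W: "inverse_block r A W" unfolding W_def using True by (rule someI_ex)
    define K where "K = (\<lambda>i j. if i < r \<and> j < r then A i j else if i < r \<or> j < r then BC i j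
        else (\<Sum>k<r. \<Sum>l<r. BC i k * W k l * BC l j))"
    have eq: "retr r X S = (\<Sum>i<CARD('n). \<Sum>j<CARD('n). K i j *\<^sub>R outer_prod (u i) (v j))"
      unfolding retr_def usv Let_def prod.case K_def W_def BC_def A_def
      by (rule if_P) (rule True[unfolded A_def])
    \<comment> \<open>In the first r columns or rows, W cancels against the block A; in the
      remaining block the identity is the definition of K.\<close>
    have K: "K i j = (\<Sum>k<r. K i k * (\<Sum>l<r. W k l * K l j))" for i j
    proof -
      have AW: "(\<Sum>k<r. A i k * W k j) = (if i = j then 1 else 0)"
        and WA: "(\<Sum>k<r. W i k * A k j) = (if i = j then 1 else 0)" if "i < r" "j < r" for i j
        using W that by (auto simp: inverse_block_def)
      consider "j < r" | "i < r" "r \<le> j" | "r \<le> i" "r \<le> j" by linarith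
      then show ?thesis
      proof cases
        case 1
        then have "(\<Sum>l<r. W k l * K l j) = (if k = j then 1 else 0)" if "k < r" for k
          using WA[OF that 1] by (simp add: K_def)
        then show ?thesis using sum_mult_delta(1)[OF 1, of "K i"] by simp
      next
        case 2
        have "(\<Sum>k<r. K i k * (\<Sum>l<r. W k l * K l j)) = (\<Sum>l<r. (\<Sum>k<r. K i k * W k l) * K l j)"
          unfolding sum_distrib_left sum_distrib_right by (subst sum.swap) (simp add: mult.assoc)
        also have "\<dots> = (\<Sum>l<r. (if i = l then 1 else 0) * K l j)"
          using 2 AW by (intro sum.cong) (auto simp: K_def)
        finally show ?thesis using sum_mult_delta(2)[OF 2(1), of "\<lambda>l. K l j"] by simp
      next
        case 3
        then show ?thesis by (simp add: K_def sum_distrib_left mult.assoc)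
      qed
    qed
    have "retr r X S = (\<Sum>k<r. outer_prod (\<Sum>i<CARD('n). K i k *\<^sub>R u i)
        (\<Sum>j<CARD('n). (\<Sum>l<r. W k l * K l j) *\<^sub>R v j))"
    proof -
      have "retr r X S = (\<Sum>i<CARD('n). \<Sum>j<CARD('n). \<Sum>k<r.
          (K i k * (\<Sum>l<r. W k l * K l j)) *\<^sub>R outer_prod (u i) (v j))"
        unfolding eq by (subst K) (simp only: scaleR_left.sum)
      also have "\<dots> = (\<Sum>k<r. \<Sum>i<CARD('n). \<Sum>j<CARD('n).
          (K i k * (\<Sum>l<r. W k l * K l j)) *\<^sub>R outer_prod (u i) (v j))"
        by (rule trans[OF sum.cong[OF refl sum.swap] sum.swap])
      finally show ?thesis
        unfolding outer.sum_left outer.scaleR_left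
        unfolding outer.sum_right outer.scaleR_right scaleR_sum_right scaleR_scaleR .
    qed
    then show ?thesis using rank_sum_outer_prod_le[of "{..<r}"] by simp
  qed
qed

context compact_svd
begin

text \<open>For small \<open>S\<close>, \<open>inv_core S\<close> is the pseudo-inverse of \<open>projU ** (X + S) ** projV\<close>, that is
  \<open>V A\<^sup>-\<^sup>1 U\<^sup>T\<close> with the block \<open>A\<close> of the retraction.  Its derivative is read off the resolvent identity
  \<open>inv_core_diff\<close>.\<close>

definition "near = {S. norm pinv * norm S \<le> 1 / 2}"

text \<open>It agrees with \<open>pinv ** (X + S)\<close> on the row space of X and with the
  identity on its complement. The r-dimensional block thereby becomes an invertible matrix of full
  size.\<close>

definition "core S = mat 1 + pinv ** S ** projV"

definition "inv_core S = matrix_inv (core S) ** pinv"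

lemma zero_near: "0 \<in> near" by (simp add: near_def)

text \<open>A perturbation of the identity by a matrix of operator norm at most 1/2. It yields both
  invertibility and the factor 2 in the bound on the inverse.\<close>

lemma norm_core_ge:
  assumes "S \<in> near"
  shows "norm x / 2 \<le> norm (core S *v x)"
proof -
  have "norm ((pinv ** S ** projV) *v x) \<le> norm (pinv ** S) * norm (projV *v x)"
    unfolding matrix_vector_mul_assoc[symmetric, of "pinv ** S"] by (rule norm_matrix_vector_mult_le)
  also have "\<dots> \<le> (norm pinv * norm S) * norm x"
    by (intro mult_mono norm_matrix_matrix_mult_le norm_orth_proj_vec_le orth_proj_UV) auto
  also have "\<dots> \<le> 1 / 2 * norm x"
    using assms by (intro mult_right_mono) (auto simp: near_def)
  finally have "norm ((pinv ** S ** projV) *v x) \<le> norm x / 2" by simp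
  moreover have "norm x - norm ((pinv ** S ** projV) *v x) \<le> norm (core S *v x)"
    using norm_diff_ineq[of x "(pinv ** S ** projV) *v x"] by (simp add: core_def mat_vec_distribs)
  ultimately show ?thesis by linarith
qed

lemma core_inverse:
  assumes "S \<in> near"
  shows "matrix_inv (core S) ** core S = mat 1" "core S ** matrix_inv (core S) = mat 1"
proof -
  have "x = 0" if "core S *v x = 0" for x
    using norm_core_ge[OF assms, of x] that by simp
  then have "\<exists>B. B ** core S = mat 1" by (simp add: matrix_left_invertible_ker)
  then have "invertible (core S)" by (simp add: invertible_left_inverse)
  then have "core S ** matrix_inv (core S) = mat 1 \<and> matrix_inv (core S) ** core S = mat 1"
    unfolding invertible_def matrix_inv_def by (rule someI_ex)
  then show "matrix_inv (core S) ** core S = mat 1" "core S ** matrix_inv (core S) = mat 1"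
    by simp_all
qed

lemma norm_inv_core_le:
  assumes "S \<in> near"
  shows "norm (inv_core S) \<le> 2 * norm pinv"
proof -
  have "norm (matrix_inv (core S) *v x) \<le> 2 * norm x" for x
    using norm_core_ge[OF assms, of "matrix_inv (core S) *v x"] core_inverse(2)[OF assms]
    by (simp add: matrix_vector_mul_assoc)
  then have "norm (transpose pinv ** transpose (matrix_inv (core S))) \<le> 2 * norm (transpose pinv)"
    by (intro norm_matrix_mult_le_bound) (simp_all del: transpose_matrix_vector)
  then show ?thesis
    by (metis inv_core_def matrix_transpose_mul norm_transpose)
qed

lemma inv_core_props:
  assumes S: "S \<in> near"
  shows "projV ** inv_core S = inv_core S" "inv_core S ** projU = inv_core S"
    "inv_core S ** (X + S) ** projV = projV" "projU ** (X + S) ** inv_core S = projU"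
proof -
  let ?F = "core S" and ?Fi = "matrix_inv (core S)"
  note Fi = core_inverse[OF S]
  have projV2: "projV ** projV = projV" using orth_proj_UV(2) by (simp add: orth_proj_def)
  have FV: "?F ** projV = projV + pinv ** S ** projV"
    by (simp add: core_def mat_mult.add_left projV2 flip: matrix_mul_assoc)
  have VF: "projV ** ?F = projV + pinv ** S ** projV"
    by (simp add: core_def mat_mult.add_right matrix_mul_assoc projV_pinv)
  \<comment> \<open>\<open>core S\<close> commutes with \<open>projV\<close>, and so does its
    inverse.\<close>
  have comm: "projV ** ?Fi = ?Fi ** projV"
  proof -
    have "projV ** ?Fi = ?Fi ** (?F ** projV) ** ?Fi"
      by (simp add: matrix_mul_assoc Fi)
    also have "\<dots> = ?Fi ** projV ** (?F ** ?Fi)"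
      by (simp only: FV VF[symmetric] matrix_mul_assoc)
    finally show ?thesis by (simp add: Fi)
  qed
  show V: "projV ** inv_core S = inv_core S"
    by (simp add: inv_core_def matrix_mul_assoc comm) (simp add: projV_pinv flip: matrix_mul_assoc)
  show "inv_core S ** projU = inv_core S"
    by (simp add: inv_core_def pinv_projU flip: matrix_mul_assoc)
  have "pinv ** (X + S) ** projV = ?F ** projV"
    by (simp add: FV mat_mult.add_left mat_mult.add_right pinv_X projV2)
  then have "inv_core S ** (X + S) ** projV = ?Fi ** (?F ** projV)"
    by (simp add: inv_core_def flip: matrix_mul_assoc)
  then show "inv_core S ** (X + S) ** projV = projV"
    by (simp add: matrix_mul_assoc Fi)
  have "X ** ?F = X + projU ** S ** projV"
    by (simp add: core_def mat_mult.add_right matrix_mul_assoc X_pinv)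
  then have "X ** ?F = projU ** (X + S) ** projV"
    by (simp add: mat_mult.add_left mat_mult.add_right projU_X X_projV)
  then have "projU ** (X + S) ** inv_core S = X ** ?F ** inv_core S"
    using V by (simp flip: matrix_mul_assoc)
  also have "\<dots> = X ** (?F ** ?Fi) ** pinv" by (simp add: inv_core_def matrix_mul_assoc)
  finally show "projU ** (X + S) ** inv_core S = projU" by (simp add: Fi X_pinv)
qed

lemma inv_core_zero: "inv_core 0 = pinv"
  using core_inverse(2)[OF zero_near] by (simp add: inv_core_def core_def)

text \<open>Inserting \<open>X + S'\<close> between the two inverses cancels the left one, inserting
  \<open>X + S\<close> cancels the right one; the difference of the two results is the
  claim.\<close>

lemma inv_core_diff:
  assumes S: "S \<in> near" and S': "S' \<in> near"
  shows "inv_core S' - inv_core S = - (inv_core S' ** (S' - S) ** inv_core S)"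
proof -
  let ?W = "inv_core S" and ?W' = "inv_core S'"
  have "?W' ** (X + S') ** ?W = ?W' ** (X + S') ** projV ** ?W"
    using inv_core_props(1)[OF S] by (simp flip: matrix_mul_assoc)
  also have "\<dots> = ?W" by (simp add: inv_core_props[OF S'] inv_core_props(1)[OF S])
  finally have 1: "?W' ** (X + S') ** ?W = ?W" .
  have "?W' ** (X + S) ** ?W = ?W' ** (projU ** (X + S) ** ?W)"
    using inv_core_props(2)[OF S'] by (simp add: matrix_mul_assoc)
  also have "\<dots> = ?W'" by (simp add: inv_core_props[OF S] inv_core_props(2)[OF S'])
  finally have 2: "?W' ** (X + S) ** ?W = ?W'" .
  have "?W' ** (S' - S) ** ?W = ?W' ** (X + S') ** ?W - ?W' ** (X + S) ** ?W"
    by (simp add: mat_mult.diff_left mat_mult.diff_right mat_mult.add_left mat_mult.add_right)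
  then show ?thesis by (simp add: 1 2)
qed

definition "radius = 1 / (2 * (norm pinv + 1))"

lemma radius_pos: "0 < radius" by (simp add: radius_def add_nonneg_pos)

lemma ball_near: "norm S < radius \<Longrightarrow> S \<in> near"
proof -
  assume S: "norm S < radius"
  have "norm pinv * norm S \<le> (norm pinv + 1) * radius"
    using S by (intro mult_mono) auto
  also have "norm pinv + 1 \<noteq> 0" using norm_ge_zero[of pinv] by linarith
  then have "(norm pinv + 1) * radius = 1 / 2" by (simp add: radius_def)
  finally show ?thesis by (simp add: near_def)
qed

text \<open>Two applications of the resolvent identity show the remainder to be quadratic in the
  increment, with constant \<open>(2 * norm pinv) ^ 3\<close>.\<close>

lemma inv_core_has_derivative:
  assumes S: "norm S < radius"
  shows "(inv_core has_derivative (\<lambda>E. - (inv_core S ** E ** inv_core S))) (at S within T)"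
proof (rule has_derivativeI_sandwich)
  let ?W = "inv_core S" and ?B = "2 * norm pinv"
  show "0 < radius - norm S" using S by simp
  show "bounded_linear (\<lambda>E. - (?W ** E ** ?W))"
    by (intro bounded_linear_minus bounded_linear_compose[OF mat_mult.bounded_linear_left]
        mat_mult.bounded_linear_right)
  fix Y assume "Y \<in> T" "Y \<noteq> S" and d: "dist Y S < radius - norm S"
  have "norm Y < radius" using d norm_triangle_ineq2[of Y S] by (simp add: dist_norm)
  note near = ball_near[OF S] ball_near[OF this]
  have "inv_core Y - ?W - - (?W ** (Y - S) ** ?W) = - ((inv_core Y - ?W) ** (Y - S) ** ?W)"
    by (subst inv_core_diff[OF near]) (simp add: mat_mult.diff_left)
  also have "norm \<dots> = norm (inv_core Y ** (Y - S) ** ?W ** (Y - S) ** ?W)"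
    by (subst inv_core_diff[OF near]) (simp add: mat_mult.minus_left)
  also have "\<dots> \<le> norm (inv_core Y) * norm (Y - S) * norm ?W * norm (Y - S) * norm ?W"
    by (intro order_trans[OF norm_matrix_matrix_mult_le] mult_right_mono norm_matrix_matrix_mult_le) auto
  also have "\<dots> \<le> ?B * norm (Y - S) * ?B * norm (Y - S) * ?B"
    using near by (intro mult_mono norm_inv_core_le) auto
  finally show "norm (inv_core Y - ?W - - (?W ** (Y - S) ** ?W)) / norm (Y - S) \<le> ?B ^ 3 * norm (Y - S)"
    using \<open>Y \<noteq> S\<close> by (simp add: divide_le_eq power3_eq_cube mult_ac)
next
  have "((\<lambda>Y. (2 * norm pinv) ^ 3 * norm (Y - S)) \<longlongrightarrow> (2 * norm pinv) ^ 3 * norm (S - S)) (at S within T)"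
    by (intro tendsto_intros)
  then show "((\<lambda>Y. (2 * norm pinv) ^ 3 * norm (Y - S)) \<longlongrightarrow> 0) (at S within T)" by simp
qed

text \<open>A form of the retraction without blocks, choices or case distinction: for tangent S the
  blocks A, B and C make up X + S, and the added term is the block C A^-1 B.\<close>

definition "smooth_retr S = X + S + perpU ** (S ** inv_core S ** S) ** perpV"

lemma smooth_retr_zero: "smooth_retr 0 = X" by (simp add: smooth_retr_def)

lemma sum_proj_vec: "(\<Sum>k<r. (u k \<bullet> y) *\<^sub>R u k) = projU *v y" "(\<Sum>k<r. (v k \<bullet> y) *\<^sub>R v k) = projV *v y"
  by (simp_all add: projU_def projV_def mat_vec.sum_left outer_prod_mult_vec)

lemma inverse_block_inv_core:
  assumes S: "S \<in> near"
  shows "inverse_block r (\<lambda>i j. u i \<bullet> ((X + S) *v v j)) (\<lambda>i j. v i \<bullet> (inv_core S *v u j))"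
  unfolding inverse_block_def
proof (intro allI impI conjI)
  let ?W = "inv_core S"
  fix i j assume ij: "i < r" "j < r"
  then have n: "i < CARD('n)" "j < CARD('n)" using r_le by auto
  have "(\<Sum>k<r. (u i \<bullet> ((X + S) *v v k)) * (v k \<bullet> (?W *v u j)))
      = u i \<bullet> ((X + S) *v (\<Sum>k<r. (v k \<bullet> (?W *v u j)) *\<^sub>R v k))"
    by (simp add: mat_vec.sum_right mat_vec.scaleR_right inner_sum_right mult.commute)
  also have "\<dots> = u i \<bullet> ((X + S) *v (?W *v u j))"
    unfolding sum_proj_vec by (simp add: matrix_vector_mul_assoc inv_core_props[OF S])
  also have "\<dots> = (projU *v u i) \<bullet> (((X + S) ** ?W) *v u j)"
    using ij n by (simp add: projU_u matrix_vector_mul_assoc)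
  also have "\<dots> = u i \<bullet> (projU *v u j)"
    by (simp add: orth_proj_mult_inner(1)[OF orth_proj_UV(1)] matrix_vector_mul_assoc matrix_mul_assoc
        inv_core_props[OF S])
  also have "\<dots> = (if i = j then 1 else 0)"
    using ij n by (simp add: projU_u orthonormal_familyD[OF orthonormal(1)])
  finally show "(\<Sum>k<r. (u i \<bullet> ((X + S) *v v k)) * (v k \<bullet> (?W *v u j))) = (if i = j then 1 else 0)" .
  have "(\<Sum>k<r. (v i \<bullet> (?W *v u k)) * (u k \<bullet> ((X + S) *v v j)))
      = v i \<bullet> (?W *v (\<Sum>k<r. (u k \<bullet> ((X + S) *v v j)) *\<^sub>R u k))"
    by (simp add: mat_vec.sum_right mat_vec.scaleR_right inner_sum_right mult.commute)
  also have "\<dots> = v i \<bullet> ((?W ** (X + S)) *v v j)"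
    unfolding sum_proj_vec by (simp add: matrix_vector_mul_assoc matrix_mul_assoc inv_core_props[OF S])
  also have "\<dots> = v i \<bullet> ((?W ** (X + S)) *v (projV *v v j))"
    using ij n by (simp add: projV_v)
  also have "\<dots> = v i \<bullet> (projV *v v j)"
    by (simp add: matrix_vector_mul_assoc inv_core_props[OF S])
  also have "\<dots> = (if i = j then 1 else 0)"
    using ij n by (simp add: projV_v orthonormal_familyD[OF orthonormal(2)])
  finally show "(\<Sum>k<r. (v i \<bullet> (?W *v u k)) * (u k \<bullet> ((X + S) *v v j))) = (if i = j then 1 else 0)" .
qed

text \<open>Both sides are compared entrywise in the singular bases. The hypothesis on
  \<open>SOME\<close> makes these the bases that \<open>retr\<close> itself uses.\<close>

lemma retr_eq_smooth_retr:
  assumes choice: "(SOME (u, s, v). is_svd X u s v) = (u, s, v)"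
    and T: "S \<in> tangent_space X" and S: "S \<in> near"
  shows "retr r X S = smooth_retr S"
proof -
  define A where "A = (\<lambda>i j. u i \<bullet> ((X + S) *v v j))"
  define BC where "BC = (\<lambda>i j. u i \<bullet> (S *v v j))"
  define V where "V = (\<lambda>i j. v i \<bullet> (inv_core S *v u j))"
  define W where "W = (SOME W. inverse_block r A W)"
  have V: "inverse_block r A V" unfolding A_def V_def by (rule inverse_block_inv_core[OF S])
  then have ex: "\<exists>W. inverse_block r A W" by blast
  then have W: "inverse_block r A W" unfolding W_def by (rule someI_ex)
  have WV: "W k l = V k l" if "k < r" "l < r" for k l
    by (rule inverse_block_unique[OF W V that])
  define K where "K = (\<lambda>i j. if i < r \<and> j < r then A i j else if i < r \<or> j < r then BC i j
      else (\<Sum>k<r. \<Sum>l<r. BC i k * W k l * BC l j))"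
  have eq: "retr r X S = (\<Sum>i<CARD('n). \<Sum>j<CARD('n). K i j *\<^sub>R outer_prod (u i) (v j))"
    unfolding retr_def choice Let_def prod.case K_def W_def BC_def A_def
    by (rule if_P) (rule ex[unfolded A_def])
  show ?thesis
  proof (rule orthonormal_matrix_eqI[OF orthonormal])
    fix a b assume ab: "a < CARD('n)" "b < CARD('n)"
    have "u a \<bullet> (retr r X S *v v b) = (\<Sum>i<CARD('n). \<Sum>j<CARD('n). K i j * ((v j \<bullet> v b) * (u a \<bullet> u i)))"
      unfolding eq by (simp add: mat_vec.sum_left mat_vec.scaleR_left outer_prod_mult_vec inner_sum_right mult.assoc)
    also have "\<dots> = (\<Sum>i<CARD('n). \<Sum>j<CARD('n). if j = b then if i = a then K a b else 0 else 0)"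
      using ab by (intro sum.cong refl)
        (auto simp: orthonormal_familyD[OF orthonormal(1)] orthonormal_familyD[OF orthonormal(2)])
    also have "\<dots> = K a b" using ab by simp
    also have "\<dots> = u a \<bullet> ((X + S) *v v b) + (perpU *v u a) \<bullet> ((S ** inv_core S ** S) *v (perpV *v v b))"
    proof (cases "a < r \<or> b < r")
      case True
      then have "u a \<bullet> (X *v v b) = 0" if "\<not> (a < r \<and> b < r)"
        using that ab by (auto simp: X_mult_v orthonormal_familyD[OF orthonormal(1)])
      then show ?thesis using True ab
        by (auto simp: K_def A_def BC_def perpU_u perpV_v mat_vec_distribs inner_add_right)
    next
      case False
      have sV: "(\<Sum>k<r. \<Sum>l<r. BC a k * V k l * BC l b) = u a \<bullet> ((S ** inv_core S ** S) *v v b)"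
      proof -
        have "S ** (projV ** inv_core S ** projU) ** S = S ** inv_core S ** S"
          by (simp only: inv_core_props(1,2)[OF S])
        then have "u a \<bullet> ((S ** inv_core S ** S) *v v b)
            = u a \<bullet> (S *v (projV *v (inv_core S *v (projU *v (S *v v b)))))"
          by (simp only: matrix_vector_mul_assoc matrix_mul_assoc)
        also have "\<dots> = (\<Sum>k<r. \<Sum>l<r. BC a k * V k l * BC l b)"
          by (simp add: sum_proj_vec[symmetric] mat_vec.sum_right mat_vec.scaleR_right inner_sum_right
              BC_def V_def sum_distrib_left sum_distrib_right mult_ac) (rule sum.swap)
        finally show ?thesis by simp
      qed
      \<comment> \<open>Tangency of S makes the normal block of X + S vanish, so only the C A^-1 B
        term is left here.\<close>
      have "u a \<bullet> ((X + S) *v v b) = (perpU *v u a) \<bullet> ((X + S) *v (perpV *v v b))"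
        using False ab by (simp add: perpU_u perpV_v)
      also have "\<dots> = u a \<bullet> ((perpU ** (X + S) ** perpV) *v v b)"
        by (simp add: orth_proj_mult_inner(1)[OF orth_proj_UV(3)] matrix_vector_mul_assoc matrix_mul_assoc)
      also have "perpU ** (X + S) ** perpV = 0"
        using T by (simp add: tangent_space_iff mat_mult.add_left mat_mult.add_right perpU_X)
      finally show ?thesis
        using False ab WV by (simp add: K_def perpU_u perpV_v sV[symmetric])
    qed
    also have "\<dots> = u a \<bullet> (smooth_retr S *v v b)"
      by (simp add: smooth_retr_def mat_vec_distribs inner_add_right
          orth_proj_mult_inner(1)[OF orth_proj_UV(3)] matrix_vector_mul_assoc matrix_mul_assoc)
    finally show "u a \<bullet> (retr r X S *v v b) = u a \<bullet> (smooth_retr S *v v b)" .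
  qed
qed

end

section \<open>Gradient and Hessian of the pullback\<close>

text \<open>Tying the singular vectors to the triple that \<open>retr\<close> picks avoids any
  argument that the retraction is independent of the decomposition.\<close>

locale retraction_point = rank_r_point +
  assumes choice: "(SOME (u, s, v). is_svd X u s v) = (u, s, v)"
begin

abbreviation "T \<equiv> tangent_space X"

lemma inner_tangent_eqI:
  assumes "\<And>E. E \<in> T \<Longrightarrow> E \<bullet> A = 0" "A \<in> T"
  shows "A = 0"
  using assms by (metis inner_eq_zero_iff)

lemma bounded_linear_perp: "bounded_linear (\<lambda>Z. perpU ** Z ** perpV)"
  by (intro bounded_linear_compose[OF mat_mult.bounded_linear_left] mat_mult.bounded_linear_right)

lemma bounded_linear_projT: "bounded_linear projT"
  unfolding projT_def by (intro bounded_linear_sub bounded_linear_ident bounded_linear_perp)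

lemma smooth_retr_has_derivative:
  assumes S: "norm S < radius"
  shows "(smooth_retr has_derivative (\<lambda>E. E + perpU ** (E ** inv_core S ** S + S ** inv_core S ** E
      - S ** inv_core S ** E ** inv_core S ** S) ** perpV)) (at S within T)"
proof -
  let ?W = "inv_core S"
  note id = has_derivative_ident[of "at S within T"]
  note 1 = mat_mult.FDERIV[OF id inv_core_has_derivative[OF S]]
  note 2 = mat_mult.FDERIV[OF 1 id]
  have "(smooth_retr has_derivative (\<lambda>E. E + perpU ** (S ** ?W ** E
      + (S ** - (?W ** E ** ?W) + E ** ?W) ** S) ** perpV)) (at S within T)"
    unfolding smooth_retr_def
    by (intro has_derivative_add_const has_derivative_add id
        bounded_linear.has_derivative[OF bounded_linear_perp 2]
        has_derivative_eq_rhs[OF has_derivative_add[OF has_derivative_add[OF has_derivative_const id]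
          bounded_linear.has_derivative[OF bounded_linear_perp 2]]]) simp
  then show ?thesis
    by (rule has_derivative_eq_rhs)
       (simp add: mat_mult.add_left mat_mult.add_right mat_mult.diff_left mat_mult.diff_right
         mat_mult.minus_left mat_mult.minus_right matrix_mul_assoc add.commute add.left_commute
         add_diff_eq diff_add_eq)
qed

definition "normal S = perpU ** grad f (smooth_retr S) ** perpV"

text \<open>The adjoint of the derivative of \<open>smooth_retr\<close> applied to the gradient of
  f, then projected back onto the tangent space.\<close>

definition "pullback_grad S = projT (grad f (smooth_retr S)
   + normal S ** transpose (inv_core S ** S) + transpose (S ** inv_core S) ** normal S
   - transpose (S ** inv_core S) ** normal S ** transpose (inv_core S ** S))"

lemma pullback_has_derivative:
  assumes ST: "S \<in> T" and S: "norm S < radius"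
  shows "(pullback r f X has_derivative (\<lambda>E. E \<bullet> pullback_grad S)) (at S within T)"
proof -
  let ?W = "inv_core S" and ?G = "grad f (smooth_retr S)"
  have "((\<lambda>S. f (smooth_retr S)) has_derivative (\<lambda>E. (E + perpU ** (E ** ?W ** S + S ** ?W ** E
      - S ** ?W ** E ** ?W ** S) ** perpV) \<bullet> ?G)) (at S within T)"
    by (rule has_derivative_compose[OF smooth_retr_has_derivative[OF S] f_deriv])
  then have "((\<lambda>S. f (smooth_retr S)) has_derivative (\<lambda>E. E \<bullet> pullback_grad S)) (at S within T)"
  proof (rule has_derivative_cong_subspace[OF subspace_tangent_space ST])
    show "bounded_linear (\<lambda>E. E \<bullet> pullback_grad S)" by (rule bounded_linear_inner_left)
    fix E assume "E \<in> T"
    then have "E \<bullet> pullback_grad S = E \<bullet> (?G + normal S ** transpose (?W ** S)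
        + transpose (S ** ?W) ** normal S - transpose (S ** ?W) ** normal S ** transpose (?W ** S))"
      unfolding pullback_grad_def by (rule inner_projT)
    also have "\<dots> = E \<bullet> ?G + (E ** (?W ** S)) \<bullet> normal S + ((S ** ?W) ** E) \<bullet> normal S
        - ((S ** ?W) ** (E ** (?W ** S))) \<bullet> normal S"
      by (simp only: inner_add_right inner_diff_right inner_matrix_matrix_mult_left[of "S ** ?W"]
          inner_matrix_matrix_mult_right[of E "?W ** S"])
    also have "\<dots> = E \<bullet> ?G + (E ** ?W ** S + S ** ?W ** E - S ** ?W ** E ** ?W ** S) \<bullet> normal S"
      by (simp only: inner_add_left inner_diff_left matrix_mul_assoc)
    also have "\<dots> = (E + perpU ** (E ** ?W ** S + S ** ?W ** E - S ** ?W ** E ** ?W ** S) ** perpV) \<bullet> ?G"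
      by (simp only: inner_add_left[of E] inner_perp_perp normal_def)
    finally show "E \<bullet> pullback_grad S = (E + perpU ** (E ** ?W ** S + S ** ?W ** E
      - S ** ?W ** E ** ?W ** S) ** perpV) \<bullet> ?G" .
  qed
  then show ?thesis
  proof (rule has_derivative_transform_within)
    show "0 < radius - norm S" using S by simp
    fix Y assume Y: "Y \<in> T" "dist Y S < radius - norm S"
    then have "norm Y < radius" using norm_triangle_ineq2[of Y S] by (simp add: dist_norm)
    then show "f (smooth_retr Y) = pullback r f X Y"
      by (simp add: pullback_def retr_eq_smooth_retr[OF choice Y(1) ball_near])
  qed (rule ST)
qed

lemma pullback_grad_in_T: "pullback_grad S \<in> T"
  unfolding pullback_grad_def by (rule projT_in_tangent_space)

lemma gradient_on_pullback:
  assumes "S \<in> T" "norm S < radius"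
  shows "gradient_on T (pullback r f X) S = pullback_grad S"
  by (rule gradient_on_eqI[OF subspace_tangent_space assms(1) pullback_grad_in_T
      pullback_has_derivative[OF assms]])

lemma zero_in_T: "0 \<in> T"
  using subspace_tangent_space by (rule subspace_0)

lemma gradient_on_pullback_zero: "gradient_on T (pullback r f X) 0 = projT (grad f X)"
  using gradient_on_pullback[OF zero_in_T] radius_pos
  by (simp add: pullback_grad_def smooth_retr_zero)

text \<open>The product rule for \<open>pullback_grad\<close> at 0: \<open>inv_core\<close> becomes
  \<open>pinv\<close>, and the term with two factors vanishing at 0 contributes nothing.\<close>

definition "pullback_hess E = projT (hess f X E + normal 0 ** transpose (pinv ** E)
  + transpose (E ** pinv) ** normal 0)"

lemma pullback_grad_has_derivative: "(pullback_grad has_derivative pullback_hess) (at 0 within T)"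
proof -
  have r0: "norm (0 :: real^'a^'a) < radius" using radius_pos by simp
  note id = has_derivative_ident[of "at 0 within T"]
  have R: "(smooth_retr has_derivative (\<lambda>E. E)) (at 0 within T)"
    using smooth_retr_has_derivative[OF r0] by simp
  have "(grad f has_derivative hess f X) (at (smooth_retr 0))"
    unfolding smooth_retr_zero by (rule grad_deriv)
  note G = has_derivative_compose[OF R this]
  note N = bounded_linear.has_derivative[OF bounded_linear_perp G, folded normal_def]
  note W = inv_core_has_derivative[OF r0, of T]
  have WS: "((\<lambda>S. transpose (inv_core S ** S)) has_derivative (\<lambda>E. transpose (pinv ** E))) (at 0 within T)"
    using bounded_linear.has_derivative[OF bounded_linear_transpose mat_mult.FDERIV[OF W id]]
    by (simp add: inv_core_zero)
  have SW: "((\<lambda>S. transpose (S ** inv_core S)) has_derivative (\<lambda>E. transpose (E ** pinv))) (at 0 within T)"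
    using bounded_linear.has_derivative[OF bounded_linear_transpose mat_mult.FDERIV[OF id W]]
    by (simp add: inv_core_zero)
  note SWN = mat_mult.FDERIV[OF SW N]
  note full = bounded_linear.has_derivative[OF bounded_linear_projT
      has_derivative_diff[OF has_derivative_add[OF has_derivative_add[OF G mat_mult.FDERIV[OF N WS]] SWN]
        mat_mult.FDERIV[OF SWN WS]]]
  show ?thesis
    using full unfolding pullback_grad_def[abs_def, symmetric]
    by (rule has_derivative_eq_rhs) (simp add: pullback_hess_def fun_eq_iff)
qed

lemma gradient_on_pullback_has_derivative:
  "(gradient_on T (pullback r f X) has_derivative pullback_hess) (at 0 within T)"
proof (rule has_derivative_transform_within[OF pullback_grad_has_derivative radius_pos zero_in_T])
  fix Y assume "Y \<in> T" "dist Y 0 < radius"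
  then show "pullback_grad Y = gradient_on T (pullback r f X) Y"
    by (simp add: gradient_on_pullback)
qed

text \<open>Moved to the other side of the inner product, the two correction terms become the same
  number, whence the factor 2 in \<open>critical_form\<close>.\<close>

lemma pullback_hess_form:
  assumes "E \<in> T"
  shows "pullback_hess E \<bullet> E = hess f X E \<bullet> E + critical_form (grad f X) E"
proof -
  have "pullback_hess E \<bullet> E = E \<bullet> (hess f X E + normal 0 ** transpose (pinv ** E)
      + transpose (E ** pinv) ** normal 0)"
    unfolding pullback_hess_def using inner_projT[OF assms] by (simp only: inner_commute)
  also have "\<dots> = E \<bullet> hess f X E + (E ** (pinv ** E)) \<bullet> normal 0 + ((E ** pinv) ** E) \<bullet> normal 0"
    by (simp only: inner_add_right inner_matrix_matrix_mult_left[of "E ** pinv"]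
        inner_matrix_matrix_mult_right[of E "pinv ** E"])
  also have "\<dots> = hess f X E \<bullet> E + 2 * (normal 0 \<bullet> (E ** pinv ** E))"
    by (simp add: matrix_mul_assoc inner_commute)
  also have "\<dots> = hess f X E \<bullet> E + critical_form (grad f X) E"
    by (simp add: normal_def smooth_retr_zero inner_perp_perp critical_form_def)
  finally show ?thesis .
qed

lemma lambda_min_pullback_le:
  assumes E: "E \<in> T"
  shows "lambda_min T (hessian_on T (pullback r f X) 0) * (norm E)\<^sup>2
    \<le> hess f X E \<bullet> E + critical_form (grad f X) E"
proof -
  \<comment> \<open>Agreement on T suffices, because the eigenvectors in \<open>lambda_min\<close>
    are taken from T.\<close>
  have "hessian_on T (pullback r f X) 0 A = pullback_hess A" if "A \<in> T" for A
    unfolding hessian_on_def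
    by (rule frechet_derivative_on_subspace[OF subspace_tangent_space zero_in_T that
          gradient_on_pullback_has_derivative])
  then have "{c. \<exists>E\<in>T. E \<noteq> 0 \<and> hessian_on T (pullback r f X) 0 E = c *\<^sub>R E}
      = {c. \<exists>E\<in>T. E \<noteq> 0 \<and> pullback_hess E = c *\<^sub>R E}"
    by (intro Collect_cong bex_cong) auto
  then have "lambda_min T (hessian_on T (pullback r f X) 0) = lambda_min T pullback_hess"
    by (simp only: lambda_min_def)
  also have "\<dots> * (norm E)\<^sup>2 \<le> pullback_hess E \<bullet> E"
  proof (rule lambda_min_le[OF subspace_tangent_space _ _ _ E])
    show "bounded_linear pullback_hess"
      by (rule has_derivative_bounded_linear[OF pullback_grad_has_derivative])
    show "pullback_hess A \<in> T" for A
      unfolding pullback_hess_def by (rule projT_in_tangent_space)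
    fix A B assume "A \<in> T" "B \<in> T"
    then show "A \<bullet> pullback_hess B = B \<bullet> pullback_hess A"
      by (intro second_derivative_symmetric_on_subspace[OF subspace_tangent_space radius_pos
            pullback_has_derivative pullback_grad_has_derivative])
  qed
  finally show ?thesis by (simp only: pullback_hess_form[OF E])
qed

lemma second_order_point_distance_le:
  assumes "second_order_local_minimizer r f \<epsilon> ((3 * \<mu> - L) / 4) X"
  shows "(3 * \<mu> - L) / 4 * norm (X - Xs) \<le> \<epsilon>"
proof (rule distance_le)
  show "norm (projT (grad f X)) \<le> \<epsilon>"
    using assms by (simp add: second_order_local_minimizer_def gradient_on_pullback_zero)
  fix E assume E: "E \<in> T"
  have "- ((3 * \<mu> - L) / 4) * (norm E)\<^sup>2 \<le> lambda_min T (hessian_on T (pullback r f X) 0) * (norm E)\<^sup>2"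
    using assms by (intro mult_right_mono) (auto simp: second_order_local_minimizer_def)
  then show "- ((3 * \<mu> - L) / 4) * (norm E)\<^sup>2 \<le> hess f X E \<bullet> E + critical_form (grad f X) E"
    using lambda_min_pullback_le[OF E] by linarith
qed

text \<open>Near t = 0 the retraction of t E is feasible and close to X, so the pullback restricted
  to this line has a one-variable local minimum at 0.\<close>

lemma local_minimizer_conditions:
  assumes "local_minimizer_on f {X. rank X \<le> r} X" and E: "E \<in> T"
  shows "E \<bullet> projT (grad f X) = 0" "0 \<le> hess f X E \<bullet> E + critical_form (grad f X) E"
proof -
  obtain e where e: "0 < e" "\<And>Y. rank Y \<le> r \<Longrightarrow> dist Y X < e \<Longrightarrow> f X \<le> f Y"
    using assms(1) by (auto simp: local_minimizer_on_def)
  have r0: "norm (0 :: real^'a^'a) < radius" using radius_pos by simp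
  have "continuous (at 0 within T) smooth_retr"
    by (rule has_derivative_continuous[OF smooth_retr_has_derivative[OF r0]])
  then obtain d1 where d1: "0 < d1" "\<And>S. S \<in> T \<Longrightarrow> dist S 0 < d1 \<Longrightarrow> dist (smooth_retr S) X < e"
    using e(1) unfolding continuous_within_eps_delta smooth_retr_zero by blast
  define d where "d = min radius d1 / (norm E + 1)"
  have d: "0 < d" using radius_pos d1 by (simp add: d_def add_nonneg_pos)
  have inT: "t *\<^sub>R E \<in> T" for t by (intro subspace_scale subspace_tangent_space E)
  have small: "norm (t *\<^sub>R E) < radius" "norm (t *\<^sub>R E) < d1" if "\<bar>t\<bar> < d" for t
  proof -
    have "\<bar>t\<bar> * norm E \<le> \<bar>t\<bar> * (norm E + 1)" by (intro mult_left_mono) auto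
    also have "\<dots> < d * (norm E + 1)" using that by (intro mult_strict_right_mono) (auto simp: add_nonneg_pos)
    also have "norm E + 1 \<noteq> 0" using norm_ge_zero[of E] by linarith
    then have "d * (norm E + 1) = min radius d1" by (simp add: d_def)
    finally show "norm (t *\<^sub>R E) < radius" "norm (t *\<^sub>R E) < d1" by simp_all
  qed
  let ?\<phi> = "\<lambda>t. pullback r f X (0 + t *\<^sub>R E)" and ?\<phi>' = "\<lambda>t. E \<bullet> pullback_grad (0 + t *\<^sub>R E)"
  have 1: "(?\<phi> has_real_derivative ?\<phi>' t) (at t)" if "\<bar>t\<bar> < d" for t
    unfolding has_real_derivative_iff_has_vector_derivative
    by (rule has_vector_derivative_along_line[OF subspace_tangent_space zero_in_T E])
       (use pullback_has_derivative[OF inT small(1)[OF that]] in simp)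
  have "((\<lambda>t. pullback_grad (0 + t *\<^sub>R E)) has_vector_derivative pullback_hess E) (at 0)"
    by (rule has_vector_derivative_along_line[OF subspace_tangent_space zero_in_T E])
       (use pullback_grad_has_derivative in simp)
  then have 2: "(?\<phi>' has_real_derivative E \<bullet> pullback_hess E) (at 0)"
    unfolding has_real_derivative_iff_has_vector_derivative
    by (rule bounded_linear.has_vector_derivative[OF bounded_linear_inner_right])
  have retr: "retr r X S = smooth_retr S" if "S \<in> T" "norm S < radius" for S
    by (rule retr_eq_smooth_retr[OF choice that(1) ball_near[OF that(2)]])
  have 3: "?\<phi> 0 \<le> ?\<phi> t" if "\<bar>t\<bar> < d" for t
  proof -
    have "?\<phi> 0 = f X" using retr[OF zero_in_T] radius_pos by (simp add: pullback_def smooth_retr_zero)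
    also have "f X \<le> f (retr r X (t *\<^sub>R E))"
    proof (rule e(2))
      show "rank (retr r X (t *\<^sub>R E)) \<le> r" by (rule rank_retr_le) (simp add: rank_X)
      show "dist (retr r X (t *\<^sub>R E)) X < e"
        using d1(2)[OF inT] small[OF that] retr[OF inT] by simp
    qed
    finally show ?thesis by (simp add: pullback_def)
  qed
  from local_min_second_order[OF d 1 2 3]
  have "E \<bullet> pullback_grad 0 = 0" "0 \<le> E \<bullet> pullback_hess E" by simp_all
  then show "E \<bullet> projT (grad f X) = 0" "0 \<le> hess f X E \<bullet> E + critical_form (grad f X) E"
    using pullback_hess_form[OF E]
    by (simp_all add: pullback_grad_def smooth_retr_zero inner_commute)
qed

end

section \<open>Feasibility of the iterates and the conclusions of the theorem\<close>

lemma truncated_svd_rank_le: "truncated_svd r Y Z \<Longrightarrow> rank Z \<le> r"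
  unfolding truncated_svd_def using rank_sum_outer_prod_le[of "{..<r}"]
  by (auto simp: outer.scaleR_left[symmetric])

text \<open>The distance bound at an approximate stationary point needs rank at most r, which that
  alternative of the guarantee does not state.\<close>

lemma rank_pprojgd_iterate_le:
  assumes Pr: "\<And>Y. truncated_svd r Y (Pr Y)" and init: "rank (init p) \<le> r"
  shows "rank (pprojgd_iterate Pr r f p \<omega> k) \<le> r"
proof (induction k)
  case (Suc k)
  then show ?case
    using truncated_svd_rank_le[OF Pr] by (simp add: pprojgd_step_def Let_def rank_retr_le)
qed (simp add: init)

context restricted_objective
begin

lemma exists_retraction_point:
  assumes "rank X = r"
  obtains u s v where "retraction_point f r L \<mu> Xs X u s v"
proof -
  obtain u s v where usv: "(SOME (u, s, v). is_svd X u s v) = (u, s, v)" by (metis prod_cases3)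
  have "\<exists>p. case p of (u, s, v) \<Rightarrow> is_svd X u s v"
    using exists_svd[of X] by auto
  then have "case (SOME (u, s, v). is_svd X u s v) of (u, s, v) \<Rightarrow> is_svd X u s v"
    by (rule someI_ex)
  then have "is_svd X u s v" by (simp add: usv)
  then have "retraction_point f r L \<mu> Xs X u s v"
    using assms r_pos usv by unfold_locales auto
  then show thesis by (rule that)
qed

lemma second_order_minimizer_close:
  assumes "second_order_local_minimizer r f \<epsilon> ((3 * \<mu> - L) / 4) X"
  shows "(3 * \<mu> - L) / 4 * norm (X - Xs) \<le> \<epsilon>"
proof -
  have "rank X = r" using assms by (simp add: second_order_local_minimizer_def)
  then obtain u s v where "retraction_point f r L \<mu> Xs X u s v" by (rule exists_retraction_point)
  then interpret retraction_point f r L \<mu> Xs X u s v .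
  show ?thesis by (rule second_order_point_distance_le[OF assms])
qed

text \<open>Strong convexity bounds \<mu> |X - Xs|^2 by an inner product with the gradient. Only the
  operator norm of the gradient is controlled, and the rank of X - Xs, at most 2r, gives the price
  of passing to the Frobenius norm.\<close>

lemma small_gradient_close:
  assumes X: "rank X \<le> r"
  shows "norm (X - Xs) \<le> onorm ((*v) (grad f X)) * sqrt (2 * real r) / \<mu>"
proof -
  let ?e = "X - Xs" and ?o = "onorm ((*v) (grad f X))"
  have "0 \<le> ?o" by (intro onorm_pos_le matrix_vector_mul_bounded_linear)
  have "rank ?e \<le> 2 * r" using rank_diff_le[of X Xs] X rank_minimizer by linarith
  then have sq: "sqrt (rank ?e) \<le> sqrt (2 * real r)"
    by (metis of_nat_le_iff of_nat_mult of_nat_numeral real_sqrt_le_iff)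
  have "\<mu> * (norm ?e)\<^sup>2 \<le> \<bar>grad f X \<bullet> ?e\<bar>"
    using distance_to_minimizer[OF X] by linarith
  also have "\<dots> \<le> ?o * sqrt (rank ?e) * norm ?e" by (rule inner_le_onorm_rank)
  also have "\<dots> \<le> ?o * sqrt (2 * real r) * norm ?e"
    using sq \<open>0 \<le> ?o\<close> by (intro mult_right_mono mult_left_mono) auto
  finally have "(\<mu> * norm ?e) * norm ?e \<le> (?o * sqrt (2 * real r)) * norm ?e"
    by (simp add: power2_eq_square mult_ac)
  then have "\<mu> * norm ?e \<le> ?o * sqrt (2 * real r)"
    using \<open>0 \<le> ?o\<close> by (cases "norm ?e = 0") (simp_all add: mult_le_cancel_right)
  then show ?thesis using mu_pos by (simp add: pos_le_divide_eq mult.commute)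
qed

text \<open>At rank r the conditions of \<open>distance_le\<close> hold with \<epsilon> = 0, as
  3\<mu> - L is positive and the Hessian form is nonnegative. Lower rank is treated without the
  retraction.\<close>

lemma local_minimizer_unique:
  assumes lm: "local_minimizer_on f {X. rank X \<le> r} X" and L: "L < 3 * \<mu>"
  shows "X = Xs"
proof (cases "rank X = r")
  case True
  then obtain u s v where "retraction_point f r L \<mu> Xs X u s v" by (rule exists_retraction_point)
  then interpret retraction_point f r L \<mu> Xs X u s v .
  have "(3 * \<mu> - L) / 4 * norm (X - Xs) \<le> 0"
  proof (rule distance_le)
    have "projT (grad f X) = 0"
      by (rule inner_tangent_eqI[OF local_minimizer_conditions(1)[OF lm] projT_in_tangent_space])
    then show "norm (projT (grad f X)) \<le> 0" by simp
    fix E assume "E \<in> T"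
    have "- ((3 * \<mu> - L) / 4) * (norm E)\<^sup>2 \<le> 0" using L by (intro mult_nonpos_nonneg) auto
    then show "- ((3 * \<mu> - L) / 4) * (norm E)\<^sup>2 \<le> hess f X E \<bullet> E + critical_form (grad f X) E"
      using local_minimizer_conditions(2)[OF lm \<open>E \<in> T\<close>] by linarith
  qed
  then show ?thesis using L by (simp add: mult_le_0_iff)
next
  case False
  obtain e where rk: "rank X \<le> r" and e: "0 < e" "\<And>Y. rank Y \<le> r \<Longrightarrow> dist Y X < e \<Longrightarrow> f X \<le> f Y"
    using lm by (auto simp: local_minimizer_on_def)
  \<comment> \<open>Below rank r, adding any rank-one matrix keeps X feasible, so every entry of the
    gradient must vanish.\<close>
  have "a \<bullet> (grad f X *v b) = 0" for a b
  proof -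
    let ?E = "outer_prod a b"
    define d where "d = e / (norm ?E + 1)"
    have d: "0 < d" using e(1) by (simp add: d_def add_nonneg_pos)
    have "((\<lambda>t. f (X + t *\<^sub>R ?E)) has_real_derivative ?E \<bullet> grad f X) (at 0)"
      unfolding has_real_derivative_iff_has_vector_derivative
      by (rule has_vector_derivative_along_line[where T = UNIV]) (use f_deriv[of X] in auto)
    moreover have "\<forall>t. \<bar>0 - t\<bar> < d \<longrightarrow> f (X + 0 *\<^sub>R ?E) \<le> f (X + t *\<^sub>R ?E)"
    proof (intro allI impI)
      fix t :: real assume "\<bar>0 - t\<bar> < d"
      then have "\<bar>t\<bar> * (norm ?E + 1) < e"
        by (simp add: d_def pos_less_divide_eq add_nonneg_pos)
      then have "norm (t *\<^sub>R ?E) < e" using abs_ge_zero[of t] by (simp add: distrib_left)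
      moreover have "rank (X + t *\<^sub>R ?E) \<le> r"
        using rank_add_le[of X "t *\<^sub>R ?E"] rank_scaleR_le[of t ?E] rank_outer_prod_le[of a b] rk False
        by linarith
      ultimately show "f (X + 0 *\<^sub>R ?E) \<le> f (X + t *\<^sub>R ?E)"
        using e(2)[of "X + t *\<^sub>R ?E"] by (simp add: dist_norm)
    qed
    ultimately have "?E \<bullet> grad f X = 0" using d by (intro DERIV_local_min)
    then show ?thesis by (simp add: inner_commute[of ?E] inner_outer_prod)
  qed
  then have "grad f X *v b = 0" for b by (metis inner_eq_zero_iff)
  then have "grad f X = 0" by (simp add: matrix_eq)
  then have "\<mu> * (norm (X - Xs))\<^sup>2 \<le> 0" using distance_to_minimizer[OF rk] by simp
  then show ?thesis using mu_pos by (simp add: mult_le_0_iff)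
qed

end

theorem corollary1:
  fixes f :: "real^'n^'n \<Rightarrow> real" and Xs :: "real^'n^'n"
    and r :: nat and L \<mu> \<rho> :: real
  assumes "1 \<le> r" and "r < CARD('n)"
    and "0 < \<mu>" and "\<mu> \<le> L"
    and "twice_differentiable f"
    and "assumption_A1 r L \<mu> f"
    and "assumption_A2 r f Xs"
    and "assumption_A3 r \<rho> f"
    and "L / \<mu> < 3"
  shows
    "(\<forall>X. local_minimizer_on f {X. rank X \<le> r} X \<longleftrightarrow> X = Xs) \<and>
     (\<forall>\<epsilon> X. second_order_local_minimizer r f \<epsilon> ((3 * \<mu> - L) / 4) X \<longrightarrow>
        norm (X - Xs) \<le> 4 * \<epsilon> / (3 * \<mu> - L)) \<and>
     (\<forall>C Pr. 0 < C \<and> (\<forall>Y. truncated_svd r Y (Pr Y)) \<and> pprojgd_guarantee Pr C r f L \<rho> Xs \<longrightarrow>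
        (\<forall>p chi \<alpha>. admissible_input C r f L \<rho> Xs p ((3 * \<mu> - L) / 4) chi \<alpha> \<longrightarrow>
           pprojgd_reaches Pr r f p (iteration_bound r f \<rho> Xs p chi) (1 - \<alpha>)
             (\<lambda>X. (second_order_local_minimizer r f (improvement p) ((3 * \<mu> - L) / 4) X \<and>
                    singular_value r X \<ge> 2 * threshold p \<and>
                    norm (X - Xs) \<le> 4 * improvement p / (3 * \<mu> - L)) \<or>
                  (onorm ((*v) (grad f X)) < 8 / 3 * (improvement p + threshold p / step_size p) \<and>
                    norm (X - Xs) \<le>
                      8 * sqrt (2 * real r) / (3 * \<mu>) * (improvement p + threshold p / step_size p)))))"
proof -
  interpret restricted_objective f r L \<mu> Xs
    using assms by unfold_locales
  have L: "L < 3 * \<mu>" using assms(3,9) by (simp add: pos_divide_less_eq)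
  have unique: "local_minimizer_on f {X. rank X \<le> r} X \<longleftrightarrow> X = Xs" for X
  proof
    assume "X = Xs"
    then show "local_minimizer_on f {X. rank X \<le> r} X"
      using rank_minimizer minimizer by (auto simp: local_minimizer_on_def intro: exI[of _ 1])
  qed (rule local_minimizer_unique[OF _ L])
  have close: "norm (X - Xs) \<le> 4 * \<epsilon> / (3 * \<mu> - L)"
    if "second_order_local_minimizer r f \<epsilon> ((3 * \<mu> - L) / 4) X" for \<epsilon> X
    using second_order_minimizer_close[OF that] L by (simp add: pos_le_divide_eq mult_ac)
  \<comment> \<open>For iterates, which have rank at most r, the alternatives of the guarantee imply
    the stronger ones pointwise. Hence the same event and the same iteration count serve.\<close>
  have reaches: "pprojgd_reaches Pr r f p (iteration_bound r f \<rho> Xs p chi) (1 - \<alpha>)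
             (\<lambda>X. (second_order_local_minimizer r f (improvement p) ((3 * \<mu> - L) / 4) X \<and>
                    singular_value r X \<ge> 2 * threshold p \<and>
                    norm (X - Xs) \<le> 4 * improvement p / (3 * \<mu> - L)) \<or>
                  (onorm ((*v) (grad f X)) < 8 / 3 * (improvement p + threshold p / step_size p) \<and>
                    norm (X - Xs) \<le>
                      8 * sqrt (2 * real r) / (3 * \<mu>) * (improvement p + threshold p / step_size p)))"
    (is "pprojgd_reaches Pr r f p ?N ?q ?Q")
    if Pr: "\<forall>Y. truncated_svd r Y (Pr Y)" and guarantee: "pprojgd_guarantee Pr C r f L \<rho> Xs"
      and admissible: "admissible_input C r f L \<rho> Xs p ((3 * \<mu> - L) / 4) chi \<alpha>" for C Pr p chi \<alpha>
  proof -
    let ?P = "\<lambda>X. (second_order_local_minimizer r f (improvement p) ((3 * \<mu> - L) / 4) X \<and>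
        singular_value r X \<ge> 2 * threshold p) \<or>
      onorm ((*v) (grad f X)) < 8 / 3 * (improvement p + threshold p / step_size p)"
    have "rank (init p) \<le> r" using admissible by (simp add: admissible_input_def Let_def)
    then have rk: "rank (pprojgd_iterate Pr r f p \<omega> k) \<le> r" for \<omega> k
      using Pr by (intro rank_pprojgd_iterate_le) auto
    have imp: "?Q X" if X: "?P X" "rank X \<le> r" for X
    proof -
      \<comment> \<open>The factor 8/3 comes from the guarantee, and sqrt(2r)/\<mu> from
        \<open>small_gradient_close\<close>.\<close>
      have "norm (X - Xs) \<le> 8 * sqrt (2 * real r) / (3 * \<mu>) * (improvement p + threshold p / step_size p)"
        if "onorm ((*v) (grad f X)) < 8 / 3 * (improvement p + threshold p / step_size p)"
      proof -
        have "norm (X - Xs) \<le> onorm ((*v) (grad f X)) * sqrt (2 * real r) / \<mu>"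
          by (rule small_gradient_close[OF X(2)])
        also have "\<dots> \<le> 8 / 3 * (improvement p + threshold p / step_size p) * sqrt (2 * real r) / \<mu>"
          using that mu_pos by (intro divide_right_mono mult_right_mono) auto
        finally show ?thesis by (simp add: field_simps)
      qed
      then show ?thesis using X close by blast
    qed
    have "pprojgd_reaches Pr r f p ?N ?q ?P"
      using guarantee admissible unfolding pprojgd_guarantee_def by blast
    then show ?thesis
      unfolding pprojgd_reaches_def with_prob_at_least_def using imp rk by meson
  qed
  show ?thesis using unique close reaches by blast
qed

end
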